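(* Let $N\ge 2$, $s\in(0,1)$, and let $\Omega\subset\mathbb{R}^N$ be a bounded domain with $C^2$ boundary. Let $\rho,\eta,\rho_0\in L^\infty(\Omega)$, let $\widetilde{\mu}_1$ be the functional on $L^\infty(\Omega)$ defined in the context, and let $\overline{\mathcal{G}(\rho_0)}$ be the weak* closure in $L^\infty(\Omega)$ of the class of rearrangements $\mathcal{G}(\rho_0)$. Then: (i) the map $\rho\mapsto\widetilde{\mu}_1(\rho)$ is convex on $L^\infty(\Omega)$; (ii) if $\rho$ and $\eta$ are linearly independent and $\widetilde{\mu}_1(\rho),\widetilde{\mu}_1(\eta)>0$, then $$\widetilde{\mu}_1(t\rho+(1-t)\eta)<t\,\widetilde{\mu}_1(\rho)+(1-t)\,\widetilde{\mu}_1(\eta)\quad\text{for all } 0<t<1;$$ (iii) if $\int_\Omega\rho_0\,dx>0$, then the map $\rho\mapsto\widetilde{\mu}_1(\rho)$ is strictly convex on $\overline{\mathcal{G}(\rho_0)}$.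
   Context: $H_0^s(\Omega)=\{u\in H^s(\mathbb{R}^N): u=0 \text{ a.e. in } \mathbb{R}^N\setminus\Omega\}$ is a Hilbert space with inner product $\langle u,v\rangle_{H_0^s(\Omega)}=\int_{\mathbb{R}^{2N}}\frac{(u(x)-u(y))(v(x)-v(y))}{|x-y|^{N+2s}}\,dx\,dy$ and associated norm. For $\rho\in L^\infty(\Omega)$, $G_\rho:H_0^s(\Omega)\to H_0^s(\Omega)$ is the self-adjoint compact linear operator determined by $\langle G_\rho(f),\varphi\rangle_{H_0^s(\Omega)}=\int_\Omega\rho f\varphi\,dx$ for all $f,\varphi\in H_0^s(\Omega)$. If $|\{\rho>0\}|>0$ (where $\{\rho>0\}=\{x\in\Omega:\rho(x)>0\}$ and $|\cdot|$ is Lebesgue measure), $\mu_1(\rho)>0$ denotes the largest positive eigenvalue of $G_\rho$, i.e. $\mu_1(\rho)=\max_{f\in H_0^s(\Omega),\,f\neq0}\frac{\int_\Omega\rho f^2\,dx}{\|f\|^2_{H_0^s(\Omega)}}$. Set $\widetilde{\mu}_1(\rho)=\mu_1(\rho)$ if $|\{\rho>0\}|>0$ and $\widetilde{\mu}_1(\rho)=0$ if $|\{\rho>0\}|=0$. Two measurable functions $f,g:\Omega\to\mathbb{R}$ are rearrangements of one another ($f\sim g$) if $|\{x\in\Omega:f(x)>t\}|=|\{x\in\Omega:g(x)>t\}|$ for all $t\in\mathbb{R}$; $\mathcal{G}(\rho_0)=\{g:\Omega\to\mathbb{R}\text{ measurable}: g\sim\rho_0\}\subset L^\infty(\Omega)$.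 The weak* topology on $L^\infty(\Omega)$ is that of the duality with $L^1(\Omega)$. The set $\overline{\mathcal{G}(\rho_0)}$ is known to be convex. *)

theory Defs
  imports "HOL-Analysis.Analysis"
begin

definition C2_function :: "('a::euclidean_space \<Rightarrow> real) \<Rightarrow> bool" where
  "C2_function \<gamma> \<longleftrightarrow>
     (\<exists>(D :: 'a \<Rightarrow> 'a \<Rightarrow>\<^sub>L real) (D2 :: 'a \<Rightarrow> 'a \<Rightarrow>\<^sub>L ('a \<Rightarrow>\<^sub>L real)).
        (\<forall>x. (\<gamma> has_derivative blinfun_apply (D x)) (at x)) \<and>
        (\<forall>x. (D has_derivative blinfun_apply (D2 x)) (at x)) \<and>
        continuous_on UNIV D2)"

(* Near each boundary point the set is the strict epigraph, in some unit direction e, of a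
   C^2 function of the remaining N - 1 coordinates. The argument x - (x . e) e is the
   orthogonal projection onto the hyperplane orthogonal to e, so only the restriction of
   \<gamma> to that hyperplane matters (and every C^2 function on it extends to the space). *)
definition C2_boundary :: "'a::euclidean_space set \<Rightarrow> bool" where
  "C2_boundary \<Omega> \<longleftrightarrow>
     (\<forall>p \<in> frontier \<Omega>. \<exists>r e \<gamma>. 0 < r \<and> norm e = 1 \<and> C2_function \<gamma> \<and>
        \<Omega> \<inter> ball p r = {x \<in> ball p r. \<gamma> (x - (x \<bullet> e) *\<^sub>R e) < x \<bullet> e})"

definition bounded_C2_domain :: "'a::euclidean_space set \<Rightarrow> bool" where
  "bounded_C2_domain \<Omega> \<longleftrightarrow>
     open \<Omega> \<and> connected \<Omega> \<and> \<Omega> \<noteq> {} \<and> bounded \<Omega> \<and> C2_boundary \<Omega>"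

(* Elements of Lebesgue and Sobolev spaces are represented by functions on the whole space,
   identified up to equality almost everywhere (on \<Omega> for the first two sets). Every
   notion below is invariant under this identification. *)

definition Linf :: "'a::euclidean_space set \<Rightarrow> ('a \<Rightarrow> real) set" where
  "Linf \<Omega> = {\<rho>. \<rho> \<in> borel_measurable (lebesgue_on \<Omega>) \<and>
                (\<exists>C. AE x in lebesgue_on \<Omega>. \<bar>\<rho> x\<bar> \<le> C)}"

definition L1 :: "'a::euclidean_space set \<Rightarrow> ('a \<Rightarrow> real) set" where
  "L1 \<Omega> = {\<phi>. integrable (lebesgue_on \<Omega>) \<phi>}"

definition Hs :: "real \<Rightarrow> ('a::euclidean_space \<Rightarrow> real) set" where
  "Hs s = {u. u \<in> borel_measurable lebesgue \<and>
              integrable lebesgue (\<lambda>x. (u x)\<^sup>2) \<and>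
              integrable (lebesgue :: ('a \<times> 'a) measure)
                (\<lambda>(x, y). (u x - u y)\<^sup>2 / norm (x - y) powr (real DIM('a) + 2 * s))}"

definition H0s :: "real \<Rightarrow> 'a::euclidean_space set \<Rightarrow> ('a \<Rightarrow> real) set" where
  "H0s s \<Omega> = {u \<in> Hs s. AE x in lebesgue. x \<notin> \<Omega> \<longrightarrow> u x = 0}"

definition inner_H0s ::
  "real \<Rightarrow> ('a::euclidean_space \<Rightarrow> real) \<Rightarrow> ('a \<Rightarrow> real) \<Rightarrow> real" where
  "inner_H0s s u v =
     integral\<^sup>L (lebesgue :: ('a \<times> 'a) measure)
       (\<lambda>(x, y). (u x - u y) * (v x - v y) / norm (x - y) powr (real DIM('a) + 2 * s))"

(* The graph of the operator G_\<rho>: since the elements of the Hilbert space are classes of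
   functions, this relation between representatives says that g represents G_\<rho>(f). *)
definition is_G ::
  "real \<Rightarrow> 'a::euclidean_space set \<Rightarrow> ('a \<Rightarrow> real) \<Rightarrow> ('a \<Rightarrow> real) \<Rightarrow> ('a \<Rightarrow> real) \<Rightarrow> bool" where
  "is_G s \<Omega> \<rho> f g \<longleftrightarrow> f \<in> H0s s \<Omega> \<and> g \<in> H0s s \<Omega> \<and>
     (\<forall>\<phi> \<in> H0s s \<Omega>. inner_H0s s g \<phi> = (LINT x|lebesgue_on \<Omega>. \<rho> x * f x * \<phi> x))"

(* G_\<rho>(f) = \<mu> f for some f that is nonzero as an element of the Hilbert space *)
definition eigenvalue_G ::
  "real \<Rightarrow> 'a::euclidean_space set \<Rightarrow> ('a \<Rightarrow> real) \<Rightarrow> real \<Rightarrow> bool" where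
  "eigenvalue_G s \<Omega> \<rho> \<mu> \<longleftrightarrow>
     (\<exists>f \<in> H0s s \<Omega>. \<not> (AE x in lebesgue. f x = 0) \<and> is_G s \<Omega> \<rho> f (\<lambda>x. \<mu> * f x))"

definition mu1 :: "real \<Rightarrow> 'a::euclidean_space set \<Rightarrow> ('a \<Rightarrow> real) \<Rightarrow> real" where
  "mu1 s \<Omega> \<rho> = (GREATEST \<mu>. 0 < \<mu> \<and> eigenvalue_G s \<Omega> \<rho> \<mu>)"

definition mu1_tilde :: "real \<Rightarrow> 'a::euclidean_space set \<Rightarrow> ('a \<Rightarrow> real) \<Rightarrow> real" where
  "mu1_tilde s \<Omega> \<rho> =
     (if emeasure lebesgue {x \<in> \<Omega>. \<rho> x > 0} > 0 then mu1 s \<Omega> \<rho> else 0)"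

definition rearrangements :: "'a::euclidean_space set \<Rightarrow> ('a \<Rightarrow> real) \<Rightarrow> ('a \<Rightarrow> real) set" where
  "rearrangements \<Omega> \<rho>0 = {g. g \<in> borel_measurable (lebesgue_on \<Omega>) \<and>
     (\<forall>t. emeasure lebesgue {x \<in> \<Omega>. g x > t} = emeasure lebesgue {x \<in> \<Omega>. \<rho>0 x > t})}"

(* The coarsest topology on L^\<infinity>(\<Omega>) making all pairings with L^1(\<Omega>) continuous.
   Functions that agree almost everywhere on \<Omega> are topologically indistinguishable. *)
definition weak_star :: "'a::euclidean_space set \<Rightarrow> ('a \<Rightarrow> real) topology" where
  "weak_star \<Omega> = topology_generated_by
     {{\<rho> \<in> Linf \<Omega>. (LINT x|lebesgue_on \<Omega>. \<rho> x * \<phi> x) \<in> U} | \<phi> U. \<phi> \<in> L1 \<Omega> \<and> open U}"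

definition lin_indep :: "'a::euclidean_space set \<Rightarrow> ('a \<Rightarrow> real) \<Rightarrow> ('a \<Rightarrow> real) \<Rightarrow> bool" where
  "lin_indep \<Omega> \<rho> \<eta> \<longleftrightarrow>
     (\<forall>a b. (AE x in lebesgue_on \<Omega>. a * \<rho> x + b * \<eta> x = 0) \<longrightarrow> a = 0 \<and> b = 0)"

end

theory Submission
  imports Defs
begin

text \<open>For a bounded weight \<open>\<rho>\<close> the number \<open>mu1_tilde\<close> is the larger of 0 and the supremum of the
Rayleigh quotient \<open>\<integral>\<rho>u\<^sup>2 / [u]\<^sup>2\<close>, where \<open>[u]\<^sup>2\<close> is the Gagliardo form (\<open>mu1_tilde_upper\<close>,
\<open>mu1_tilde_attained\<close>). For fixed \<open>u\<close> the quotient is linear in \<open>\<rho>\<close>, so convexity is the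
convexity of a supremum of linear functionals. For strictness let \<open>f\<close> be a maximiser for the
intermediate weight. If equality held, \<open>f\<close> would maximise both quotients, so it would satisfy the
Euler-Lagrange equations of \<open>\<rho>\<close> and of \<open>\<eta>\<close> with the same left-hand side up to the factors
\<open>r = mu1_tilde \<rho>\<close> and \<open>e = mu1_tilde \<eta>\<close>; hence \<open>(e\<rho> - r\<eta>) f = 0\<close> almost everywhere on the
domain. Since \<open>f\<close> can be chosen positive almost everywhere, \<open>\<rho>\<close> and \<open>\<eta>\<close> are dependent. On the
closure of a rearrangement class all weights have the same integral as \<open>\<rho>0\<close>; when that is
positive, two dependent elements coincide, so strict convexity there is a special case.

Two analytic facts carry this argument.

Existence of a maximiser (\<open>rayleigh_maximizer_exists\<close>). The deficit
\<open>Q u = \<mu>[u]\<^sup>2 - \<integral>\<rho>u\<^sup>2\<close> is a nonnegative quadratic form when \<open>\<mu>\<close> is the supremum, so along a normalised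
maximising sequence \<open>Q (f m - f n) \<le> 2 Q (f m) + 2 Q (f n)\<close> tends to 0. A Poincare inequality on the
cells of one sufficiently fine cubical grid bounds \<open>\<integral>u\<^sup>2\<close> by a small multiple of \<open>[u]\<^sup>2\<close> plus
finitely many squared cell integrals (\<open>H0s_cell_poincare\<close>). Once a subsequence makes these
finitely many integrals converge, the small multiple is absorbed by \<open>\<mu>[u]\<^sup>2\<close> and the
sequence is Cauchy for \<open>[.]\<close>. Its strong limit, which exists by completeness (\<open>H0s_complete\<close>), attains
the maximum.

Positivity (\<open>nonneg_solution_positive\<close>). If a nonnegative solution \<open>f\<close> vanished on a set of
positive measure, choose a compact \<open>K\<close> of positive measure in that set and a Lipschitz bump \<open>\<psi>\<close>
with \<open>\<psi> = 1\<close> on \<open>K\<close>, and test the equation with the positive part of \<open>\<psi> - f/\<epsilon>\<close>. Nonlocality produces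
the interaction between \<open>K\<close>, where the test function is 1, and the region where \<open>f\<close> is large; it
bounds \<open>|K| \<integral>f\<close> by a multiple of \<open>\<epsilon>\<close>, and therefore \<open>f\<close> is zero.\<close>

section \<open>Lebesgue measure on product spaces\<close>

text \<open>Lebesgue measure on the product space is only the completion of the product of the two Lebesgue
measures, so its sections need not be measurable and Fubini's theorem does not apply to it
directly. What is needed survives: null sets lift to cylinders, and functions of one coordinate
can be replaced by Borel versions.\<close>

lemma AE_lebesgue_fst:
  assumes "AE x in (lebesgue :: 'a::euclidean_space measure). P x"
  shows "AE p in (lebesgue :: ('a \<times> 'b::euclidean_space) measure). P (fst p)"
proof -
  from assms have "AE x in (lborel :: 'a measure). P x"
    by (simp add: AE_completion_iff)
  then obtain N where N: "N \<in> null_sets (lborel :: 'a measure)" "{x. \<not> P x} \<subseteq> N"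
    by (auto elim!: AE_E simp: null_sets_def)
  have "N \<times> (UNIV :: 'b set) \<in> null_sets (lborel \<Otimes>\<^sub>M lborel)"
    by (rule lborel.times_in_null_sets1) (use N in auto)
  then have "N \<times> (UNIV :: 'b set) \<in> null_sets lborel" by (simp add: lborel_prod)
  then have "AE p in (lborel :: ('a \<times> 'b) measure). P (fst p)"
    by (rule AE_I') (use N in auto)
  then show ?thesis by (simp add: AE_completion_iff)
qed

lemma AE_lebesgue_snd:
  assumes "AE x in (lebesgue :: 'b::euclidean_space measure). P x"
  shows "AE p in (lebesgue :: ('a::euclidean_space \<times> 'b) measure). P (snd p)"
proof -
  from assms have "AE x in (lborel :: 'b measure). P x"
    by (simp add: AE_completion_iff)
  then obtain N where N: "N \<in> null_sets (lborel :: 'b measure)" "{x. \<not> P x} \<subseteq> N"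
    by (auto elim!: AE_E simp: null_sets_def)
  have "(UNIV :: 'a set) \<times> N \<in> null_sets (lborel \<Otimes>\<^sub>M lborel)"
    by (rule lborel.times_in_null_sets2) (use N in auto)
  then have "(UNIV :: 'a set) \<times> N \<in> null_sets lborel" by (simp add: lborel_prod)
  then have "AE p in (lborel :: ('a \<times> 'b) measure). P (snd p)"
    by (rule AE_I') (use N in auto)
  then show ?thesis by (simp add: AE_completion_iff)
qed

lemma measurable_lebesgue_fst [measurable]:
  "fst \<in> (lebesgue :: ('a::euclidean_space \<times> 'b::euclidean_space) measure) \<rightarrow>\<^sub>M lebesgue"
proof (rule completion.measurable_completion2)
  show *: "fst \<in> (lebesgue :: ('a \<times> 'b) measure) \<rightarrow>\<^sub>M lborel"
    by (rule measurable_completion) (simp add: borel_prod[symmetric] measurable_fst cong: measurable_cong_sets)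
  show "null_sets lborel \<subseteq> null_sets (distr (lebesgue :: ('a \<times> 'b) measure) lborel fst)"
  proof
    fix N :: "'a set" assume N: "N \<in> null_sets lborel"
    then have "AE x in (lebesgue :: 'a measure). x \<notin> N"
      by (simp add: AE_completion_iff AE_not_in)
    from AE_lebesgue_fst[OF this] have "AE p in (lebesgue :: ('a \<times> 'b) measure). fst p \<notin> N" .
    then show "N \<in> null_sets (distr (lebesgue :: ('a \<times> 'b) measure) lborel fst)"
      using N by (subst null_sets_distr_iff[OF *]) (auto simp: completion.AE_iff_null_sets vimage_def)
  qed
qed

lemma measurable_lebesgue_snd [measurable]:
  "snd \<in> (lebesgue :: ('a::euclidean_space \<times> 'b::euclidean_space) measure) \<rightarrow>\<^sub>M lebesgue"
proof (rule completion.measurable_completion2)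
  show *: "snd \<in> (lebesgue :: ('a \<times> 'b) measure) \<rightarrow>\<^sub>M lborel"
    by (rule measurable_completion) (simp add: borel_prod[symmetric] measurable_snd cong: measurable_cong_sets)
  show "null_sets lborel \<subseteq> null_sets (distr (lebesgue :: ('a \<times> 'b) measure) lborel snd)"
  proof
    fix N :: "'b set" assume N: "N \<in> null_sets lborel"
    then have "AE x in (lebesgue :: 'b measure). x \<notin> N"
      by (simp add: AE_completion_iff AE_not_in)
    from AE_lebesgue_snd[OF this] have "AE p in (lebesgue :: ('a \<times> 'b) measure). snd p \<notin> N" .
    then show "N \<in> null_sets (distr (lebesgue :: ('a \<times> 'b) measure) lborel snd)"
      using N by (subst null_sets_distr_iff[OF *]) (auto simp: completion.AE_iff_null_sets vimage_def)
  qed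
qed

text \<open>Products are the only integrands on the product space that have to be evaluated for merely
Lebesgue measurable factors; both factors are replaced by Borel versions, for which Tonelli
applies.\<close>

lemma nn_integral_tensor:
  fixes f :: "'a::euclidean_space \<Rightarrow> ennreal" and g :: "'b::euclidean_space \<Rightarrow> ennreal"
  assumes f: "f \<in> borel_measurable lebesgue" and g: "g \<in> borel_measurable lebesgue"
  shows "(\<integral>\<^sup>+p. f (fst p) * g (snd p) \<partial>lebesgue) = (\<integral>\<^sup>+x. f x \<partial>lebesgue) * (\<integral>\<^sup>+y. g y \<partial>lebesgue)"
proof -
  obtain f' where f'[measurable]: "f' \<in> borel_measurable lborel" and ff: "AE x in lborel. f x = f' x"
    using completion_ex_borel_measurable[OF f] by auto
  obtain g' where g'[measurable]: "g' \<in> borel_measurable lborel" and gg: "AE x in lborel. g x = g' x"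
    using completion_ex_borel_measurable[OF g] by auto
  have 1: "AE p in (lebesgue :: ('a \<times> 'b) measure). f (fst p) = f' (fst p)"
    by (rule AE_lebesgue_fst) (simp add: AE_completion_iff ff)
  have 2: "AE p in (lebesgue :: ('a \<times> 'b) measure). g (snd p) = g' (snd p)"
    by (rule AE_lebesgue_snd) (simp add: AE_completion_iff gg)
  have "(\<integral>\<^sup>+p. f (fst p) * g (snd p) \<partial>lebesgue) = (\<integral>\<^sup>+p. f' (fst p) * g' (snd p) \<partial>(lebesgue :: ('a \<times> 'b) measure))"
    by (rule nn_integral_cong_AE) (use 1 2 in eventually_elim, simp)
  also have "\<dots> = (\<integral>\<^sup>+p. f' (fst p) * g' (snd p) \<partial>(lborel \<Otimes>\<^sub>M lborel))"
    by (simp add: nn_integral_completion lborel_prod)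
  also have "\<dots> = (\<integral>\<^sup>+x. \<integral>\<^sup>+y. f' x * g' y \<partial>lborel \<partial>lborel)"
    by (subst lborel.nn_integral_fst[symmetric]) auto
  also have "\<dots> = (\<integral>\<^sup>+x. f' x \<partial>lborel) * (\<integral>\<^sup>+y. g' y \<partial>lborel)"
    by (simp add: nn_integral_cmult nn_integral_multc)
  also have "(\<integral>\<^sup>+x. f' x \<partial>lborel) = (\<integral>\<^sup>+x. f x \<partial>lebesgue)"
    unfolding nn_integral_completion by (rule nn_integral_cong_AE) (use ff in eventually_elim, simp)
  also have "(\<integral>\<^sup>+x. g' x \<partial>lborel) = (\<integral>\<^sup>+x. g x \<partial>lebesgue)"
    unfolding nn_integral_completion by (rule nn_integral_cong_AE) (use gg in eventually_elim, simp)
  finally show ?thesis .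
qed

lemma integral_tensor:
  fixes f :: "'a::euclidean_space \<Rightarrow> real" and g :: "'b::euclidean_space \<Rightarrow> real"
  assumes f: "integrable lebesgue f" and g: "integrable lebesgue g"
  shows integrable_tensor: "integrable lebesgue (\<lambda>p. f (fst p) * g (snd p))"
    and "(\<integral>p. f (fst p) * g (snd p) \<partial>lebesgue) = (\<integral>x. f x \<partial>lebesgue) * (\<integral>y. g y \<partial>lebesgue)"
proof -
  note [measurable] = borel_measurable_integrable[OF f] borel_measurable_integrable[OF g]
  have fin: "(\<integral>\<^sup>+x. norm (f x) \<partial>lebesgue) < \<infinity>" "(\<integral>\<^sup>+x. norm (g x) \<partial>lebesgue) < \<infinity>"
    using f g by (auto simp: integrable_iff_bounded)
  show I: "integrable lebesgue (\<lambda>p. f (fst p) * g (snd p))"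
  proof (rule integrableI_bounded)
    have "(\<integral>\<^sup>+p. norm (f (fst p) * g (snd p)) \<partial>lebesgue)
        = (\<integral>\<^sup>+p. ennreal (norm (f (fst p))) * ennreal (norm (g (snd p))) \<partial>lebesgue)"
      by (simp add: abs_mult ennreal_mult)
    also have "\<dots> = (\<integral>\<^sup>+x. norm (f x) \<partial>lebesgue) * (\<integral>\<^sup>+y. norm (g y) \<partial>lebesgue)"
      by (rule nn_integral_tensor) auto
    also have "\<dots> < \<infinity>" using fin by (simp add: ennreal_mult_less_top)
    finally show "(\<integral>\<^sup>+p. norm (f (fst p) * g (snd p)) \<partial>lebesgue) < \<infinity>" .
  qed measurable
  obtain f' where f'[measurable]: "f' \<in> borel_measurable lborel" and ff: "AE x in lborel. f x = f' x"
    using completion_ex_borel_measurable_real[of f lborel] by auto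
  obtain g' where g'[measurable]: "g' \<in> borel_measurable lborel" and gg: "AE x in lborel. g x = g' x"
    using completion_ex_borel_measurable_real[of g lborel] by auto
  have 1: "AE p in (lebesgue :: ('a \<times> 'b) measure). f (fst p) = f' (fst p)"
    by (rule AE_lebesgue_fst) (simp add: AE_completion_iff ff)
  have 2: "AE p in (lebesgue :: ('a \<times> 'b) measure). g (snd p) = g' (snd p)"
    by (rule AE_lebesgue_snd) (simp add: AE_completion_iff gg)
  have meas: "(\<lambda>p. f' (fst p) * g' (snd p)) \<in> borel_measurable (lborel \<Otimes>\<^sub>M lborel)"
    by measurable
  then have meas': "(\<lambda>p. f' (fst p) * g' (snd p)) \<in> borel_measurable lborel"
    by (simp add: lborel_prod)
  have "integrable lebesgue (\<lambda>p. f' (fst p) * g' (snd p))"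
  proof (rule iffD1[OF integrable_cong_AE I])
    show "AE p in lebesgue. f (fst p) * g (snd p) = f' (fst p) * g' (snd p)"
      using 1 2 by eventually_elim simp
    show "(\<lambda>p. f' (fst p) * g' (snd p)) \<in> borel_measurable lebesgue"
      using meas' by (rule measurable_completion)
  qed auto
  then have I': "integrable (lborel \<Otimes>\<^sub>M lborel) (\<lambda>p. f' (fst p) * g' (snd p))"
    using meas' by (simp add: integrable_completion lborel_prod)
  have "(\<integral>p. f (fst p) * g (snd p) \<partial>lebesgue) = (\<integral>p. f' (fst p) * g' (snd p) \<partial>(lebesgue :: ('a \<times> 'b) measure))"
  proof (rule integral_cong_AE)
    show "AE p in lebesgue. f (fst p) * g (snd p) = f' (fst p) * g' (snd p)"
      using 1 2 by eventually_elim simp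
    show "(\<lambda>p. f' (fst p) * g' (snd p)) \<in> borel_measurable lebesgue"
      using meas' by (rule measurable_completion)
  qed auto
  also have "\<dots> = (\<integral>p. f' (fst p) * g' (snd p) \<partial>(lborel \<Otimes>\<^sub>M lborel))"
    using meas' by (simp add: integral_completion lborel_prod)
  also have "\<dots> = (\<integral>x. \<integral>y. f' x * g' y \<partial>lborel \<partial>lborel)"
    using lborel_pair.integral_fst'[OF I'] by simp
  also have "\<dots> = (\<integral>x. f' x \<partial>lborel) * (\<integral>y. g' y \<partial>lborel)"
    by simp
  also have "(\<integral>x. f' x \<partial>lborel) = (\<integral>x. f' x \<partial>lebesgue)"
    using f' by (simp add: integral_completion)
  also have "\<dots> = (\<integral>x. f x \<partial>lebesgue)"
    by (rule integral_cong_AE) (use ff in \<open>auto simp: AE_completion_iff eq_commute intro: measurable_completion\<close>)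
  also have "(\<integral>x. g' x \<partial>lborel) = (\<integral>x. g' x \<partial>lebesgue)"
    using g' by (simp add: integral_completion)
  also have "\<dots> = (\<integral>x. g x \<partial>lebesgue)"
    by (rule integral_cong_AE) (use gg in \<open>auto simp: AE_completion_iff eq_commute intro: measurable_completion\<close>)
  finally show "(\<integral>p. f (fst p) * g (snd p) \<partial>lebesgue) = (\<integral>x. f x \<partial>lebesgue) * (\<integral>y. g y \<partial>lebesgue)" .
qed

section \<open>Square integrable functions and the Gagliardo form\<close>

definition sq_integrable :: "'b measure \<Rightarrow> ('b \<Rightarrow> real) \<Rightarrow> bool" where
  "sq_integrable M f \<longleftrightarrow> f \<in> borel_measurable M \<and> integrable M (\<lambda>x. (f x)\<^sup>2)"

lemma sq_integrable_mult:
  assumes "sq_integrable M f" "sq_integrable M g"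
  shows "integrable M (\<lambda>x. f x * g x)"
proof (rule Bochner_Integration.integrable_bound[of M "\<lambda>x. (f x)\<^sup>2 + (g x)\<^sup>2"])
  show "integrable M (\<lambda>x. (f x)\<^sup>2 + (g x)\<^sup>2)" "(\<lambda>x. f x * g x) \<in> borel_measurable M"
    using assms by (auto simp: sq_integrable_def)
  have "\<bar>a * b\<bar> \<le> a\<^sup>2 + b\<^sup>2" for a b :: real
  proof -
    have "2 * (\<bar>a\<bar> * \<bar>b\<bar>) \<le> a\<^sup>2 + b\<^sup>2" "0 \<le> \<bar>a\<bar> * \<bar>b\<bar>"
      using sum_squares_bound[of "\<bar>a\<bar>" "\<bar>b\<bar>"] by (simp_all add: mult.assoc)
    then show ?thesis unfolding abs_mult by linarith
  qed
  then show "AE x in M. norm (f x * g x) \<le> norm ((f x)\<^sup>2 + (g x)\<^sup>2)"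
    by (auto simp: abs_mult)
qed

lemma sq_integrable_bound:
  assumes "sq_integrable M f" "g \<in> borel_measurable M" "AE x in M. \<bar>g x\<bar> \<le> \<bar>f x\<bar>"
  shows "sq_integrable M g"
  unfolding sq_integrable_def
proof (safe intro!: assms(2))
  show "integrable M (\<lambda>x. (g x)\<^sup>2)"
  proof (rule Bochner_Integration.integrable_bound[of M "\<lambda>x. (f x)\<^sup>2"])
    show "AE x in M. norm ((g x)\<^sup>2) \<le> norm ((f x)\<^sup>2)"
      using assms(3) by eventually_elim (simp add: abs_le_square_iff)
  qed (use assms in \<open>auto simp: sq_integrable_def\<close>)
qed

lemma sq_integrable_add:
  assumes "sq_integrable M f" "sq_integrable M g"
  shows "sq_integrable M (\<lambda>x. f x + g x)"
  using assms sq_integrable_mult[OF assms] by (auto simp: sq_integrable_def power2_sum mult.assoc)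

lemma sq_integrable_scale:
  assumes "sq_integrable M f"
  shows "sq_integrable M (\<lambda>x. c * f x)"
  using assms by (auto simp: sq_integrable_def power_mult_distrib)

lemma sq_integrable_diff:
  assumes "sq_integrable M f" "sq_integrable M g"
  shows "sq_integrable M (\<lambda>x. f x - g x)"
  using sq_integrable_add[OF assms(1) sq_integrable_scale[OF assms(2), of "-1"]] by simp

text \<open>The kernel is split evenly between the two factors of the Gagliardo form, so that the form becomes
the inner product of \<open>L\<^sup>2\<close> pulled back by a linear map. At \<open>x = y\<close>
the value is 0 because division by 0 yields 0.\<close>

definition diff_quot :: "real \<Rightarrow> ('a::euclidean_space \<Rightarrow> real) \<Rightarrow> 'a \<times> 'a \<Rightarrow> real" where
  "diff_quot s u p = (u (fst p) - u (snd p)) / norm (fst p - snd p) powr ((real DIM('a) + 2 * s) / 2)"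

lemma diff_quot_mult:
  fixes u v :: "'a::euclidean_space \<Rightarrow> real"
  shows "diff_quot s u (x, y) * diff_quot s v (x, y)
    = (u x - u y) * (v x - v y) / norm (x - y) powr (real DIM('a) + 2 * s)"
proof -
  have "norm (x - y) powr ((real DIM('a) + 2 * s) / 2) * norm (x - y) powr ((real DIM('a) + 2 * s) / 2)
      = norm (x - y) powr (real DIM('a) + 2 * s)"
    by (subst powr_add[symmetric]) simp
  then show ?thesis by (simp add: diff_quot_def)
qed

lemma diff_quot_add: "diff_quot s (\<lambda>x. u x + v x) p = diff_quot s u p + diff_quot s v p"
  by (simp add: diff_quot_def add_divide_distrib[symmetric])

lemma diff_quot_diff: "diff_quot s (\<lambda>x. u x - v x) p = diff_quot s u p - diff_quot s v p"
  by (simp add: diff_quot_def diff_divide_distrib[symmetric])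

lemma diff_quot_scale: "diff_quot s (\<lambda>x. c * u x) p = c * diff_quot s u p"
  by (simp add: diff_quot_def right_diff_distrib)

lemma measurable_diff_quot [measurable]:
  fixes u :: "'a::euclidean_space \<Rightarrow> real"
  assumes [measurable]: "u \<in> borel_measurable lebesgue"
  shows "diff_quot s u \<in> borel_measurable lebesgue"
proof -
  have "(\<lambda>p::'a\<times>'a. norm (fst p - snd p)) \<in> borel_measurable borel"
    by (intro borel_measurable_continuous_onI continuous_intros)
  then have [measurable]: "(\<lambda>p::'a\<times>'a. norm (fst p - snd p)) \<in> borel_measurable lebesgue"
    by (intro measurable_completion) auto
  show ?thesis unfolding diff_quot_def[abs_def] by measurable
qed

lemma Hs_iff: "u \<in> Hs s \<longleftrightarrow> sq_integrable lebesgue u \<and> sq_integrable lebesgue (diff_quot s u)"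
proof -
  have "(\<lambda>p. (diff_quot s u p)\<^sup>2) = (\<lambda>(x, y). (u x - u y)\<^sup>2 / norm (x - y) powr (real DIM('a) + 2 * s))"
    by (auto simp: fun_eq_iff power2_eq_square diff_quot_mult)
  then show ?thesis by (auto simp: Hs_def sq_integrable_def)
qed

lemma inner_H0s_diff_quot: "inner_H0s s u v = (\<integral>p. diff_quot s u p * diff_quot s v p \<partial>lebesgue)"
  unfolding inner_H0s_def by (rule Bochner_Integration.integral_cong) (auto simp: diff_quot_mult)

lemma Hs_diff_quot_mult: "u \<in> Hs s \<Longrightarrow> v \<in> Hs s \<Longrightarrow> integrable lebesgue (\<lambda>p. diff_quot s u p * diff_quot s v p)"
  by (auto simp: Hs_iff intro: sq_integrable_mult)

lemma Hs_add: "u \<in> Hs s \<Longrightarrow> v \<in> Hs s \<Longrightarrow> (\<lambda>x. u x + v x) \<in> Hs s"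
  by (auto simp: Hs_iff diff_quot_add[abs_def] sq_integrable_add)

lemma Hs_diff: "u \<in> Hs s \<Longrightarrow> v \<in> Hs s \<Longrightarrow> (\<lambda>x. u x - v x) \<in> Hs s"
  by (auto simp: Hs_iff diff_quot_diff[abs_def] sq_integrable_diff)

lemma Hs_scale: "u \<in> Hs s \<Longrightarrow> (\<lambda>x. c * u x) \<in> Hs s"
  by (auto simp: Hs_iff diff_quot_scale[abs_def] sq_integrable_scale)

lemma abs_diff_quot_abs_le: "\<bar>diff_quot s (\<lambda>x. \<bar>u x\<bar>) p\<bar> \<le> \<bar>diff_quot s u p\<bar>"
  by (auto simp: diff_quot_def abs_div_pos intro!: divide_right_mono abs_triangle_ineq3)

lemma Hs_abs:
  assumes "u \<in> Hs s"
  shows "(\<lambda>x. \<bar>u x\<bar>) \<in> Hs s"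
proof -
  have u: "sq_integrable lebesgue u" "sq_integrable lebesgue (diff_quot s u)" using assms by (auto simp: Hs_iff)
  then have [measurable]: "u \<in> borel_measurable lebesgue" by (simp add: sq_integrable_def)
  have "sq_integrable lebesgue (\<lambda>x. \<bar>u x\<bar>)"
    by (rule sq_integrable_bound[OF u(1)]) auto
  moreover have "sq_integrable lebesgue (diff_quot s (\<lambda>x. \<bar>u x\<bar>))"
    by (rule sq_integrable_bound[OF u(2)]) (auto simp: abs_diff_quot_abs_le)
  ultimately show ?thesis by (simp add: Hs_iff)
qed

lemma H0s_add: "u \<in> H0s s \<Omega> \<Longrightarrow> v \<in> H0s s \<Omega> \<Longrightarrow> (\<lambda>x. u x + v x) \<in> H0s s \<Omega>"
  by (auto simp: H0s_def Hs_add)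

lemma H0s_diff: "u \<in> H0s s \<Omega> \<Longrightarrow> v \<in> H0s s \<Omega> \<Longrightarrow> (\<lambda>x. u x - v x) \<in> H0s s \<Omega>"
  by (auto simp: H0s_def Hs_diff)

lemma H0s_scale: "u \<in> H0s s \<Omega> \<Longrightarrow> (\<lambda>x. c * u x) \<in> H0s s \<Omega>"
  by (auto simp: H0s_def Hs_scale)

lemma H0s_abs: "u \<in> H0s s \<Omega> \<Longrightarrow> (\<lambda>x. \<bar>u x\<bar>) \<in> H0s s \<Omega>"
  by (auto simp: H0s_def Hs_abs)

lemma H0s_pos_part:
  assumes "u \<in> H0s s \<Omega>"
  shows "(\<lambda>x. max 0 (u x)) \<in> H0s s \<Omega>"
proof -
  have "(\<lambda>x. max 0 (u x)) = (\<lambda>x. (1/2) * (u x + \<bar>u x\<bar>))" by (auto simp: max_def)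
  then show ?thesis using H0s_scale[OF H0s_add[OF assms H0s_abs[OF assms]], of "1/2"] by simp
qed

lemma H0s_Hs: "u \<in> H0s s \<Omega> \<Longrightarrow> u \<in> Hs s"
  by (simp add: H0s_def)

lemma H0s_sq: "u \<in> H0s s \<Omega> \<Longrightarrow> sq_integrable lebesgue u"
  by (simp add: H0s_def Hs_iff)

lemma H0s_measurable: "u \<in> H0s s \<Omega> \<Longrightarrow> u \<in> borel_measurable lebesgue"
  by (simp add: H0s_def Hs_def)

lemma inner_H0s_commute: "inner_H0s s u v = inner_H0s s v u"
  by (simp add: inner_H0s_diff_quot mult.commute)

lemma inner_H0s_nonneg: "0 \<le> inner_H0s s u u"
  by (simp add: inner_H0s_diff_quot)

lemma inner_H0s_add_left:
  "\<lbrakk>u \<in> H0s s \<Omega>; v \<in> H0s s \<Omega>; w \<in> H0s s \<Omega>\<rbrakk> \<Longrightarrow>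
    inner_H0s s (\<lambda>x. u x + v x) w = inner_H0s s u w + inner_H0s s v w"
  by (simp add: inner_H0s_diff_quot diff_quot_add distrib_right Hs_diff_quot_mult H0s_Hs)

lemma inner_H0s_diff_left:
  "\<lbrakk>u \<in> H0s s \<Omega>; v \<in> H0s s \<Omega>; w \<in> H0s s \<Omega>\<rbrakk> \<Longrightarrow>
    inner_H0s s (\<lambda>x. u x - v x) w = inner_H0s s u w - inner_H0s s v w"
  by (simp add: inner_H0s_diff_quot diff_quot_diff left_diff_distrib Hs_diff_quot_mult H0s_Hs)

lemma inner_H0s_scale_left: "inner_H0s s (\<lambda>x. c * u x) w = c * inner_H0s s u w"
  by (simp add: inner_H0s_diff_quot diff_quot_scale mult.assoc)

lemma inner_H0s_abs_le:
  assumes "u \<in> H0s s \<Omega>"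
  shows "inner_H0s s (\<lambda>x. \<bar>u x\<bar>) (\<lambda>x. \<bar>u x\<bar>) \<le> inner_H0s s u u"
  unfolding inner_H0s_diff_quot
proof (rule integral_mono)
  show "diff_quot s (\<lambda>x. \<bar>u x\<bar>) p * diff_quot s (\<lambda>x. \<bar>u x\<bar>) p \<le> diff_quot s u p * diff_quot s u p" for p
    using abs_diff_quot_abs_le[of s u p] by (simp add: abs_le_square_iff power2_eq_square[symmetric])
qed (use assms in \<open>auto intro!: Hs_diff_quot_mult H0s_Hs H0s_abs\<close>)

text \<open>Within distance \<open>D\<close> the kernel is at least \<open>D powr -(N + 2s)\<close>; on the
diagonal both sides vanish.\<close>

lemma sq_diff_le_diff_quot:
  fixes u :: "'a::euclidean_space \<Rightarrow> real"
  assumes "0 < s" "dist x y \<le> D"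
  shows "(u x - u y)\<^sup>2 \<le> D powr (real DIM('a) + 2 * s) * (diff_quot s u (x, y))\<^sup>2"
proof (cases "x = y")
  case False
  let ?a = "real DIM('a) + 2 * s"
  have n: "0 < norm (x - y) powr ?a" using False by simp
  have "norm (x - y) powr ?a \<le> D powr ?a"
    using assms by (intro powr_mono2) (auto simp: dist_norm)
  then have "(u x - u y)\<^sup>2 * norm (x - y) powr ?a \<le> (u x - u y)\<^sup>2 * D powr ?a"
    by (intro mult_left_mono) auto
  then show ?thesis using n
    by (simp add: power2_eq_square[of "diff_quot _ _ _"] diff_quot_mult power2_eq_square[of "u x - u y"] field_simps)
qed auto

text \<open>A function of the space vanishes on a ball \<open>E\<close> disjoint from the domain. Keeping only
the pairs with \<open>x\<close> in the domain and \<open>y\<close> in \<open>E\<close>, where the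
difference is \<open>u x\<close> and the kernel is bounded below, already controls the
\<open>L\<^sup>2\<close> norm.\<close>

lemma H0s_poincare:
  fixes \<Omega> :: "'a::euclidean_space set"
  assumes "0 < s" "bounded \<Omega>"
  obtains C where "0 < C" "\<And>u. u \<in> H0s s \<Omega> \<Longrightarrow> (\<integral>x. (u x)\<^sup>2 \<partial>lebesgue) \<le> C * inner_H0s s u u"
proof -
  obtain R where R: "0 < R" "\<Omega> \<subseteq> ball 0 R"
    using assms(2) by (metis bounded_subset_ballD)
  obtain b :: 'a where b: "b \<in> Basis" using nonempty_Basis by blast
  define E where "E = ball ((3 * R) *\<^sub>R b) R"
  have E[measurable]: "E \<in> sets lebesgue" by (simp add: E_def)
  have mE: "0 < measure lebesgue E" using R by (simp add: E_def content_ball_pos)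
  have EO: "y \<notin> \<Omega>" if "y \<in> E" for y
  proof
    assume "y \<in> \<Omega>"
    then have "norm y < R" using R by auto
    moreover have "norm ((3 * R) *\<^sub>R b) \<le> norm y + dist ((3 * R) *\<^sub>R b) y"
      unfolding dist_norm using norm_triangle_ineq[of y "(3 * R) *\<^sub>R b - y"] by simp
    ultimately show False using that b R by (simp add: E_def)
  qed
  have D: "dist x y \<le> 5 * R" if "x \<in> \<Omega>" "y \<in> E" for x y
  proof -
    have "dist x y \<le> dist x 0 + dist 0 y"
      by (rule dist_triangle)
    also have "dist 0 y \<le> dist 0 ((3 * R) *\<^sub>R b) + dist ((3 * R) *\<^sub>R b) y"
      by (rule dist_triangle)
    also have "dist x 0 < R" using that(1) R(2) by auto
    also have "dist ((3 * R) *\<^sub>R b) y < R" using that(2) by (simp add: E_def)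
    also have "dist 0 ((3 * R) *\<^sub>R b) = 3 * R" using b R(1) by simp
    finally show ?thesis by simp
  qed
  define K where "K = (5 * R) powr (real DIM('a) + 2 * s)"
  have K: "0 < K" using R by (simp add: K_def)
  show thesis
  proof (rule that[of "K / measure lebesgue E"])
    show "0 < K / measure lebesgue E" using K mE by simp
    fix u assume u: "u \<in> H0s s \<Omega>"
    note [measurable] = H0s_measurable[OF u]
    have i1: "integrable lebesgue (\<lambda>x. (u x)\<^sup>2)" using H0s_sq[OF u] by (simp add: sq_integrable_def)
    have i2: "integrable lebesgue (\<lambda>y. indicator E y :: real)"
      using lmeasurable_ball[of "(3 * R) *\<^sub>R b" R] by (intro integrable_real_indicator) (auto simp: E_def fmeasurable_def)
    have AE0: "AE x in lebesgue. x \<notin> \<Omega> \<longrightarrow> u x = 0" using u by (simp add: H0s_def)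
    have "(\<integral>x. (u x)\<^sup>2 \<partial>lebesgue) * measure lebesgue E
        = (\<integral>p. (u (fst p))\<^sup>2 * indicator E (snd p) \<partial>lebesgue)"
      using integral_tensor[OF i1 i2] by simp
    also have "\<dots> \<le> (\<integral>p. K * (diff_quot s u p * diff_quot s u p) \<partial>lebesgue)"
    proof (rule integral_mono_AE)
      show "integrable lebesgue (\<lambda>p. (u (fst p))\<^sup>2 * indicator E (snd p) :: real)"
        by (rule integrable_tensor[OF i1 i2])
      show "integrable lebesgue (\<lambda>p. K * (diff_quot s u p * diff_quot s u p))"
        using u by (intro integrable_mult_right Hs_diff_quot_mult H0s_Hs)
      show "AE p in lebesgue. (u (fst p))\<^sup>2 * indicator E (snd p) \<le> K * (diff_quot s u p * diff_quot s u p)"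
        using AE_lebesgue_fst[OF AE0] AE_lebesgue_snd[OF AE0]
      proof eventually_elim
        case (elim p)
        show ?case
        proof (cases "fst p \<in> \<Omega> \<and> snd p \<in> E")
          case True
          then have "u (snd p) = 0" using elim EO by auto
          then show ?thesis
            using True sq_diff_le_diff_quot[OF assms(1) D, of "fst p" "snd p" u]
            by (simp add: K_def power2_eq_square)
        next
          case False
          then have z: "(u (fst p))\<^sup>2 * indicator E (snd p) = (0::real)" using elim by auto
          show ?thesis unfolding z using K by simp
        qed
      qed
    qed
    also have "\<dots> = K * inner_H0s s u u" by (simp add: inner_H0s_diff_quot)
    finally show "(\<integral>x. (u x)\<^sup>2 \<partial>lebesgue) \<le> K / measure lebesgue E * inner_H0s s u u"
      using mE by (simp add: field_simps)
  qed
qed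

section \<open>Compactness at a single scale\<close>

text \<open>The half-open cubes of side \<open>h\<close> whose corners lie on the grid, each indexed by any of
its points: as classes of an equivalence relation they are disjoint without further argument.\<close>

definition cell :: "real \<Rightarrow> 'a::euclidean_space \<Rightarrow> 'a set" where
  "cell h z = {x. \<forall>b\<in>Basis. \<lfloor>x \<bullet> b / h\<rfloor> = \<lfloor>z \<bullet> b / h\<rfloor>}"

lemma cell_self: "z \<in> cell h z"
  by (simp add: cell_def)

lemma cell_eq: "x \<in> cell h z \<Longrightarrow> cell h x = cell h z"
  by (auto simp: cell_def)

lemma mem_cell_iff:
  assumes "0 < h"
  shows "x \<in> cell h z \<longleftrightarrow> (\<forall>b\<in>Basis. h * of_int \<lfloor>z \<bullet> b / h\<rfloor> \<le> x \<bullet> b \<and> x \<bullet> b < h * of_int \<lfloor>z \<bullet> b / h\<rfloor> + h)"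
proof -
  have "\<lfloor>t / h\<rfloor> = k \<longleftrightarrow> h * of_int k \<le> t \<and> t < h * of_int k + h" for t k
    using assms by (simp add: floor_eq_iff field_simps)
  then show ?thesis by (auto simp: cell_def)
qed

lemma
  fixes z :: "'a::euclidean_space"
  assumes h: "0 < h"
  shows cell_lmeasurable: "cell h z \<in> lmeasurable"
    and measure_cell: "measure lebesgue (cell h z) = h ^ DIM('a)"
proof -
  define l where "l = (\<Sum>b\<in>Basis. (h * of_int \<lfloor>z \<bullet> b / h\<rfloor>) *\<^sub>R b)"
  have lb: "l \<bullet> b = h * of_int \<lfloor>z \<bullet> b / h\<rfloor>" if "b \<in> Basis" for b
    using that by (simp add: l_def)
  have c: "cell h z = {x. \<forall>b\<in>Basis. l \<bullet> b \<le> x \<bullet> b \<and> x \<bullet> b < l \<bullet> b + h}"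
    by (auto simp: mem_cell_iff[OF h] lb)
  have "cell h z = (\<Inter>b\<in>Basis. {x. l \<bullet> b \<le> b \<bullet> x} \<inter> {x. b \<bullet> x < l \<bullet> b + h})"
    by (auto simp: c inner_commute)
  also have "\<dots> \<in> sets borel"
    by (intro sets.finite_INT) (auto intro!: sets.Int borel_closed borel_open closed_halfspace_ge open_halfspace_lt)
  finally have sb: "cell h z \<in> sets borel" .
  let ?u = "l + h *\<^sub>R One"
  have sub: "box l ?u \<subseteq> cell h z" "cell h z \<subseteq> cbox l ?u"
    unfolding c by (auto simp: mem_box inner_add_left less_imp_le)
  have pr: "(\<Prod>b\<in>Basis. (?u - l) \<bullet> b) = h ^ DIM('a)" by simp
  have e1: "emeasure lborel (box l ?u) = ennreal (h ^ DIM('a))"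
    using h by (subst emeasure_lborel_box) (auto simp: inner_add_left)
  have e2: "emeasure lborel (cbox l ?u) = ennreal (h ^ DIM('a))"
    using h by (subst emeasure_lborel_cbox) (auto simp: inner_add_left)
  have "emeasure lborel (cell h z) = ennreal (h ^ DIM('a))"
    using emeasure_mono[OF sub(1), of lborel] emeasure_mono[OF sub(2), of lborel] sb e1 e2
    by (intro antisym) auto
  then have e: "emeasure lebesgue (cell h z) = ennreal (h ^ DIM('a))"
    using sb by simp
  show "cell h z \<in> lmeasurable" using sb e by (auto simp: fmeasurable_def)
  show "measure lebesgue (cell h z) = h ^ DIM('a)" using e h by (simp add: measure_def)
qed

lemma dist_in_cell:
  fixes z :: "'a::euclidean_space"
  assumes h: "0 < h" and "x \<in> cell h z" "y \<in> cell h z"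
  shows "dist x y \<le> real DIM('a) * h"
proof -
  have "dist x y \<le> (\<Sum>b\<in>Basis. \<bar>(x - y) \<bullet> b\<bar>)"
    unfolding dist_norm by (rule norm_le_l1)
  also have "\<dots> \<le> (\<Sum>b\<in>(Basis::'a set). h)"
    using assms(2,3) by (intro sum_mono) (fastforce simp: mem_cell_iff[OF h] inner_diff_left abs_if)
  finally show ?thesis by simp
qed

text \<open>A cell is determined by the integer vector of the floors, and on a bounded set these vectors lie
in a finite box.\<close>

lemma finite_cells:
  fixes \<Omega> :: "'a::euclidean_space set"
  assumes h: "0 < h" and "bounded \<Omega>"
  shows "finite (cell h ` \<Omega>)"
proof -
  obtain R where R: "\<And>x. x \<in> \<Omega> \<Longrightarrow> norm x \<le> R" using assms(2) by (auto simp: bounded_iff)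
  define F where "F x = restrict (\<lambda>b. \<lfloor>x \<bullet> b / h\<rfloor>) (Basis :: 'a set)" for x :: 'a
  have "F ` \<Omega> \<subseteq> Basis \<rightarrow>\<^sub>E {\<lfloor>- R / h\<rfloor>..\<lfloor>R / h\<rfloor>}"
  proof
    fix f assume "f \<in> F ` \<Omega>"
    then obtain x where x: "x \<in> \<Omega>" "f = F x" by auto
    have "\<bar>x \<bullet> b\<bar> \<le> R" if "b \<in> Basis" for b
      using Basis_le_norm[OF that, of x] R[OF x(1)] by simp
    then show "f \<in> Basis \<rightarrow>\<^sub>E {\<lfloor>- R / h\<rfloor>..\<lfloor>R / h\<rfloor>}"
      using h by (auto simp: x F_def abs_le_iff intro!: floor_mono divide_right_mono)
        (smt (verit) divide_right_mono floor_mono minus_divide_left)+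
  qed
  then have fin: "finite (F ` \<Omega>)"
    by (rule finite_subset) (intro finite_PiE, auto)
  have "cell h x = cell h y" if "F x = F y" for x y
  proof -
    have "\<lfloor>x \<bullet> b / h\<rfloor> = \<lfloor>y \<bullet> b / h\<rfloor>" if "b \<in> Basis" for b
      using fun_cong[OF \<open>F x = F y\<close>, of b] that by (simp add: F_def)
    then show ?thesis by (simp add: cell_def)
  qed
  then have "cell h x = (\<lambda>f. cell h (SOME y. F y = f)) (F x)" for x
    by (metis (mono_tags, lifting) someI_ex)
  then have "cell h ` \<Omega> = (\<lambda>f. cell h (SOME y. F y = f)) ` F ` \<Omega>"
    by (auto simp: image_image)
  then show ?thesis using fin by simp
qed

lemma integrable_indicator_mult_sq:
  assumes "sq_integrable lebesgue u" "A \<in> lmeasurable"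
  shows "integrable lebesgue (\<lambda>x. indicator A x * u x :: real)"
    and "integrable lebesgue (\<lambda>x. indicator A x * (u x)\<^sup>2 :: real)"
proof -
  have "sq_integrable lebesgue (indicator A :: _ \<Rightarrow> real)"
  proof -
    have "(\<lambda>x. (indicator A x :: real)\<^sup>2) = indicator A" by (auto simp: indicator_def fun_eq_iff)
    then show ?thesis using assms(2) by (auto simp: sq_integrable_def fmeasurable_def)
  qed
  from sq_integrable_mult[OF this assms(1)]
  show "integrable lebesgue (\<lambda>x. indicator A x * u x :: real)" .
  show "integrable lebesgue (\<lambda>x. indicator A x * (u x)\<^sup>2 :: real)"
    using assms by (intro integrable_real_mult_indicator[of A lebesgue "\<lambda>x. (u x)\<^sup>2", simplified mult.commute])
      (auto simp: sq_integrable_def fmeasurable_def)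
qed

text \<open>Integrating \<open>(u x - u y)\<^sup>2\<close> over \<open>A \<times> A\<close> gives \<open>2 |A|
\<integral>\<^sub>A u\<^sup>2 - 2 (\<integral>\<^sub>A u)\<^sup>2\<close>, and the integrand is
bounded by the Gagliardo density since \<open>A\<close> has diameter at most \<open>D\<close>.\<close>

lemma integral_sq_on_set_le:
  fixes u :: "'a::euclidean_space \<Rightarrow> real"
  assumes s: "0 < s" and u: "u \<in> Hs s" and A: "A \<in> lmeasurable" "0 < measure lebesgue A"
    and D: "\<And>x y. x \<in> A \<Longrightarrow> y \<in> A \<Longrightarrow> dist x y \<le> D"
  shows "(\<integral>x. indicator A x * (u x)\<^sup>2 \<partial>lebesgue)
    \<le> (\<integral>x. indicator A x * u x \<partial>lebesgue)\<^sup>2 / measure lebesgue A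
      + D powr (real DIM('a) + 2 * s) / (2 * measure lebesgue A)
        * (\<integral>p. indicator (A \<times> A) p * (diff_quot s u p * diff_quot s u p) \<partial>lebesgue)"
proof -
  let ?m = "measure lebesgue A" and ?K = "D powr (real DIM('a) + 2 * s)"
  let ?I = "\<integral>x. indicator A x * u x \<partial>lebesgue" and ?J = "\<integral>x. indicator A x * (u x)\<^sup>2 \<partial>lebesgue"
  have su: "sq_integrable lebesgue u" using u by (simp add: Hs_iff)
  have Al[measurable]: "A \<in> sets lebesgue" using A by (simp add: fmeasurable_def)
  note [measurable] = su[unfolded sq_integrable_def, THEN conjunct1]
  note i1 = integrable_indicator_mult_sq(1)[OF su A(1)]
  note i2 = integrable_indicator_mult_sq(2)[OF su A(1)]
  have i0: "integrable lebesgue (indicator A :: 'a \<Rightarrow> real)"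
    using A(1) by (auto simp: fmeasurable_def)
  let ?g = "\<lambda>p. indicator A (fst p) * (u (fst p))\<^sup>2 * indicator A (snd p)
      + indicator A (fst p) * (indicator A (snd p) * (u (snd p))\<^sup>2)
      - 2 * ((indicator A (fst p) * u (fst p)) * (indicator A (snd p) * u (snd p))) :: real"
  have gi: "integrable lebesgue ?g"
    by (intro Bochner_Integration.integrable_diff Bochner_Integration.integrable_add integrable_mult_right
        integrable_tensor[OF i2 i0] integrable_tensor[OF i0 i2] integrable_tensor[OF i1 i1])
  have "2 * (?J * ?m - ?I\<^sup>2) = (\<integral>p. ?g p \<partial>lebesgue)"
    using integrable_tensor[OF i2 i0] integrable_tensor[OF i0 i2] integrable_tensor[OF i1 i1] Al
    by (simp add: integral_tensor(2)[OF i2 i0] integral_tensor(2)[OF i0 i2] integral_tensor(2)[OF i1 i1]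
        power2_eq_square[of ?I])
  also have "\<dots> \<le> (\<integral>p. ?K * (indicator (A \<times> A) p * (diff_quot s u p * diff_quot s u p)) \<partial>lebesgue)"
  proof (rule integral_mono[OF gi])
    have m: "A \<times> A = fst -` A \<inter> snd -` A \<inter> space lebesgue" by auto
    have "A \<times> A \<in> sets (lebesgue :: ('a \<times> 'a) measure)" by (subst m) measurable
    then have "integrable lebesgue (\<lambda>p. (diff_quot s u p * diff_quot s u p) * indicator (A \<times> A) p)"
      using Hs_diff_quot_mult[OF u u] by (intro integrable_real_mult_indicator)
    then show "integrable lebesgue (\<lambda>p. ?K * (indicator (A \<times> A) p * (diff_quot s u p * diff_quot s u p)))"
      by (simp add: mult.commute)
    fix p :: "'a \<times> 'a"
    obtain x y where p: "p = (x, y)" by (cases p)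
    show "?g p \<le> ?K * (indicator (A \<times> A) p * (diff_quot s u p * diff_quot s u p))"
    proof (cases "x \<in> A \<and> y \<in> A")
      case True
      then show ?thesis using sq_diff_le_diff_quot[OF s D, of x y u] 
        by (simp add: p power2_diff) (simp add: power2_eq_square)
    qed (auto simp: p)
  qed
  also have "\<dots> = ?K * (\<integral>p. indicator (A \<times> A) p * (diff_quot s u p * diff_quot s u p) \<partial>lebesgue)" by simp
  finally show ?thesis using A(2) by (simp add: field_simps)
qed

text \<open>For cubes of side \<open>h\<close> the constant of the previous lemma is of order \<open>h powr
(2s)\<close>, and the products \<open>A \<times> A\<close> are disjoint, so their Gagliardo
energies add up to at most the whole one. Hence up to a small multiple of the energy the
\<open>L\<^sup>2\<close> norm is controlled by finitely many linear functionals, which is the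
source of compactness in the existence proof.\<close>

lemma H0s_cell_poincare:
  fixes \<Omega> :: "'a::euclidean_space set"
  assumes s: "0 < s" and bd: "bounded \<Omega>" and \<delta>: "0 < \<delta>"
  obtains \<A> where "finite \<A>" "\<And>A. A \<in> \<A> \<Longrightarrow> A \<in> lmeasurable" "\<And>A. A \<in> \<A> \<Longrightarrow> 0 < measure lebesgue A"
    "\<And>u. u \<in> H0s s \<Omega> \<Longrightarrow> (\<integral>x. (u x)\<^sup>2 \<partial>lebesgue)
       \<le> \<delta> * inner_H0s s u u + (\<Sum>A\<in>\<A>. (\<integral>x. indicator A x * u x \<partial>lebesgue)\<^sup>2 / measure lebesgue A)"
proof -
  define N where "N = real DIM('a)"
  have N: "1 \<le> N" by (simp add: N_def Suc_leI)
  \<comment> \<open>The side for which \<open>(N h) powr (N + 2 s) / h ^ N = \<delta>\<close>, a cell having diameter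
    at most \<open>N h\<close>.\<close>
  define h where "h = (\<delta> / N powr (N + 2 * s)) powr (1 / (2 * s))"
  have Np: "0 < N powr (N + 2 * s)" using N by simp
  have h: "0 < h" using \<delta> Np by (simp add: h_def)
  have "h powr (2 * s) = \<delta> / N powr (N + 2 * s)"
    using \<delta> Np s by (simp add: h_def powr_powr)
  then have eq: "(N * h) powr (N + 2 * s) / h ^ DIM('a) = \<delta>"
    using N h Np by (simp add: powr_mult powr_add[of h] N_def powr_realpow)
  let ?\<A> = "cell h ` \<Omega>"
  have fin: "finite ?\<A>" by (rule finite_cells[OF h bd])
  have lm: "A \<in> lmeasurable" "measure lebesgue A = h ^ DIM('a)" if "A \<in> ?\<A>" for A
    using that cell_lmeasurable[OF h] measure_cell[OF h] by auto
  show thesis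
  proof (rule that[of ?\<A>])
    show "finite ?\<A>" by (rule fin)
    show "A \<in> lmeasurable" "0 < measure lebesgue A" if "A \<in> ?\<A>" for A
      using lm[OF that] h by auto
    fix u assume u: "u \<in> H0s s \<Omega>"
    note [measurable] = H0s_measurable[OF u]
    have ind1: "(\<Sum>A\<in>?\<A>. indicator A x) = (1::real)" if "x \<in> \<Omega>" for x
    proof -
      have "(\<Sum>A\<in>?\<A>. indicator A x) = (\<Sum>A\<in>?\<A>. if A = cell h x then 1 else (0::real))"
        by (rule sum.cong) (auto simp: indicator_def cell_self dest: cell_eq)
      then show ?thesis using that fin by simp
    qed
    have ind2: "(\<Sum>A\<in>?\<A>. indicator (A \<times> A) p) \<le> (1::real)" for p
    proof -
      have "(\<Sum>A\<in>?\<A>. indicator (A \<times> A) p) \<le> (\<Sum>A\<in>?\<A>. if A = cell h (fst p) then 1 else (0::real))"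
        by (rule sum_mono) (auto simp: indicator_def dest: cell_eq)
      also have "\<dots> \<le> 1" using fin by (simp add: sum.delta)
      finally show ?thesis .
    qed
    note iA = integrable_indicator_mult_sq(2)[OF H0s_sq[OF u] lm(1)]
    have uu: "integrable lebesgue (\<lambda>p. diff_quot s u p * diff_quot s u p)" using u by (intro Hs_diff_quot_mult H0s_Hs)
    have iAA: "integrable lebesgue (\<lambda>p. indicator (A \<times> A) p * (diff_quot s u p * diff_quot s u p))" if "A \<in> ?\<A>" for A
    proof -
      have [measurable]: "A \<in> sets lebesgue" using lm[OF that] by (simp add: fmeasurable_def)
      have m: "A \<times> A = fst -` A \<inter> snd -` A \<inter> space lebesgue" by auto
      have "A \<times> A \<in> sets (lebesgue :: ('a \<times> 'a) measure)" by (subst m) measurable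
      then have "integrable lebesgue (\<lambda>p. (diff_quot s u p * diff_quot s u p) * indicator (A \<times> A) p)"
        using uu by (intro integrable_real_mult_indicator)
      then show ?thesis by (simp add: mult.commute)
    qed
    have AE0: "AE x in lebesgue. x \<notin> \<Omega> \<longrightarrow> u x = 0" using u by (simp add: H0s_def)
    have "(\<integral>x. (u x)\<^sup>2 \<partial>lebesgue) = (\<integral>x. (\<Sum>A\<in>?\<A>. indicator A x * (u x)\<^sup>2) \<partial>lebesgue)"
    proof (rule integral_cong_AE)
      show "(\<lambda>x. \<Sum>A\<in>?\<A>. indicator A x * (u x)\<^sup>2) \<in> borel_measurable lebesgue"
        by (intro borel_measurable_sum borel_measurable_integrable iA)
      show "AE x in lebesgue. (u x)\<^sup>2 = (\<Sum>A\<in>?\<A>. indicator A x * (u x)\<^sup>2)"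
        using AE0
      proof eventually_elim
        case (elim x)
        then show ?case by (cases "x \<in> \<Omega>") (auto simp: ind1 sum_distrib_right[symmetric])
      qed
    qed measurable
    also have "\<dots> = (\<Sum>A\<in>?\<A>. \<integral>x. indicator A x * (u x)\<^sup>2 \<partial>lebesgue)"
      by (rule Bochner_Integration.integral_sum) (rule iA)
    also have "\<dots> \<le> (\<Sum>A\<in>?\<A>. (\<integral>x. indicator A x * u x \<partial>lebesgue)\<^sup>2 / measure lebesgue A
        + (N * h) powr (N + 2 * s) / (2 * h ^ DIM('a)) 
        * (\<integral>p. indicator (A \<times> A) p * (diff_quot s u p * diff_quot s u p) \<partial>lebesgue))"
    proof (rule sum_mono)
      fix A assume A: "A \<in> ?\<A>"
      then show "(\<integral>x. indicator A x * (u x)\<^sup>2 \<partial>lebesgue) \<le> (\<integral>x. indicator A x * u x \<partial>lebesgue)\<^sup>2 / measure lebesgue A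
        + (N * h) powr (N + 2 * s) / (2 * h ^ DIM('a)) 
        * (\<integral>p. indicator (A \<times> A) p * (diff_quot s u p * diff_quot s u p) \<partial>lebesgue)"
        using integral_sq_on_set_le[OF s H0s_Hs[OF u] lm(1)[OF A], of "N * h"] lm(2)[OF A] h
        by (auto simp: N_def dist_in_cell)
    qed
    also have "\<dots> = (\<Sum>A\<in>?\<A>. (\<integral>x. indicator A x * u x \<partial>lebesgue)\<^sup>2 / measure lebesgue A)
        + \<delta> / 2 * (\<Sum>A\<in>?\<A>. \<integral>p. indicator (A \<times> A) p * (diff_quot s u p * diff_quot s u p) \<partial>lebesgue)"
      by (simp add: sum.distrib sum_distrib_left eq[symmetric] ac_simps)
    also have "(\<Sum>A\<in>?\<A>. \<integral>p. indicator (A \<times> A) p * (diff_quot s u p * diff_quot s u p) \<partial>lebesgue)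
        = (\<integral>p. (\<Sum>A\<in>?\<A>. indicator (A \<times> A) p * (diff_quot s u p * diff_quot s u p)) \<partial>lebesgue)"
      by (rule Bochner_Integration.integral_sum[symmetric]) (rule iAA)
    also have "\<dots> \<le> (\<integral>p. diff_quot s u p * diff_quot s u p \<partial>lebesgue)"
    proof (rule integral_mono)
      show "integrable lebesgue (\<lambda>p. \<Sum>A\<in>?\<A>. indicator (A \<times> A) p * (diff_quot s u p * diff_quot s u p))"
        by (intro Bochner_Integration.integrable_sum iAA)
      show "(\<Sum>A\<in>?\<A>. indicator (A \<times> A) p * (diff_quot s u p * diff_quot s u p)) \<le> diff_quot s u p * diff_quot s u p" for p
        using mult_right_mono[OF ind2[of p], of "diff_quot s u p * diff_quot s u p"]
        by (simp add: sum_distrib_right)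
    qed (rule uu)
    also have "\<dots> = inner_H0s s u u" by (simp add: inner_H0s_diff_quot)
    finally have "(\<integral>x. (u x)\<^sup>2 \<partial>lebesgue)
       \<le> \<delta> / 2 * inner_H0s s u u + (\<Sum>A\<in>?\<A>. (\<integral>x. indicator A x * u x \<partial>lebesgue)\<^sup>2 / measure lebesgue A)"
      using \<delta> by (simp add: algebra_simps)
    also have "\<delta> / 2 * inner_H0s s u u \<le> \<delta> * inner_H0s s u u"
      using \<delta> inner_H0s_nonneg[of s u] by (intro mult_right_mono) auto
    finally show "(\<integral>x. (u x)\<^sup>2 \<partial>lebesgue)
       \<le> \<delta> * inner_H0s s u u + (\<Sum>A\<in>?\<A>. (\<integral>x. indicator A x * u x \<partial>lebesgue)\<^sup>2 / measure lebesgue A)"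
      by simp
  qed
qed

section \<open>Completeness\<close>

text \<open>Fatou's lemma in the form in which it is applied both to the functions and to their difference
quotients.\<close>

lemma sq_integrable_fatou:
  fixes g :: "nat \<Rightarrow> 'b \<Rightarrow> real"
  assumes "\<And>k. sq_integrable M (g k)" "h \<in> borel_measurable M"
    and lim: "AE x in M. (\<lambda>k. g k x) \<longlonglongrightarrow> h x"
    and B: "eventually (\<lambda>k. (\<integral>x. (g k x)\<^sup>2 \<partial>M) \<le> B) sequentially"
  shows "sq_integrable M h" "(\<integral>x. (h x)\<^sup>2 \<partial>M) \<le> B"
proof -
  note [measurable] = assms(1)[unfolded sq_integrable_def, THEN conjunct1] assms(2)
  have B0: "0 \<le> B"
  proof -
    obtain k where "(\<integral>x. (g k x)\<^sup>2 \<partial>M) \<le> B" using B by (auto simp: eventually_sequentially)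
    from order_trans[OF Bochner_Integration.integral_nonneg this] show ?thesis by simp
  qed
  have "(\<integral>\<^sup>+x. ennreal ((h x)\<^sup>2) \<partial>M) = (\<integral>\<^sup>+x. liminf (\<lambda>k. ennreal ((g k x)\<^sup>2)) \<partial>M)"
  proof (rule nn_integral_cong_AE)
    show "AE x in M. ennreal ((h x)\<^sup>2) = liminf (\<lambda>k. ennreal ((g k x)\<^sup>2))"
      using lim
    proof eventually_elim
      case (elim x)
      have "(\<lambda>k. ennreal ((g k x)\<^sup>2)) \<longlonglongrightarrow> ennreal ((h x)\<^sup>2)"
        by (intro tendsto_ennrealI tendsto_power elim)
      then show ?case by (rule lim_imp_Liminf[OF trivial_limit_sequentially, symmetric])
    qed
  qed
  also have "\<dots> \<le> liminf (\<lambda>k. \<integral>\<^sup>+x. ennreal ((g k x)\<^sup>2) \<partial>M)"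
    by (rule nn_integral_liminf) measurable
  also have "\<dots> \<le> ennreal B"
  proof (rule Liminf_le)
    show "\<forall>\<^sub>F k in sequentially. (\<integral>\<^sup>+x. ennreal ((g k x)\<^sup>2) \<partial>M) \<le> ennreal B"
      using B
    proof eventually_elim
      case (elim k)
      then show ?case using assms(1)[of k]
        by (subst nn_integral_eq_integral) (auto simp: sq_integrable_def intro: ennreal_leI)
    qed
  qed simp
  finally have nn: "(\<integral>\<^sup>+x. ennreal ((h x)\<^sup>2) \<partial>M) \<le> ennreal B" .
  show "sq_integrable M h" unfolding sq_integrable_def
  proof safe
    show "integrable M (\<lambda>x. (h x)\<^sup>2)"
      by (rule integrableI_bounded) (use nn in \<open>auto simp: le_less_trans[OF _ ennreal_less_top]\<close>)
  qed (rule assms(2))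
  show "(\<integral>x. (h x)\<^sup>2 \<partial>M) \<le> B"
    by (rule integral_real_bounded[OF B0 nn])
qed

text \<open>By Young's inequality \<open>2 |d| \<le> 2^-k + 2^k d\<^sup>2\<close>, the increments have
summable integrals of their absolute values on a ball containing the domain, so the telescoping
series converges absolutely almost everywhere.\<close>

lemma AE_convergent_if_summable_sq:
  fixes g :: "nat \<Rightarrow> 'a::euclidean_space \<Rightarrow> real"
  assumes g: "\<And>k. sq_integrable lebesgue (g k)" and bd: "bounded \<Omega>"
    and C: "\<And>k. (\<integral>x. (g (Suc k) x - g k x)\<^sup>2 \<partial>lebesgue) \<le> C / 4 ^ k"
  shows "AE x in lebesgue. x \<in> \<Omega> \<longrightarrow> convergent (\<lambda>k. g k x)"
proof -
  obtain R where R: "\<Omega> \<subseteq> ball 0 R"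
    using bd by (metis bounded_subset_ballD)
  let ?B = "ball 0 R :: 'a set"
  define d where "d k x = g (Suc k) x - g k x" for k x
  have d: "sq_integrable lebesgue (d k)" for k
    unfolding d_def[abs_def] by (intro sq_integrable_diff g)
  note [measurable] = d[unfolded sq_integrable_def, THEN conjunct1]
  have dm: "d k \<in> borel_measurable lebesgue" for k using d[of k] by (simp add: sq_integrable_def)
  have iB: "integrable lebesgue (indicator ?B :: 'a \<Rightarrow> real)"
    using lmeasurable_ball[of "0::'a" R] by (intro integrable_real_indicator) (auto simp: fmeasurable_def)
  have 1: "(\<integral>\<^sup>+x. ennreal (indicator ?B x * \<bar>d k x\<bar>) \<partial>lebesgue) \<le> ennreal ((measure lebesgue ?B + C) * (1/2) ^ k)" for k
  proof -
    have p: "indicator ?B x * \<bar>d k x\<bar> \<le> (1/2)^k * indicator ?B x + 2^k * (d k x)\<^sup>2" for x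
    proof -
      have e: "(2::real)^k * (1/2)^k = 1" by (simp add: power_mult_distrib[symmetric])
      have "0 \<le> (2::real)^k * ((1/2)^k - \<bar>d k x\<bar>)\<^sup>2" by simp
      also have "\<dots> = (1/2)^k * (2^k * (1/2)^k) - 2 * (2^k * (1/2)^k) * \<bar>d k x\<bar> + 2^k * (d k x)\<^sup>2"
        by (simp add: power2_eq_square algebra_simps)
      finally have "2 * \<bar>d k x\<bar> \<le> (1/2)^k + 2^k * (d k x)\<^sup>2" unfolding e by simp
      then show ?thesis by (auto simp: indicator_def)
    qed
    have ie: "integrable lebesgue (\<lambda>x. (1/2)^k * indicator ?B x + 2^k * (d k x)\<^sup>2)"
      using d[of k] iB by (auto simp: sq_integrable_def)
    have "(\<integral>\<^sup>+x. ennreal (indicator ?B x * \<bar>d k x\<bar>) \<partial>lebesgue)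
        \<le> (\<integral>\<^sup>+x. ennreal ((1/2)^k * indicator ?B x + 2^k * (d k x)\<^sup>2) \<partial>lebesgue)"
      by (intro nn_integral_mono ennreal_leI p)
    also have "\<dots> = ennreal (\<integral>x. (1/2)^k * indicator ?B x + 2^k * (d k x)\<^sup>2 \<partial>lebesgue)"
      by (rule nn_integral_eq_integral[OF ie]) simp
    also have "(\<integral>x. (1/2)^k * indicator ?B x + 2^k * (d k x)\<^sup>2 \<partial>lebesgue)
        = (1/2)^k * measure lebesgue ?B + 2^k * (\<integral>x. (d k x)\<^sup>2 \<partial>lebesgue)"
      using d[of k] iB by (subst Bochner_Integration.integral_add) (auto simp: sq_integrable_def)
    also have "2^k * (\<integral>x. (d k x)\<^sup>2 \<partial>lebesgue) \<le> 2^k * (C / 4^k)"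
      using C[of k] by (intro mult_left_mono) (auto simp: d_def)
    also have "2^k * (C / 4^k) = C * (1/2)^k"
    proof -
      have "(4::real)^k = 2^k * 2^k" by (simp add: power_mult_distrib[symmetric])
      then show ?thesis by (simp add: power_one_over divide_simps)
    qed
    finally show ?thesis by (simp add: algebra_simps ennreal_leI)
  qed
  have C0: "0 \<le> C"
    using order_trans[OF Bochner_Integration.integral_nonneg C[of 0]] by simp
  have bm: "(\<lambda>x. ennreal (indicator ?B x * \<bar>d k x\<bar>)) \<in> borel_measurable lebesgue" for k
    by (intro measurable_compose[OF _ measurable_ennreal] borel_measurable_times borel_measurable_abs
        borel_measurable_indicator dm) simp
  have sm: "summable (\<lambda>k. (measure lebesgue ?B + C) * (1/2) ^ k)"
    by (intro summable_mult summable_geometric) simp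
  have "(\<integral>\<^sup>+x. (\<Sum>k. ennreal (indicator ?B x * \<bar>d k x\<bar>)) \<partial>lebesgue)
      = (\<Sum>k. \<integral>\<^sup>+x. ennreal (indicator ?B x * \<bar>d k x\<bar>) \<partial>lebesgue)"
    by (intro nn_integral_suminf bm)
  also have "\<dots> \<le> (\<Sum>k. ennreal ((measure lebesgue ?B + C) * (1/2) ^ k))"
    by (intro suminf_le 1 summableI)
  also have "\<dots> = ennreal (\<Sum>k. (measure lebesgue ?B + C) * (1/2) ^ k)"
    using C0 by (intro suminf_ennreal2 sm) simp
  finally have "(\<integral>\<^sup>+x. (\<Sum>k. ennreal (indicator ?B x * \<bar>d k x\<bar>)) \<partial>lebesgue) \<noteq> \<infinity>"
    unfolding infinity_ennreal_def by (rule neq_top_trans[OF ennreal_neq_top])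
  then have "AE x in lebesgue. (\<Sum>k. ennreal (indicator ?B x * \<bar>d k x\<bar>)) \<noteq> \<infinity>"
    by (intro nn_integral_PInf_AE borel_measurable_suminf_order bm)
  then show ?thesis
  proof (rule AE_mp, intro AE_I2 impI)
      fix x
      assume elim: "(\<Sum>k. ennreal (indicator ?B x * \<bar>d k x\<bar>)) \<noteq> \<infinity>" and "x \<in> \<Omega>"
      then have "x \<in> ?B" using R by blast
      then have "indicator ?B x = (1::real)" by (rule indicator_simps(1))
      then have "(\<Sum>k. ennreal \<bar>d k x\<bar>) \<noteq> \<infinity>" using elim by (simp only: mult_1_left simp_thms)
      then have "summable (\<lambda>k. \<bar>d k x\<bar>)"
        by (intro summable_suminf_not_top) auto
      then have "summable (\<lambda>k. g (Suc k) x - g k x)"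
        unfolding d_def[symmetric] by (rule summable_rabs_cancel)
      then have "convergent (\<lambda>n. \<Sum>k<n. g (Suc k) x - g k x)"
        by (simp add: summable_iff_convergent)
      then have "convergent (\<lambda>n. g n x - g 0 x)" by (simp add: sum_lessThan_telescope[of "\<lambda>k. g k x"])
      then have "convergent (\<lambda>n. (g n x - g 0 x) + g 0 x)"
        by (intro convergent_add convergent_const)
      then show "convergent (\<lambda>n. g n x)" by simp
  qed
qed

lemma fast_cauchy_subseq:
  fixes e :: "nat \<Rightarrow> nat \<Rightarrow> real"
  assumes "\<And>\<epsilon>. 0 < \<epsilon> \<Longrightarrow> \<exists>N. \<forall>m\<ge>N. \<forall>n\<ge>N. e m n \<le> \<epsilon>"
  obtains r where "strict_mono (r :: nat \<Rightarrow> nat)" "\<And>k. e (r (Suc k)) (r k) \<le> 1 / 4 ^ k"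
proof -
  have "\<exists>N. \<forall>m\<ge>N. \<forall>n\<ge>N. e m n \<le> 1 / 4 ^ k" for k by (rule assms) simp
  then obtain N where N: "\<And>k m n. N k \<le> m \<Longrightarrow> N k \<le> n \<Longrightarrow> e m n \<le> 1 / 4 ^ k" by metis
  define r where "r = rec_nat (N 0) (\<lambda>k a. Suc (max a (N (Suc k))))"
  have r: "r (Suc k) = Suc (max (r k) (N (Suc k)))" "r 0 = N 0" for k by (simp_all add: r_def)
  have "strict_mono r" by (auto simp: strict_mono_Suc_iff r less_Suc_eq_le)
  moreover have "N k \<le> r k" for k by (cases k) (auto simp: r)
  moreover have "r k \<le> r (Suc k)" for k by (simp add: r)
  ultimately show thesis using that N by (meson order_trans)
qed

lemma inner_H0s_self: "inner_H0s s u u = (\<integral>p. (diff_quot s u p)\<^sup>2 \<partial>lebesgue)"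
  by (simp add: inner_H0s_diff_quot power2_eq_square)

text \<open>A rapidly converging subsequence converges almost everywhere, and Fatou's lemma on the product
space shows that its pointwise limit is also the limit in the Gagliardo norm.\<close>

lemma H0s_complete:
  fixes \<Omega> :: "'a::euclidean_space set"
  assumes s: "0 < s" and bd: "bounded \<Omega>" and f: "\<And>n. f n \<in> H0s s \<Omega>"
    and cauchy: "\<And>\<epsilon>. 0 < \<epsilon> \<Longrightarrow> \<exists>N. \<forall>m\<ge>N. \<forall>n\<ge>N. inner_H0s s (\<lambda>x. f m x - f n x) (\<lambda>x. f m x - f n x) \<le> \<epsilon>"
  obtains g where "g \<in> H0s s \<Omega>" "(\<lambda>n. inner_H0s s (\<lambda>x. f n x - g x) (\<lambda>x. f n x - g x)) \<longlonglongrightarrow> 0"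
proof -
  define e where "e m n = inner_H0s s (\<lambda>x. f m x - f n x) (\<lambda>x. f m x - f n x)" for m n
  note cauchy' = cauchy[folded e_def]
  obtain r where r: "strict_mono r" "\<And>k. e (r (Suc k)) (r k) \<le> 1 / 4 ^ k"
    using fast_cauchy_subseq[of e, OF cauchy'] by blast
  obtain C where C: "0 < C" "\<And>u. u \<in> H0s s \<Omega> \<Longrightarrow> (\<integral>x. (u x)\<^sup>2 \<partial>lebesgue) \<le> C * inner_H0s s u u"
    using H0s_poincare[OF s bd] by blast
  note [measurable] = H0s_measurable[OF f]
  have fd: "(\<lambda>x. f m x - f n x) \<in> H0s s \<Omega>" for m n by (intro H0s_diff f)
  define g where "g x = lim (\<lambda>k. f (r k) x)" for x
  have [measurable]: "g \<in> borel_measurable lebesgue" unfolding g_def[abs_def] by measurable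
  have AE0: "AE x in lebesgue. x \<notin> \<Omega> \<longrightarrow> f n x = 0" for n using f[of n] by (simp add: H0s_def)
  have "AE x in lebesgue. \<forall>n. x \<notin> \<Omega> \<longrightarrow> f n x = 0"
    unfolding AE_all_countable using AE0 by blast
  moreover have "AE x in lebesgue. x \<in> \<Omega> \<longrightarrow> convergent (\<lambda>k. f (r k) x)"
  proof (rule AE_convergent_if_summable_sq[OF _ bd])
    show "sq_integrable lebesgue (f (r k))" for k by (rule H0s_sq[OF f])
    show "(\<integral>x. (f (r (Suc k)) x - f (r k) x)\<^sup>2 \<partial>lebesgue) \<le> C / 4 ^ k" for k
      using C(2)[OF fd, of "r (Suc k)" "r k"] mult_left_mono[OF r(2)[of k], of C] C(1)
      by (simp add: e_def)
  qed
  ultimately have both: "AE x in lebesgue. (\<lambda>k. f (r k) x) \<longlonglongrightarrow> g x \<and> (x \<notin> \<Omega> \<longrightarrow> g x = 0)"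
  proof eventually_elim
    case (elim x)
    show ?case
    proof (cases "x \<in> \<Omega>")
      case True
      then show ?thesis using elim by (auto simp: g_def convergent_LIMSEQ_iff)
    next
      case False
      then have "f (r k) x = 0" for k using elim by simp
      then show ?thesis by (simp add: g_def lim_def[symmetric])
    qed
  qed
  then have lim: "AE x in lebesgue. (\<lambda>k. f (r k) x) \<longlonglongrightarrow> g x"
    and g0: "AE x in lebesgue. x \<notin> \<Omega> \<longrightarrow> g x = 0" by auto
  have key: "(\<lambda>x. g x - f n x) \<in> Hs s \<and> inner_H0s s (\<lambda>x. g x - f n x) (\<lambda>x. g x - f n x) \<le> \<epsilon>"
    if n: "n \<ge> N" and N: "\<forall>m\<ge>N. \<forall>n\<ge>N. e m n \<le> \<epsilon>" for n N \<epsilon>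
  proof -
    have ev: "\<forall>\<^sub>F k in sequentially. e (r k) n \<le> \<epsilon>"
      unfolding eventually_sequentially using N n seq_suble[OF r(1)] by (meson order_trans)
    have a1: "sq_integrable lebesgue (\<lambda>x. f (r k) x - f n x)" for k by (rule H0s_sq[OF fd])
    have a2: "(\<lambda>x. g x - f n x) \<in> borel_measurable lebesgue" by measurable
    have a3: "AE x in lebesgue. (\<lambda>k. f (r k) x - f n x) \<longlonglongrightarrow> g x - f n x"
      using lim by eventually_elim (intro tendsto_diff tendsto_const)
    have a4: "\<forall>\<^sub>F k in sequentially. (\<integral>x. (f (r k) x - f n x)\<^sup>2 \<partial>lebesgue) \<le> C * \<epsilon>"
      using ev
    proof eventually_elim
      case (elim k)
      then have "C * e (r k) n \<le> C * \<epsilon>" using C(1) by (intro mult_left_mono) auto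
      then show ?case using C(2)[OF fd, of "r k" n] by (simp add: e_def)
    qed
    have b1: "sq_integrable lebesgue (diff_quot s (\<lambda>x. f (r k) x - f n x))" for k
      using fd[of "r k" n] by (simp add: H0s_def Hs_iff)
    have b3: "AE p in lebesgue. (\<lambda>k. diff_quot s (\<lambda>x. f (r k) x - f n x) p) \<longlonglongrightarrow> diff_quot s (\<lambda>x. g x - f n x) p"
      using AE_lebesgue_fst[OF lim] AE_lebesgue_snd[OF lim]
      unfolding diff_quot_def divide_inverse
      by eventually_elim (intro tendsto_mult tendsto_diff tendsto_const)
    have b4: "\<forall>\<^sub>F k in sequentially. (\<integral>p. (diff_quot s (\<lambda>x. f (r k) x - f n x) p)\<^sup>2 \<partial>lebesgue) \<le> \<epsilon>"
      using ev by (simp add: e_def inner_H0s_self)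
    show ?thesis
      using sq_integrable_fatou(1)[OF a1 a2 a3 a4] sq_integrable_fatou[OF b1 measurable_diff_quot[OF a2] b3 b4]
      by (simp add: Hs_iff inner_H0s_self)
  qed
  obtain N where N: "\<forall>m\<ge>N. \<forall>n\<ge>N. e m n \<le> 1" using cauchy'[of 1] by auto
  have "(\<lambda>x. (g x - f N x) + f N x) \<in> Hs s"
    using key[OF order_refl N] H0s_Hs[OF f[of N]] by (intro Hs_add) auto
  then have g: "g \<in> H0s s \<Omega>" using g0 by (simp add: H0s_def)
  have sym: "inner_H0s s (\<lambda>x. f n x - g x) (\<lambda>x. f n x - g x) = inner_H0s s (\<lambda>x. g x - f n x) (\<lambda>x. g x - f n x)" for n
    by (simp add: inner_H0s_self diff_quot_diff power2_commute)
  have "(\<lambda>n. inner_H0s s (\<lambda>x. f n x - g x) (\<lambda>x. f n x - g x)) \<longlonglongrightarrow> 0"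
  proof (rule LIMSEQ_I)
    fix \<epsilon> :: real assume "0 < \<epsilon>"
    then obtain N where N: "\<forall>m\<ge>N. \<forall>n\<ge>N. e m n \<le> \<epsilon> / 2" using cauchy'[of "\<epsilon> / 2"] by auto
    have "norm (inner_H0s s (\<lambda>x. f n x - g x) (\<lambda>x. f n x - g x) - 0) < \<epsilon>" if "n \<ge> N" for n
      using key[OF that N] inner_H0s_nonneg[of s "\<lambda>x. g x - f n x"] \<open>0 < \<epsilon>\<close> by (simp add: sym)
    then show "\<exists>N. \<forall>n\<ge>N. norm (inner_H0s s (\<lambda>x. f n x - g x) (\<lambda>x. f n x - g x) - 0) < \<epsilon>" by blast
  qed
  with g show thesis by (rule that)
qed

section \<open>Lipschitz functions and test functions\<close>

text \<open>Radial functions are dominated by series of indicators of balls with dyadic radii; this takes the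
place of polar coordinates.\<close>

lemma nn_integral_ball_series_le:
  fixes x :: "'a::euclidean_space"
  assumes "\<And>j. 0 \<le> c j" "\<And>j. 0 \<le> r j" "0 \<le> A" "0 \<le> q" "q < 1"
    and le: "\<And>j. c j * r j ^ DIM('a) \<le> A * q ^ j"
  shows "(\<integral>\<^sup>+y. (\<Sum>j. ennreal (c j) * indicator (ball x (r j)) y) \<partial>lborel)
    \<le> ennreal (unit_ball_vol DIM('a) * A / (1 - q))"
proof -
  let ?V = "unit_ball_vol (real DIM('a))"
  have V: "0 \<le> ?V" by simp
  have sq: "summable (\<lambda>j. q ^ j)" using assms(4,5) by (intro summable_geometric) simp
  have "(\<integral>\<^sup>+y. (\<Sum>j. ennreal (c j) * indicator (ball x (r j)) y) \<partial>lborel)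
      = (\<Sum>j. \<integral>\<^sup>+y. ennreal (c j) * indicator (ball x (r j)) y \<partial>lborel)"
    by (intro nn_integral_suminf borel_measurable_times_ennreal borel_measurable_const
        borel_measurable_indicator) simp
  also have "\<dots> = (\<Sum>j. ennreal (?V * (c j * r j ^ DIM('a))))"
  proof (rule suminf_cong)
    fix j
    have "(\<integral>\<^sup>+y. ennreal (c j) * indicator (ball x (r j)) y \<partial>lborel) = ennreal (c j) * ennreal (?V * r j ^ DIM('a))"
      using assms(2) by (simp add: nn_integral_cmult_indicator emeasure_ball)
    also have "\<dots> = ennreal (?V * (c j * r j ^ DIM('a)))"
      using assms(1,2) by (subst ennreal_mult[symmetric]) (simp_all add: mult.left_commute)
    finally show "(\<integral>\<^sup>+y. ennreal (c j) * indicator (ball x (r j)) y \<partial>lborel) = ennreal (?V * (c j * r j ^ DIM('a)))" .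
  qed
  also have "\<dots> \<le> (\<Sum>j. ennreal (?V * A * q ^ j))"
    using le V by (intro suminf_le summableI ennreal_leI) (simp add: mult.assoc mult_left_mono)
  also have "\<dots> = ennreal (\<Sum>j. ?V * A * q ^ j)"
    using assms(3,4) by (intro suminf_ennreal2 summable_mult sq) simp
  also have "(\<Sum>j. ?V * A * q ^ j) = ?V * A * (1 / (1 - q))"
    using suminf_geometric[of q] assms(4,5) by (subst suminf_mult[OF sq]) simp
  finally show ?thesis by simp
qed

lemma le_suminf_ennreal: "f j \<le> (\<Sum>j. f j :: ennreal)"
  using sum_le_suminf[OF summableI, of "{j}" f] by simp

lemma ex_dyadic:
  fixes r :: real
  assumes "1 \<le> r"
  obtains j :: nat where "2 ^ j \<le> r" "r < 2 ^ Suc j"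
proof -
  obtain n where "r < 2 ^ n" using real_arch_pow[of 2 r] by auto
  define m where "m = (LEAST n. r < 2 ^ n)"
  have m: "r < 2 ^ m" unfolding m_def by (rule LeastI) fact
  then have "m \<noteq> 0" using assms by (cases "m = 0") auto
  then obtain j where j: "m = Suc j" by (cases m) auto
  have "\<not> r < 2 ^ j" using not_less_Least[of j "\<lambda>n. r < 2 ^ n"] j by (simp add: m_def)
  then show thesis using that[of j] m j by (simp add: not_less)
qed

text \<open>Up to a factor, the Gagliardo density of a bounded Lipschitz function is at most this truncated
kernel.\<close>

definition cutoff_kernel :: "real \<Rightarrow> 'a::euclidean_space \<Rightarrow> 'a \<Rightarrow> real" where
  "cutoff_kernel s x y = min ((norm (x - y))\<^sup>2) 1 / norm (x - y) powr (real DIM('a) + 2 * s)"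

text \<open>Far from \<open>x\<close> the kernel decays like \<open>r powr -(N + 2s)\<close>, which is
integrable at infinity as \<open>s > 0\<close>; near \<open>x\<close> it grows like \<open>r powr
(2 - N - 2s)\<close>, which is integrable at 0 as \<open>s < 1\<close>. On dyadic shells the two
contributions are geometric series with ratios \<open>2 powr (-2s)\<close> and \<open>2 powr (2s -
2)\<close>.\<close>

lemma nn_integral_cutoff_kernel_bounded:
  assumes s: "0 < s" "s < 1" and N: "2 \<le> DIM('a::euclidean_space)"
  obtains C where "0 \<le> C" "\<And>x::'a. (\<integral>\<^sup>+y. ennreal (cutoff_kernel s x y) \<partial>lborel) \<le> ennreal C"
proof -
  define n where "n = DIM('a)"
  define a where "a = real n + 2 * s"
  have a2: "2 < a" using s N by (simp add: a_def n_def)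
  define c where "c j = (2 ^ j) powr (- a)" for j :: nat
  define d where "d j = (2 ^ Suc j) powr (a - 2)" for j :: nat
  have pw: "(2 powr b) ^ j = (2::real) powr (b * real j)" for b j
    by (simp add: powr_realpow[symmetric] powr_powr)
  have cq: "c j * (2 ^ Suc j) ^ n \<le> 2 ^ n * (2 powr (- 2 * s)) ^ j" for j
  proof -
    have "c j * (2 ^ Suc j) ^ n = 2 powr (real j * - a) * (2 powr (real n) * 2 powr (real j * real n))"
      by (simp add: c_def powr_realpow[symmetric] powr_powr power_mult_distrib powr_add[symmetric] power_mult[symmetric])
    also have "\<dots> = 2 powr real n * 2 powr (- 2 * s * real j)"
      by (simp add: powr_add[symmetric] a_def algebra_simps)
    also have "\<dots> = 2 ^ n * (2 powr (- 2 * s)) ^ j"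
      by (simp add: pw powr_realpow)
    finally show ?thesis by simp
  qed
  have diff_quot: "d j * (2 * (1/2) ^ j) ^ n \<le> (2 ^ n * 2 powr (a - 2)) * (2 powr (2 * s - 2)) ^ j" for j
  proof -
    have h: "(1/2 :: real) ^ j = 2 powr (- real j)"
      using pw[of "-1" j] by (simp add: powr_minus_divide)
    have "d j * (2 * (1/2) ^ j) ^ n = 2 powr ((1 + real j) * (a - 2)) * (2 powr real n * 2 powr (- real j * real n))"
      by (simp add: d_def h power_mult_distrib powr_realpow[symmetric] powr_powr del: power_Suc)
    also have "\<dots> = 2 powr real n * 2 powr (a - 2) * 2 powr ((2 * s - 2) * real j)"
      by (simp add: powr_add[symmetric] a_def algebra_simps)
    also have "\<dots> = (2 ^ n * 2 powr (a - 2)) * (2 powr (2 * s - 2)) ^ j"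
      by (simp add: pw powr_realpow)
    finally show ?thesis by simp
  qed
  have q1: "2 powr (- 2 * s) < (1::real)" using s by (simp add: powr_less_one)
  have q2: "2 powr (2 * s - 2) < (1::real)" using s by (simp add: powr_less_one)
  define C1 where "C1 = unit_ball_vol (real n) * 2 ^ n / (1 - 2 powr (- 2 * s))"
  define C2 where "C2 = unit_ball_vol (real n) * (2 ^ n * 2 powr (a - 2)) / (1 - 2 powr (2 * s - 2))"
  have C12: "0 \<le> C1" "0 \<le> C2" using q1 q2 by (auto simp: C1_def C2_def)
  show thesis
  proof (rule that[of "C1 + C2"])
    show "0 \<le> C1 + C2" using C12 by simp
    fix x :: 'a
    let ?f = "\<lambda>y. \<Sum>j. ennreal (c j) * indicator (ball x (2 ^ Suc j)) y"
    let ?g = "\<lambda>y. \<Sum>j. ennreal (d j) * indicator (ball x (2 * (1/2) ^ j)) y"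
    have "ennreal (cutoff_kernel s x y) \<le> ?f y + ?g y" for y
    proof -
      let ?r = "norm (x - y)"
      consider "?r = 0" | "1 \<le> ?r" | "0 < ?r" "?r < 1" by fastforce
      then show ?thesis
      proof cases
        case 1
        then show ?thesis by (simp add: cutoff_kernel_def)
      next
        case 2
        obtain j where j: "2 ^ j \<le> ?r" "?r < 2 ^ Suc j" using ex_dyadic[OF 2] by blast
        have "1 \<le> ?r\<^sup>2" using 2 by simp
        then have "cutoff_kernel s x y = ?r powr (- a)"
          unfolding cutoff_kernel_def a_def n_def powr_minus_divide by simp
        also have "\<dots> \<le> c j" unfolding c_def using j(1) a2 by (intro powr_mono2') auto
        finally have "ennreal (cutoff_kernel s x y) \<le> ennreal (c j) * indicator (ball x (2 ^ Suc j)) y"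
          using j(2) by (simp add: dist_norm ennreal_leI)
        also have "\<dots> \<le> ?f y"
          by (rule le_suminf_ennreal)
        also have "\<dots> \<le> ?f y + ?g y" by simp
        finally show ?thesis .
      next
        case 3
        then have "1 \<le> 1 / ?r" by simp
        then obtain j where j: "2 ^ j \<le> 1 / ?r" "1 / ?r < 2 ^ Suc j" using ex_dyadic by blast
        have "?r\<^sup>2 \<le> 1" using 3 by (simp add: power_le_one)
        then have "cutoff_kernel s x y = ?r\<^sup>2 / ?r powr a" by (simp add: cutoff_kernel_def a_def n_def)
        also have "?r\<^sup>2 = ?r powr 2" using 3 by (simp add: powr_numeral)
        also have "?r powr 2 / ?r powr a = (1 / ?r) powr (a - 2)"
          using 3 by (simp add: powr_diff powr_divide)
        also have "\<dots> \<le> d j" unfolding d_def using j(2) 3 a2 by (intro powr_mono2) auto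
        finally have k: "cutoff_kernel s x y \<le> d j" .
        have "?r \<le> (1/2) ^ j" using j(1) 3 by (simp add: field_simps power_one_over)
        also have "\<dots> < 2 * (1/2) ^ j" by simp
        finally have "ennreal (cutoff_kernel s x y) \<le> ennreal (d j) * indicator (ball x (2 * (1/2) ^ j)) y"
          using k by (simp add: dist_norm ennreal_leI)
        also have "\<dots> \<le> ?g y"
          by (rule le_suminf_ennreal)
        also have "\<dots> \<le> ?f y + ?g y" by simp
        finally show ?thesis .
      qed
    qed
    then have "(\<integral>\<^sup>+y. ennreal (cutoff_kernel s x y) \<partial>lborel) \<le> (\<integral>\<^sup>+y. ?f y + ?g y \<partial>lborel)"
      by (intro nn_integral_mono)
    also have "\<dots> = (\<integral>\<^sup>+y. ?f y \<partial>lborel) + (\<integral>\<^sup>+y. ?g y \<partial>lborel)"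
      by (rule nn_integral_add) (auto intro!: borel_measurable_suminf_order borel_measurable_times_ennreal borel_measurable_indicator)
    also have "\<dots> \<le> ennreal C1 + ennreal C2"
    proof (rule add_mono)
      show "(\<integral>\<^sup>+y. ?f y \<partial>lborel) \<le> ennreal C1"
        unfolding C1_def n_def
        by (rule nn_integral_ball_series_le[OF _ _ _ _ q1 cq[unfolded n_def]]) (simp_all add: c_def)
      show "(\<integral>\<^sup>+y. ?g y \<partial>lborel) \<le> ennreal C2"
        unfolding C2_def n_def
        by (rule nn_integral_ball_series_le[OF _ _ _ _ q2 diff_quot[unfolded n_def]]) (simp_all add: d_def)
    qed
    also have "\<dots> = ennreal (C1 + C2)" using C12 by simp
    finally show "(\<integral>\<^sup>+y. ennreal (cutoff_kernel s x y) \<partial>lborel) \<le> ennreal (C1 + C2)" .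
  qed
qed

lemma cutoff_kernel_commute: "cutoff_kernel s x y = cutoff_kernel s y x"
  by (simp add: cutoff_kernel_def norm_minus_commute)

lemma cutoff_kernel_nonneg: "0 \<le> cutoff_kernel s x y"
  by (simp add: cutoff_kernel_def)

lemma measurable_cutoff_kernel:
  "(\<lambda>p. cutoff_kernel s (fst p) (snd p)) \<in> borel_measurable (borel :: ('a::euclidean_space \<times> 'a) measure)"
proof -
  have "(\<lambda>p::'a\<times>'a. norm (fst p - snd p)) \<in> borel_measurable borel"
    by (intro borel_measurable_continuous_onI continuous_intros)
  then show ?thesis unfolding cutoff_kernel_def
    by measurable
qed

text \<open>The Gagliardo density of \<open>\<psi>\<close> vanishes unless one of the two points lies in the
ball \<open>B\<close> around the domain, and is dominated by the truncated kernel, which is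
integrable in the other point.\<close>

lemma lipschitz_in_H0s:
  fixes \<psi> :: "'a::euclidean_space \<Rightarrow> real"
  assumes s: "0 < s" "s < 1" and N: "2 \<le> DIM('a)" and bd: "bounded \<Omega>"
    and lip: "\<And>x y. \<bar>\<psi> x - \<psi> y\<bar> \<le> L * norm (x - y)" and supp: "\<And>x. x \<notin> \<Omega> \<Longrightarrow> \<psi> x = 0"
  shows "\<psi> \<in> H0s s \<Omega>"
proof -
  obtain R where R: "0 < R" "\<Omega> \<subseteq> ball 0 R"
    using bd by (metis bounded_subset_ballD)
  let ?B = "ball 0 R :: 'a set"
  have sB: "\<psi> x = 0" if "x \<notin> ?B" for x using supp R that by blast
  obtain b :: 'a where b: "b \<in> Basis" using nonempty_Basis by blast
  have "\<bar>\<psi> b - \<psi> 0\<bar> \<le> L * norm b" using lip[of b 0] by simp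
  then have L: "0 \<le> L" using b by simp
  define M where "M = L * (2 * R)"
  have M: "0 \<le> M" using L R by (simp add: M_def)
  have bnd: "\<bar>\<psi> x\<bar> \<le> M" for x
  proof (cases "x \<in> ?B")
    case True
    \<comment> \<open>A bound for \<open>\<psi>\<close> comes from comparison with a point of the sphere of radius
      \<open>R\<close>, where it vanishes.\<close>
    have "\<psi> (R *\<^sub>R b) = 0" using b R(1) by (intro sB) simp
    then have "\<bar>\<psi> x\<bar> \<le> L * norm (x - R *\<^sub>R b)" using lip[of x "R *\<^sub>R b"] by simp
    also have "norm (x - R *\<^sub>R b) \<le> 2 * R"
      using norm_triangle_ineq4[of x "R *\<^sub>R b"] True b R(1) by simp
    finally show ?thesis using L by (simp add: M_def mult_left_mono)
  qed (use sB M in auto)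
  have "continuous_on UNIV \<psi>"
  proof (rule lipschitz_on_continuous_on)
    show "L-lipschitz_on UNIV \<psi>" using lip L by (intro lipschitz_onI) (auto simp: dist_norm)
  qed
  then have "\<psi> \<in> borel_measurable borel" by (rule borel_measurable_continuous_onI)
  then have [measurable]: "\<psi> \<in> borel_measurable lebesgue" by (intro measurable_completion) auto
  define K where "K = max (L\<^sup>2) ((2 * M)\<^sup>2)"
  have K: "0 \<le> K" by (simp add: K_def max_def)
  have diff: "(\<psi> x - \<psi> y)\<^sup>2 \<le> K * min ((norm (x - y))\<^sup>2) 1" for x y
  proof -
    have "(\<psi> x - \<psi> y)\<^sup>2 \<le> (L * norm (x - y))\<^sup>2" using lip[of x y] L by (intro abs_le_square_iff[THEN iffD1]) simp
    also have "\<dots> \<le> K * (norm (x - y))\<^sup>2" by (simp add: power_mult_distrib K_def mult_right_mono)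
    finally have 1: "(\<psi> x - \<psi> y)\<^sup>2 \<le> K * (norm (x - y))\<^sup>2" .
    have "(\<psi> x - \<psi> y)\<^sup>2 \<le> (2 * M)\<^sup>2" using bnd[of x] bnd[of y] M by (intro abs_le_square_iff[THEN iffD1]) simp
    also have "\<dots> \<le> K" by (simp add: K_def)
    finally show ?thesis using 1 by (simp add: min_def)
  qed
  have diff_quot: "(diff_quot s \<psi> p)\<^sup>2 \<le> K * (indicator ?B (fst p) * cutoff_kernel s (fst p) (snd p) + indicator ?B (snd p) * cutoff_kernel s (fst p) (snd p))" for p
  proof -
    obtain x y where p: "p = (x, y)" by (cases p)
    have k: "cutoff_kernel s y x = cutoff_kernel s x y" by (rule cutoff_kernel_commute)
    have k0: "0 \<le> cutoff_kernel s x y" by (rule cutoff_kernel_nonneg)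
    show ?thesis
    proof (cases "x \<in> ?B \<or> y \<in> ?B")
      case True
      have "(diff_quot s \<psi> p)\<^sup>2 = (\<psi> x - \<psi> y)\<^sup>2 / norm (x - y) powr (real DIM('a) + 2 * s)"
        by (simp add: p power2_eq_square diff_quot_mult)
      also have "\<dots> \<le> K * min ((norm (x - y))\<^sup>2) 1 / norm (x - y) powr (real DIM('a) + 2 * s)"
        by (intro divide_right_mono diff) simp
      also have "\<dots> = K * cutoff_kernel s x y" by (simp add: cutoff_kernel_def)
      also have "\<dots> \<le> K * (indicator ?B x * cutoff_kernel s x y + indicator ?B y * cutoff_kernel s x y)"
        using True k0 K by (intro mult_left_mono) (auto simp: indicator_def)
      finally show ?thesis by (simp add: p k)
    qed (auto simp: p sB diff_quot_def)
  qed
  obtain C where C: "0 \<le> C" "\<And>x::'a. (\<integral>\<^sup>+y. ennreal (cutoff_kernel s x y) \<partial>lborel) \<le> ennreal C"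
    using nn_integral_cutoff_kernel_bounded[OF s N] by blast
  let ?F = "\<lambda>p::'a\<times>'a. indicator ?B (fst p) * ennreal (cutoff_kernel s (fst p) (snd p))"
  let ?G = "\<lambda>p::'a\<times>'a. indicator ?B (snd p) * ennreal (cutoff_kernel s (fst p) (snd p))"
  have fs: "(fst :: 'a \<times> 'a \<Rightarrow> 'a) \<in> borel_measurable borel" "(snd :: 'a \<times> 'a \<Rightarrow> 'a) \<in> borel_measurable borel"
    by (intro borel_measurable_continuous_onI continuous_intros)+
  have ind: "(indicator ?B :: 'a \<Rightarrow> ennreal) \<in> borel_measurable borel"
    by (rule borel_measurable_indicator) simp
  have "?F \<in> borel_measurable borel" "?G \<in> borel_measurable borel"
    by (intro borel_measurable_times_ennreal measurable_compose[OF fs(1) ind] measurable_compose[OF fs(2) ind]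
        measurable_compose[OF measurable_cutoff_kernel measurable_ennreal])+
  then have mF: "?F \<in> borel_measurable (lborel \<Otimes>\<^sub>M lborel)" "?G \<in> borel_measurable (lborel \<Otimes>\<^sub>M lborel)"
    unfolding lborel_prod by simp_all
  have e: "emeasure lborel ?B < \<infinity>" by (rule emeasure_bounded_finite[OF bounded_ball])
  have "(\<integral>\<^sup>+p. ?F p \<partial>lborel) = (\<integral>\<^sup>+x. \<integral>\<^sup>+y. indicator ?B x * ennreal (cutoff_kernel s x y) \<partial>lborel \<partial>lborel)"
    using lborel.nn_integral_fst[OF mF(1)] by (simp add: lborel_prod)
  also have "\<dots> \<le> (\<integral>\<^sup>+x. ennreal C * indicator ?B x \<partial>lborel)"
    using C(2) by (intro nn_integral_mono) (auto simp: indicator_def)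
  also have "\<dots> = ennreal C * emeasure lborel ?B" by (simp add: nn_integral_cmult_indicator)
  also have "\<dots> < \<infinity>" using e by (simp add: ennreal_mult_less_top)
  finally have F: "(\<integral>\<^sup>+p. ?F p \<partial>lborel) < \<infinity>" .
  have "(\<integral>\<^sup>+p. ?G p \<partial>lborel) = (\<integral>\<^sup>+y. \<integral>\<^sup>+x. indicator ?B y * ennreal (cutoff_kernel s x y) \<partial>lborel \<partial>lborel)"
    using lborel_pair.nn_integral_snd[OF mF(2)] by (simp add: lborel_prod)
  also have "\<dots> \<le> (\<integral>\<^sup>+x. ennreal C * indicator ?B x \<partial>lborel)"
    using C(2) by (intro nn_integral_mono) (auto simp: indicator_def cutoff_kernel_commute)
  also have "\<dots> = ennreal C * emeasure lborel ?B" by (simp add: nn_integral_cmult_indicator)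
  also have "\<dots> < \<infinity>" using e by (simp add: ennreal_mult_less_top)
  finally have G: "(\<integral>\<^sup>+p. ?G p \<partial>lborel) < \<infinity>" .
  have "sq_integrable lebesgue (diff_quot s \<psi>)" unfolding sq_integrable_def
  proof (intro conjI integrableI_bounded)
    have "(\<integral>\<^sup>+p. ennreal (norm ((diff_quot s \<psi> p)\<^sup>2)) \<partial>lebesgue) \<le> (\<integral>\<^sup>+p. ennreal K * (?F p + ?G p) \<partial>lebesgue)"
    proof (rule nn_integral_mono)
      fix p :: "'a \<times> 'a"
      have "ennreal (norm ((diff_quot s \<psi> p)\<^sup>2)) \<le> ennreal (K * (indicator ?B (fst p) * cutoff_kernel s (fst p) (snd p) + indicator ?B (snd p) * cutoff_kernel s (fst p) (snd p)))"
        using diff_quot[of p] by (simp add: ennreal_leI)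
      also have "\<dots> = ennreal K * (?F p + ?G p)"
        using K by (simp add: ennreal_mult ennreal_plus cutoff_kernel_nonneg ennreal_indicator)
      finally show "ennreal (norm ((diff_quot s \<psi> p)\<^sup>2)) \<le> ennreal K * (?F p + ?G p)" .
    qed
    also have "\<dots> = ennreal K * ((\<integral>\<^sup>+p. ?F p \<partial>lborel) + (\<integral>\<^sup>+p. ?G p \<partial>lborel))"
      using mF unfolding nn_integral_completion lborel_prod
      by (subst nn_integral_cmult) (auto simp: nn_integral_add)
    also have "\<dots> < \<infinity>" using F G by (simp add: ennreal_mult_less_top)
    finally show "(\<integral>\<^sup>+p. ennreal (norm ((diff_quot s \<psi> p)\<^sup>2)) \<partial>lebesgue) < \<infinity>" .
  qed measurable
  moreover have "sq_integrable lebesgue \<psi>"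
  proof (rule sq_integrable_bound[of _ "\<lambda>x. M * indicator ?B x"])
    have "(\<lambda>x. (indicator ?B x :: real)\<^sup>2) = indicator ?B" by (auto simp: indicator_def fun_eq_iff)
    then show "sq_integrable lebesgue (\<lambda>x. M * indicator ?B x)"
      using lmeasurable_ball[of "0::'a" R]
      by (intro sq_integrable_scale) (auto simp: sq_integrable_def fmeasurable_def intro!: borel_measurable_indicator)
    show "AE x in lebesgue. \<bar>\<psi> x\<bar> \<le> \<bar>M * indicator ?B x\<bar>"
      using bnd sB M by (auto simp: indicator_def)
  qed measurable
  ultimately show ?thesis using supp by (simp add: H0s_def Hs_iff)
qed

text \<open>Compact sets of positive measure take the place of arbitrary measurable sets below, because their
indicators are limits of Lipschitz functions.\<close>

lemma compact_subset_positive_measure: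
  fixes S :: "'a::euclidean_space set"
  assumes S: "S \<in> sets lebesgue" "bounded S" "emeasure lebesgue S > 0"
  obtains K where "compact K" "K \<subseteq> S" "emeasure lebesgue K > 0"
proof -
  have "S \<in> lmeasurable" by (rule bounded_set_imp_lmeasurable[OF S(2,1)])
  then have fin: "emeasure lebesgue S = ennreal (measure lebesgue S)"
    by (simp add: emeasure_eq_measure2)
  then have "0 < measure lebesgue S" using S(3) by simp
  then obtain T where T: "closed T" "T \<subseteq> S" "S - T \<in> lmeasurable" "emeasure lebesgue (S - T) < ennreal (measure lebesgue S)"
    using sets_lebesgue_inner_closed[OF S(1)] by blast
  have "compact T" using T(1,2) S(2) bounded_subset compact_eq_bounded_closed by blast
  moreover have "emeasure lebesgue T > 0"
  proof (rule ccontr)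
    assume "\<not> emeasure lebesgue T > 0"
    then have "emeasure lebesgue T = 0" by (simp add: not_gr_zero)
    moreover have "emeasure lebesgue S = emeasure lebesgue T + emeasure lebesgue (S - T)"
      using plus_emeasure[of T lebesgue "S - T"] T by (simp add: Un_absorb1 fmeasurable_def borel_closed)
    ultimately show False using T(4) fin by simp
  qed
  ultimately show thesis using that T(2) by blast
qed

text \<open>Truncated linear functions of the distance to \<open>K\<close>. The squares are included since
quadratic expressions have to be tested as well as linear ones.\<close>

lemma H0s_bump_sequence:
  fixes K :: "'a::euclidean_space set"
  assumes s: "0 < s" "s < 1" and N: "2 \<le> DIM('a)" and \<Omega>: "open \<Omega>" "bounded \<Omega>"
    and K: "compact K" "K \<noteq> {}" "K \<subseteq> \<Omega>"
  obtains \<psi> :: "nat \<Rightarrow> 'a \<Rightarrow> real" where "\<And>n. \<psi> n \<in> H0s s \<Omega>" "\<And>n. (\<lambda>x. (\<psi> n x)\<^sup>2) \<in> H0s s \<Omega>"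
    "\<And>n x. 0 \<le> \<psi> n x" "\<And>n x. \<psi> n x \<le> 1" "\<And>n x. x \<in> K \<Longrightarrow> \<psi> n x = 1"
    "\<And>x. (\<lambda>n. \<psi> n x) \<longlonglongrightarrow> indicator K x"
proof -
  obtain e where e: "e > 0" "{x. infdist x K \<le> e} \<subseteq> \<Omega>"
    using compact_in_open_separated[OF K(2,1) \<Omega>(1) K(3)] by blast
  \<comment> \<open>The slope is at least \<open>1/e\<close>, so that the support stays in the
    \<open>e\<close>-neighbourhood of \<open>K\<close>, and tends to infinity.\<close>
  define c where "c n = real n + 1 / e" for n
  have c1: "0 < c n" for n using e(1) by (simp add: c_def add_nonneg_pos)
  have c2: "1 / c n \<le> e" for n
  proof -
    have "1 / e \<le> c n" by (simp add: c_def)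
    then show ?thesis using e(1) c1[of n] by (simp add: pos_divide_le_eq mult.commute)
  qed
  note c = c1 c2
  define \<psi> where "\<psi> n x = max 0 (1 - c n * infdist x K)" for n x
  have b: "0 \<le> \<psi> n x" "\<psi> n x \<le> 1" for n x using c(1)[of n] by (auto simp: \<psi>_def infdist_nonneg)
  have supp: "\<psi> n x = 0" if "x \<notin> \<Omega>" for n x
  proof -
    have "e < infdist x K" using that e(2) by force
    then have "1 / c n < infdist x K" using c(2)[of n] by simp
    then have "1 < c n * infdist x K" using c(1)[of n] by (simp add: pos_divide_less_eq mult.commute)
    then show ?thesis by (simp add: \<psi>_def)
  qed
  have lip: "\<bar>\<psi> n x - \<psi> n y\<bar> \<le> c n * norm (x - y)" for n x y
  proof -
    have "\<bar>\<psi> n x - \<psi> n y\<bar> \<le> \<bar>c n * infdist x K - c n * infdist y K\<bar>" by (auto simp: \<psi>_def max_def)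
    also have "\<dots> = c n * \<bar>infdist x K - infdist y K\<bar>"
      using c(1)[of n] by (simp add: right_diff_distrib[symmetric] abs_mult)
    also have "\<dots> \<le> c n * norm (x - y)"
      using infdist_triangle_abs[of x K y] c(1)[of n] by (intro mult_left_mono) (auto simp: dist_norm)
    finally show ?thesis .
  qed
  have lip2: "\<bar>(\<psi> n x)\<^sup>2 - (\<psi> n y)\<^sup>2\<bar> \<le> (2 * c n) * norm (x - y)" for n x y
  proof -
    have "\<bar>(\<psi> n x)\<^sup>2 - (\<psi> n y)\<^sup>2\<bar> = \<bar>\<psi> n x + \<psi> n y\<bar> * \<bar>\<psi> n x - \<psi> n y\<bar>"
      by (simp add: abs_mult[symmetric] power2_eq_square algebra_simps)
    also have "\<dots> \<le> 2 * (c n * norm (x - y))"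
      using b[of n x] b[of n y] by (intro mult_mono lip) auto
    finally show ?thesis by simp
  qed
  have one: "\<psi> n x = 1" if "x \<in> K" for n x using that by (simp add: \<psi>_def)
  have lim: "(\<lambda>n. \<psi> n x) \<longlonglongrightarrow> indicator K x" for x
  proof (cases "x \<in> K")
    case True
    then show ?thesis by (simp add: one)
  next
    case False
    then have p: "0 < infdist x K"
      using K compact_imp_closed infdist_pos_not_in_closed by blast
    obtain n0 where n0: "1 / infdist x K < real n0" using reals_Archimedean2 by blast
    have "\<psi> n x = 0" if "n \<ge> n0" for n
    proof -
      have "real n0 \<le> real n" "0 < 1 / e" using that e(1) by simp_all
      then have "1 / infdist x K < c n" using n0 unfolding c_def by linarith
      then have "1 < c n * infdist x K" using p by (simp add: pos_divide_less_eq)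
      then show ?thesis by (simp add: \<psi>_def)
    qed
    then have "\<forall>\<^sub>F n in sequentially. \<psi> n x = 0" by (auto simp: eventually_sequentially)
    then show ?thesis using False by (simp add: tendsto_eventually)
  qed
  show thesis
  proof (rule that[of \<psi>])
    show "\<psi> n \<in> H0s s \<Omega>" for n by (rule lipschitz_in_H0s[OF s N \<Omega>(2) lip supp])
    show "(\<lambda>x. (\<psi> n x)\<^sup>2) \<in> H0s s \<Omega>" for n
      by (rule lipschitz_in_H0s[OF s N \<Omega>(2) lip2]) (simp add: supp)
  qed (use b one lim in auto)
qed

text \<open>Bumps shrinking to a compact set on which \<open>h\<close> is positive; dominated convergence.\<close>

lemma test_function_positive:
  fixes h :: "'a::euclidean_space \<Rightarrow> real"
  assumes s: "0 < s" "s < 1" and N: "2 \<le> DIM('a)" and \<Omega>: "open \<Omega>" "bounded \<Omega>"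
    and h: "integrable lebesgue h" and pos: "emeasure lebesgue {x \<in> \<Omega>. 0 < h x} > 0"
  obtains \<psi> where "\<psi> \<in> H0s s \<Omega>" "(\<lambda>x. (\<psi> x)\<^sup>2) \<in> H0s s \<Omega>" "0 < (\<integral>x. h x * (\<psi> x)\<^sup>2 \<partial>lebesgue)"
proof -
  have hm: "h \<in> borel_measurable lebesgue" using h by auto
  have "h -` {0<..} \<inter> space lebesgue \<in> sets lebesgue" by (rule measurable_sets[OF hm]) simp
  then have "\<Omega> \<inter> (h -` {0<..} \<inter> space lebesgue) \<in> sets lebesgue"
    using \<Omega>(1) by (intro sets.Int) simp_all
  moreover have "\<Omega> \<inter> (h -` {0<..} \<inter> space lebesgue) = {x \<in> \<Omega>. 0 < h x}" by auto
  ultimately have P: "{x \<in> \<Omega>. 0 < h x} \<in> sets lebesgue" by simp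
  have "bounded {x \<in> \<Omega>. 0 < h x}" using \<Omega>(2) by (rule bounded_subset) auto
  from compact_subset_positive_measure[OF P this pos]
  obtain K where K: "compact K" "K \<subseteq> {x \<in> \<Omega>. 0 < h x}" "emeasure lebesgue K > 0" by blast
  have Kn: "K \<noteq> {}" "K \<subseteq> \<Omega>" using K by auto
  have Km: "K \<in> sets lebesgue" using K(1) by (simp add: borel_compact)
  obtain \<psi> where \<psi>: "\<And>n. \<psi> n \<in> H0s s \<Omega>" "\<And>n. (\<lambda>x. (\<psi> n x)\<^sup>2) \<in> H0s s \<Omega>"
    "\<And>n x. 0 \<le> \<psi> n x" "\<And>n x. \<psi> n x \<le> 1" "\<And>n x. x \<in> K \<Longrightarrow> \<psi> n x = 1"
    "\<And>x. (\<lambda>n. \<psi> n x) \<longlonglongrightarrow> indicator K x"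
    using H0s_bump_sequence[OF s N \<Omega> K(1) Kn] by blast
  have \<psi>m: "(\<lambda>x. (\<psi> n x)\<^sup>2) \<in> borel_measurable lebesgue" for n by (rule H0s_measurable[OF \<psi>(2)])
  have lim: "(\<lambda>n. \<integral>x. h x * (\<psi> n x)\<^sup>2 \<partial>lebesgue) \<longlonglongrightarrow> (\<integral>x. h x * (indicator K x)\<^sup>2 \<partial>lebesgue)"
  proof (rule integral_dominated_convergence)
    show "integrable lebesgue (\<lambda>x. \<bar>h x\<bar>)" using h by simp
    show "(\<lambda>x. h x * (indicator K x)\<^sup>2) \<in> borel_measurable lebesgue"
      using Km by (intro borel_measurable_times borel_measurable_power borel_measurable_indicator hm)
    show "(\<lambda>x. h x * (\<psi> n x)\<^sup>2) \<in> borel_measurable lebesgue" for n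
      by (intro borel_measurable_times hm \<psi>m)
    show "AE x in lebesgue. (\<lambda>n. h x * (\<psi> n x)\<^sup>2) \<longlonglongrightarrow> h x * (indicator K x)\<^sup>2"
      by (intro AE_I2 tendsto_mult tendsto_const tendsto_power \<psi>(6))
    show "AE x in lebesgue. norm (h x * (\<psi> n x)\<^sup>2) \<le> \<bar>h x\<bar>" for n
      using \<psi>(3,4) by (intro AE_I2) (simp add: abs_mult mult_left_le power_le_one)
  qed
  have hK: "integrable lebesgue (\<lambda>x. h x * indicator K x)"
    using integrable_real_mult_indicator[OF Km h] .
  have "0 < (\<integral>x. h x * indicator K x \<partial>lebesgue)"
  proof -
    have nn: "0 \<le> h x * indicator K x" for x using K(2) by (auto simp: indicator_def)
    have "\<not> (AE x in lebesgue. h x * indicator K x = 0)"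
    proof
      assume "AE x in lebesgue. h x * indicator K x = 0"
      then have "AE x in lebesgue. x \<notin> K"
        by eventually_elim (use K(2) in \<open>auto simp: indicator_def\<close>)
      then show False using K(3) Km by (simp add: AE_iff_null_sets[symmetric] null_sets_def)
    qed
    then have "(\<integral>x. h x * indicator K x \<partial>lebesgue) \<noteq> 0"
      using integral_nonneg_eq_0_iff_AE[OF hK] nn by simp
    moreover have "0 \<le> (\<integral>x. h x * indicator K x \<partial>lebesgue)" using nn by (rule Bochner_Integration.integral_nonneg)
    ultimately show ?thesis by simp
  qed
  moreover have "(\<integral>x. h x * (indicator K x)\<^sup>2 \<partial>lebesgue) = (\<integral>x. h x * indicator K x \<partial>lebesgue)"
    by (intro Bochner_Integration.integral_cong) (auto simp: indicator_def)
  ultimately have "\<forall>\<^sub>F n in sequentially. 0 < (\<integral>x. h x * (\<psi> n x)\<^sup>2 \<partial>lebesgue)"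
    using order_tendstoD(1)[OF lim, of 0] by simp
  then obtain n where "0 < (\<integral>x. h x * (\<psi> n x)\<^sup>2 \<partial>lebesgue)" by (auto simp: eventually_sequentially)
  with \<psi>(1,2) show thesis by (rule that)
qed

section \<open>Maximisers of the Rayleigh quotient\<close>

definition weight_form :: "('a::euclidean_space \<Rightarrow> real) \<Rightarrow> ('a \<Rightarrow> real) \<Rightarrow> ('a \<Rightarrow> real) \<Rightarrow> real" where
  "weight_form w u v = (\<integral>x. w x * u x * v x \<partial>lebesgue)"

text \<open>The bound is required at every point of the whole space, so that estimates under the integral sign
hold pointwise.\<close>

definition weight :: "real \<Rightarrow> ('a::euclidean_space \<Rightarrow> real) \<Rightarrow> bool" where
  "weight C w \<longleftrightarrow> w \<in> borel_measurable lebesgue \<and> (\<forall>x. \<bar>w x\<bar> \<le> C)"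

lemma weight_integrable_mult:
  assumes w: "weight C w" and h: "integrable lebesgue h"
  shows "integrable lebesgue (\<lambda>x. w x * h x)"
proof (rule Bochner_Integration.integrable_bound[of _ "\<lambda>x. C * \<bar>h x\<bar>"])
  show "integrable lebesgue (\<lambda>x. C * \<bar>h x\<bar>)" using h by simp
  show "(\<lambda>x. w x * h x) \<in> borel_measurable lebesgue"
    using w h by (auto simp: weight_def)
  have C: "0 \<le> C" using w abs_ge_zero order_trans unfolding weight_def by blast
  show "AE x in lebesgue. norm (w x * h x) \<le> norm (C * \<bar>h x\<bar>)"
    using w C by (intro AE_I2) (simp add: weight_def abs_mult mult_right_mono)
qed

lemma weight_form_integrable:
  assumes "weight C w" "u \<in> H0s s \<Omega>" "v \<in> H0s s \<Omega>"
  shows "integrable lebesgue (\<lambda>x. w x * u x * v x)"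
  using weight_integrable_mult[OF assms(1) sq_integrable_mult[OF H0s_sq[OF assms(2)] H0s_sq[OF assms(3)]]]
  by (simp add: mult.assoc)

lemma weight_form_le:
  assumes w: "weight C w" and u: "u \<in> H0s s \<Omega>"
  shows "weight_form w u u \<le> C * (\<integral>x. (u x)\<^sup>2 \<partial>lebesgue)"
proof -
  have "weight_form w u u \<le> (\<integral>x. C * (u x)\<^sup>2 \<partial>lebesgue)" unfolding weight_form_def
  proof (rule integral_mono[OF weight_form_integrable[OF w u u]])
    show "integrable lebesgue (\<lambda>x. C * (u x)\<^sup>2)" using H0s_sq[OF u] by (simp add: sq_integrable_def)
    fix x
    have "w x \<le> C" using w abs_ge_self order_trans unfolding weight_def by blast
    then show "w x * u x * u x \<le> C * (u x)\<^sup>2"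
      by (simp add: power2_eq_square mult.assoc mult_right_mono)
  qed
  then show ?thesis by simp
qed

text \<open>The polarised amount by which \<open>\<mu>\<close> times the energy exceeds the weighted square
integral. It is nonnegative on the diagonal exactly when \<open>\<mu>\<close> bounds the Rayleigh
quotient.\<close>

definition deficit :: "real \<Rightarrow> real \<Rightarrow> ('a::euclidean_space \<Rightarrow> real) \<Rightarrow> ('a \<Rightarrow> real) \<Rightarrow> ('a \<Rightarrow> real) \<Rightarrow> real" where
  "deficit s \<mu> w u v = \<mu> * inner_H0s s u v - weight_form w u v"

lemma weight_form_commute: "weight_form w u v = weight_form w v u"
  by (simp add: weight_form_def mult.assoc mult.commute[of "u _"])

lemma deficit_commute: "deficit s \<mu> w u v = deficit s \<mu> w v u"
  by (simp add: deficit_def inner_H0s_commute[of s u] weight_form_commute[of w u])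

lemma deficit_add_left:
  assumes "weight C w" "u \<in> H0s s \<Omega>" "v \<in> H0s s \<Omega>" "z \<in> H0s s \<Omega>"
  shows "deficit s \<mu> w (\<lambda>x. u x + v x) z = deficit s \<mu> w u z + deficit s \<mu> w v z"
proof -
  have "weight_form w (\<lambda>x. u x + v x) z = weight_form w u z + weight_form w v z"
    unfolding weight_form_def
    using weight_form_integrable[OF assms(1,2,4)] weight_form_integrable[OF assms(1,3,4)]
    by (simp add: distrib_left distrib_right)
  then show ?thesis using inner_H0s_add_left[OF assms(2-4)] by (simp add: deficit_def algebra_simps)
qed

lemma deficit_scale_left: "deficit s \<mu> w (\<lambda>x. c * u x) z = c * deficit s \<mu> w u z"
proof -
  have "weight_form w (\<lambda>x. c * u x) z = c * weight_form w u z"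
    unfolding weight_form_def integral_mult_right_zero[symmetric]
    by (rule Bochner_Integration.integral_cong) simp_all
  then show ?thesis by (simp add: deficit_def inner_H0s_scale_left algebra_simps)
qed

lemma deficit_expand:
  assumes "weight C w" "u \<in> H0s s \<Omega>" "v \<in> H0s s \<Omega>"
  shows "deficit s \<mu> w (\<lambda>x. u x + t * v x) (\<lambda>x. u x + t * v x)
    = deficit s \<mu> w u u + 2 * t * deficit s \<mu> w u v + t\<^sup>2 * deficit s \<mu> w v v"
proof -
  let ?Q = "deficit s \<mu> w" and ?z = "\<lambda>x. u x + t * v x"
  have tv: "(\<lambda>x. t * v x) \<in> H0s s \<Omega>" by (rule H0s_scale[OF assms(3)])
  have z: "?z \<in> H0s s \<Omega>" by (rule H0s_add[OF assms(2) tv])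
  have 1: "?Q ?z y = ?Q u y + t * ?Q v y" if "y \<in> H0s s \<Omega>" for y
    using deficit_add_left[OF assms(1,2) tv that] by (simp add: deficit_scale_left)
  have "?Q ?z ?z = ?Q u ?z + t * ?Q v ?z" by (rule 1[OF z])
  also have "?Q u ?z = ?Q u u + t * ?Q u v"
    using 1[OF assms(2)] deficit_commute[of s \<mu> w u ?z] deficit_commute[of s \<mu> w v u] by simp
  also have "?Q v ?z = ?Q u v + t * ?Q v v"
    using 1[OF assms(3)] deficit_commute[of s \<mu> w v ?z] by simp
  finally show ?thesis by (simp add: power2_eq_square algebra_simps)
qed

text \<open>Both the sum and the difference appear in the parallelogram identity, and nonnegativity allows one
of them to be dropped.\<close>

lemma deficit_parallelogram_le:
  assumes w: "weight C w" and nn: "\<And>u. u \<in> H0s s \<Omega> \<Longrightarrow> 0 \<le> deficit s \<mu> w u u"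
    and u: "u \<in> H0s s \<Omega>" and v: "v \<in> H0s s \<Omega>"
  shows "deficit s \<mu> w (\<lambda>x. u x - v x) (\<lambda>x. u x - v x) \<le> 2 * deficit s \<mu> w u u + 2 * deficit s \<mu> w v v"
    and "deficit s \<mu> w (\<lambda>x. u x + v x) (\<lambda>x. u x + v x) \<le> 2 * deficit s \<mu> w u u + 2 * deficit s \<mu> w v v"
  using deficit_expand[OF w u v, of \<mu> 1] deficit_expand[OF w u v, of \<mu> "-1"]
    nn[OF H0s_add[OF u v]] nn[OF H0s_diff[OF u v]] by simp_all

text \<open>A nonnegative quadratic form has a critical point at every zero; applied to maximisers this is the
Euler-Lagrange equation.\<close>

lemma deficit_null_vector:
  assumes w: "weight C w" and nn: "\<And>u. u \<in> H0s s \<Omega> \<Longrightarrow> 0 \<le> deficit s \<mu> w u u"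
    and u: "u \<in> H0s s \<Omega>" and v: "v \<in> H0s s \<Omega>" and 0: "deficit s \<mu> w u u = 0"
  shows "deficit s \<mu> w u v = 0"
proof -
  let ?b = "deficit s \<mu> w u v" and ?a = "deficit s \<mu> w v v"
  have a: "0 \<le> ?a" by (rule nn[OF v])
  have *: "0 \<le> 2 * t * ?b + t\<^sup>2 * ?a" for t
    using nn[OF H0s_add[OF u H0s_scale[OF v, of t]]] deficit_expand[OF w u v, of \<mu> t] 0 by simp
  \<comment> \<open>The value \<open>-b/(a+1)\<close> makes the linear term dominate, also when \<open>a = 0\<close>.\<close>
  have "0 \<le> 2 * (- ?b / (?a + 1)) * ?b + (- ?b / (?a + 1))\<^sup>2 * ?a" by (rule *)
  also have "\<dots> = - ?b\<^sup>2 * (?a + 2) / (?a + 1)\<^sup>2"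
    using a by (simp add: divide_simps power2_eq_square) (simp add: algebra_simps)
  finally have "?b\<^sup>2 * (?a + 2) / (?a + 1)\<^sup>2 \<le> 0" by simp
  then have "?b\<^sup>2 * (?a + 2) \<le> 0" using a by (simp add: divide_le_0_iff zero_less_power)
  then show ?thesis using a by (simp add: mult_le_0_iff)
qed

lemma inner_H0s_pos_iff:
  assumes s: "0 < s" and bd: "bounded \<Omega>" and u: "u \<in> H0s s \<Omega>"
  shows "0 < inner_H0s s u u \<longleftrightarrow> \<not> (AE x in lebesgue. u x = 0)"
proof -
  obtain C where C: "0 < C" "\<And>u. u \<in> H0s s \<Omega> \<Longrightarrow> (\<integral>x. (u x)\<^sup>2 \<partial>lebesgue) \<le> C * inner_H0s s u u"
    using H0s_poincare[OF s bd] by blast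
  have "inner_H0s s u u = 0" if "AE x in lebesgue. u x = 0"
  proof -
    have "AE p in lebesgue. diff_quot s u p * diff_quot s u p = 0"
      using AE_lebesgue_fst[OF that] AE_lebesgue_snd[OF that]
      by eventually_elim (simp add: diff_quot_def)
    then show ?thesis unfolding inner_H0s_diff_quot by (rule integral_eq_zero_AE)
  qed
  moreover have "AE x in lebesgue. u x = 0" if "inner_H0s s u u = 0"
  proof -
    have "(\<integral>x. (u x)\<^sup>2 \<partial>lebesgue) \<le> 0" using C(2)[OF u] that by simp
    moreover have "0 \<le> (\<integral>x. (u x)\<^sup>2 \<partial>lebesgue)" by simp
    ultimately have "(\<integral>x. (u x)\<^sup>2 \<partial>lebesgue) = 0" by linarith
    then have "AE x in lebesgue. (u x)\<^sup>2 = 0"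
      using H0s_sq[OF u] by (subst (asm) integral_nonneg_eq_0_iff_AE) (auto simp: sq_integrable_def)
    then show ?thesis by eventually_elim simp
  qed
  ultimately show ?thesis using inner_H0s_nonneg[of s u] by (auto simp: less_le)
qed

text \<open>Bolzano-Weierstrass, applied once for each index.\<close>

lemma finite_family_convergent_subseq:
  fixes x :: "'i \<Rightarrow> nat \<Rightarrow> real"
  assumes "finite F" "\<And>i. i \<in> F \<Longrightarrow> bounded (range (x i))"
  obtains r where "strict_mono (r :: nat \<Rightarrow> nat)" "\<And>i. i \<in> F \<Longrightarrow> convergent (\<lambda>n. x i (r n))"
proof -
  have "\<exists>r. strict_mono (r :: nat \<Rightarrow> nat) \<and> (\<forall>i\<in>F. convergent (\<lambda>n. x i (r n)))"
    using assms
  proof (induction F rule: finite_induct)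
    case empty
    then show ?case by (auto intro: exI[of _ id] strict_mono_id)
  next
    case (insert i F)
    then obtain r where r: "strict_mono (r :: nat \<Rightarrow> nat)" "\<forall>j\<in>F. convergent (\<lambda>n. x j (r n))" by auto
    have "bounded (range (x i))" using insert.prems[of i] by simp
    then have "bounded (range (\<lambda>n. x i (r n)))" by (rule bounded_subset) auto
    then obtain l q where q: "strict_mono (q :: nat \<Rightarrow> nat)" "((\<lambda>n. x i (r n)) \<circ> q) \<longlonglongrightarrow> l"
      using bounded_imp_convergent_subsequence by blast
    have "convergent (\<lambda>n. x j (r (q n)))" if "j \<in> F" for j
      using convergent_subseq_convergent[OF r(2)[rule_format, OF that] q(1)] by (simp add: o_def)
    moreover have "convergent (\<lambda>n. x i (r (q n)))"
      using q(2) by (auto simp: o_def convergent_def)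
    moreover have "strict_mono (\<lambda>n. r (q n))"
      using strict_mono_o[OF r(1) q(1)] by (simp add: o_def)
    ultimately show ?case by (intro exI[of _ "\<lambda>n. r (q n)"]) auto
  qed
  then show thesis using that by blast
qed

lemma abs_cell_integral_le:
  assumes u: "sq_integrable lebesgue u" and A: "A \<in> lmeasurable"
  shows "\<bar>\<integral>x. indicator A x * u x \<partial>lebesgue\<bar> \<le> measure lebesgue A + (\<integral>x. (u x)\<^sup>2 \<partial>lebesgue)"
proof -
  have iA: "integrable lebesgue (indicator A :: 'a \<Rightarrow> real)" using A by (auto simp: fmeasurable_def)
  have iu: "integrable lebesgue (\<lambda>x. (u x)\<^sup>2)" using u by (simp add: sq_integrable_def)
  have "\<bar>\<integral>x. indicator A x * u x \<partial>lebesgue\<bar> \<le> (\<integral>x. \<bar>indicator A x * u x\<bar> \<partial>lebesgue)"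
    by (rule integral_abs_bound)
  also have "\<dots> \<le> (\<integral>x. indicator A x + (u x)\<^sup>2 \<partial>lebesgue)"
  proof (rule integral_mono)
    show "integrable lebesgue (\<lambda>x. \<bar>indicator A x * u x\<bar>)"
      using integrable_indicator_mult_sq(1)[OF u A] by simp
    show "integrable lebesgue (\<lambda>x. indicator A x + (u x)\<^sup>2)" using iA iu by simp
    have "\<bar>a\<bar> \<le> 1 + a\<^sup>2" for a :: real
    proof (cases "\<bar>a\<bar> \<le> 1")
      case False
      then have "\<bar>a\<bar> * 1 \<le> \<bar>a\<bar> * \<bar>a\<bar>" by (intro mult_left_mono) auto
      then show ?thesis by (simp add: power2_eq_square abs_mult_self_eq)
    qed (use zero_le_power2[of a] in linarith)
    then show "\<bar>indicator A x * u x\<bar> \<le> indicator A x + (u x)\<^sup>2" for x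
      by (cases "x \<in> A") auto
  qed
  also have "\<dots> = measure lebesgue A + (\<integral>x. (u x)\<^sup>2 \<partial>lebesgue)"
    using iA iu by simp
  finally show ?thesis .
qed

text \<open>A normalised maximising sequence is made Cauchy in the Gagliardo norm. The deficit of differences
tends to 0 by the parallelogram inequality; the weighted integral of \<open>(g m - g
n)\<^sup>2\<close> is split by the cell inequality into half of \<open>\<mu>\<close> times the
energy, which is absorbed, and finitely many cell integrals, which converge along a subsequence.
The strong limit has deficit 0 and cannot vanish because the energies are all 1.\<close>

lemma rayleigh_maximizer_exists:
  fixes \<Omega> :: "'a::euclidean_space set"
  assumes s: "0 < s" "s < 1" and N: "2 \<le> DIM('a)" and \<Omega>: "open \<Omega>" "bounded \<Omega>"
    and w: "weight M w" and w0: "\<And>x. x \<notin> \<Omega> \<Longrightarrow> w x = 0" and pos: "emeasure lebesgue {x \<in> \<Omega>. 0 < w x} > 0"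
  obtains \<mu> f where "0 < \<mu>" "f \<in> H0s s \<Omega>" "\<not> (AE x in lebesgue. f x = 0)"
    "\<And>u. u \<in> H0s s \<Omega> \<Longrightarrow> weight_form w u u \<le> \<mu> * inner_H0s s u u"
    "weight_form w f f = \<mu> * inner_H0s s f f"
proof -
  have M: "0 \<le> M" using w abs_ge_zero order_trans unfolding weight_def by blast
  obtain C where C: "0 < C" "\<And>u. u \<in> H0s s \<Omega> \<Longrightarrow> (\<integral>x. (u x)\<^sup>2 \<partial>lebesgue) \<le> C * inner_H0s s u u"
    using H0s_poincare[OF s(1) \<Omega>(2)] by blast
  have WE: "weight_form w u u \<le> M * C * inner_H0s s u u" if "u \<in> H0s s \<Omega>" for u
    using weight_form_le[OF w that] mult_left_mono[OF C(2)[OF that] M] by (simp add: mult.assoc)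
  have wi: "integrable lebesgue w"
  proof -
    have "\<Omega> \<in> lmeasurable" using \<Omega> by (simp add: lmeasurable_open)
    then have "integrable lebesgue (indicator \<Omega> :: 'a \<Rightarrow> real)" by (auto simp: fmeasurable_def)
    from weight_integrable_mult[OF w this] have "integrable lebesgue (\<lambda>x. w x * indicator \<Omega> x)" .
    moreover have "(\<lambda>x. w x * indicator \<Omega> x) = w" using w0 by (auto simp: fun_eq_iff indicator_def)
    ultimately show ?thesis by simp
  qed
  define S where "S = {weight_form w u u / inner_H0s s u u | u. u \<in> H0s s \<Omega> \<and> 0 < inner_H0s s u u}"
  obtain \<psi> where \<psi>: "\<psi> \<in> H0s s \<Omega>" "0 < (\<integral>x. w x * (\<psi> x)\<^sup>2 \<partial>lebesgue)"
    using test_function_positive[OF s N \<Omega> wi pos] by blast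
  have W\<psi>: "0 < weight_form w \<psi> \<psi>" using \<psi>(2) by (simp add: weight_form_def power2_eq_square mult.assoc)
  then have "inner_H0s s \<psi> \<psi> \<noteq> 0" using WE[OF \<psi>(1)] by auto
  then have E\<psi>: "0 < inner_H0s s \<psi> \<psi>" using inner_H0s_nonneg[of s \<psi>] by simp
  have \<psi>S: "weight_form w \<psi> \<psi> / inner_H0s s \<psi> \<psi> \<in> S" using \<psi>(1) E\<psi> by (auto simp: S_def)
  have bdd: "bdd_above S"
  proof (rule bdd_aboveI)
    show "x \<le> M * C" if "x \<in> S" for x
      using that WE by (auto simp: S_def pos_divide_le_eq)
  qed
  define \<mu> where "\<mu> = Sup S"
  have "weight_form w \<psi> \<psi> / inner_H0s s \<psi> \<psi> \<le> \<mu>" unfolding \<mu>_def by (rule cSup_upper[OF \<psi>S bdd])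
  moreover have "0 < weight_form w \<psi> \<psi> / inner_H0s s \<psi> \<psi>" using W\<psi> E\<psi> by simp
  ultimately have \<mu>: "0 < \<mu>" by linarith
  have upper: "weight_form w u u \<le> \<mu> * inner_H0s s u u" if u: "u \<in> H0s s \<Omega>" for u
  proof (cases "0 < inner_H0s s u u")
    case True
    then have "weight_form w u u / inner_H0s s u u \<in> S" using u by (auto simp: S_def)
    then have "weight_form w u u / inner_H0s s u u \<le> \<mu>" unfolding \<mu>_def by (rule cSup_upper[OF _ bdd])
    then show ?thesis using True by (simp add: pos_divide_le_eq)
  next
    case False
    then have "inner_H0s s u u = 0" using inner_H0s_nonneg[of s u] by simp
    then show ?thesis using WE[OF u] by simp
  qed
  let ?Q = "deficit s \<mu> w" and ?E = "inner_H0s s"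
  have nn: "0 \<le> ?Q u u" if "u \<in> H0s s \<Omega>" for u using upper[OF that] by (simp add: deficit_def)
  have "\<exists>u. u \<in> H0s s \<Omega> \<and> ?E u u = 1 \<and> ?Q u u \<le> 1 / real (Suc n)" for n
  proof -
    have "\<mu> - 1 / real (Suc n) < Sup S" by (simp add: \<mu>_def)
    then obtain y where "y \<in> S" "\<mu> - 1 / real (Suc n) < y" using \<psi>S by (metis empty_iff less_cSupE)
    then obtain u where u: "u \<in> H0s s \<Omega>" "0 < ?E u u" "\<mu> - 1 / real (Suc n) < weight_form w u u / ?E u u"
      by (auto simp: S_def)
    define c where "c = 1 / sqrt (?E u u)"
    have c2: "c * c = 1 / ?E u u" using u(2) by (simp add: c_def)
    have E1: "?E (\<lambda>x. c * u x) (\<lambda>x. c * u x) = 1"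
      using u(2) c2 inner_H0s_scale_left[of s c u "\<lambda>x. c * u x"] inner_H0s_scale_left[of s c u u]
        inner_H0s_commute[of s u "\<lambda>x. c * u x"] by (simp add: mult.assoc[symmetric])
    have "?Q (\<lambda>x. c * u x) (\<lambda>x. c * u x) = (c * c) * ?Q u u"
      using deficit_scale_left[of s \<mu> w c u "\<lambda>x. c * u x"] deficit_scale_left[of s \<mu> w c u u]
        deficit_commute[of s \<mu> w u "\<lambda>x. c * u x"] by (simp add: mult.assoc)
    also have "\<dots> = \<mu> - weight_form w u u / ?E u u"
      using u(2) by (simp add: c2 deficit_def diff_divide_distrib)
    also have "\<dots> \<le> 1 / real (Suc n)" using u(3) by linarith
    finally show ?thesis using E1 H0s_scale[OF u(1), of c] by blast
  qed
  then obtain f where f: "\<And>n. f n \<in> H0s s \<Omega>" "\<And>n. ?E (f n) (f n) = 1" "\<And>n. ?Q (f n) (f n) \<le> 1 / real (Suc n)"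
    by metis
  \<comment> \<open>Small enough that the energy term of the cell inequality, multiplied by the bound \<open>M\<close>
    of the weight, is at most half of \<open>\<mu>\<close> times the energy.\<close>
  define \<delta> where "\<delta> = \<mu> / (2 * (M + 1))"
  have \<delta>: "0 < \<delta>" using \<mu> M by (simp add: \<delta>_def)
  have M\<delta>: "M * \<delta> \<le> \<mu> / 2" using \<mu> M by (simp add: \<delta>_def field_simps)
  obtain \<A> where \<A>: "finite \<A>" "\<And>A. A \<in> \<A> \<Longrightarrow> A \<in> lmeasurable" "\<And>A. A \<in> \<A> \<Longrightarrow> 0 < measure lebesgue A"
    and cell: "\<And>u. u \<in> H0s s \<Omega> \<Longrightarrow> (\<integral>x. (u x)\<^sup>2 \<partial>lebesgue)
       \<le> \<delta> * ?E u u + (\<Sum>A\<in>\<A>. (\<integral>x. indicator A x * u x \<partial>lebesgue)\<^sup>2 / measure lebesgue A)"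
    using H0s_cell_poincare[OF s(1) \<Omega>(2) \<delta>] by blast
  define a where "a A n = (\<integral>x. indicator A x * f n x \<partial>lebesgue)" for A n
  have "bounded (range (a A))" if "A \<in> \<A>" for A
  proof (rule boundedI)
    fix y assume "y \<in> range (a A)"
    then obtain n where y: "y = a A n" by auto
    show "norm y \<le> measure lebesgue A + C"
      using abs_cell_integral_le[OF H0s_sq[OF f(1)[of n]] \<A>(2)[OF that]] C(2)[OF f(1)[of n]] f(2)[of n]
      by (simp add: y a_def)
  qed
  then obtain r where r: "strict_mono (r :: nat \<Rightarrow> nat)" "\<And>A. A \<in> \<A> \<Longrightarrow> convergent (\<lambda>n. a A (r n))"
    using finite_family_convergent_subseq[OF \<A>(1), of a] by blast
  define l where "l A = lim (\<lambda>n. a A (r n))" for A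
  have l: "(\<lambda>n. a A (r n)) \<longlonglongrightarrow> l A" if "A \<in> \<A>" for A
    using r(2)[OF that] by (simp add: l_def convergent_LIMSEQ_iff)
  define g where "g n = f (r n)" for n
  have g: "g n \<in> H0s s \<Omega>" "?E (g n) (g n) = 1" for n by (simp_all add: g_def f)
  have Qg: "(\<lambda>n. ?Q (g n) (g n)) \<longlonglongrightarrow> 0"
  proof (rule tendsto_sandwich)
    show "\<forall>\<^sub>F n in sequentially. 0 \<le> ?Q (g n) (g n)" by (simp add: nn g)
    show "\<forall>\<^sub>F n in sequentially. ?Q (g n) (g n) \<le> 1 / real (Suc (r n))"
      unfolding g_def by (intro always_eventually allI f(3))
    show "(\<lambda>n. 1 / real (Suc (r n))) \<longlonglongrightarrow> 0"
      using LIMSEQ_subseq_LIMSEQ[OF LIMSEQ_Suc[OF lim_1_over_n] r(1)] by (simp add: o_def)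
  qed simp
  \<comment> \<open>The energy of \<open>g m - g n\<close> is at most \<open>t m + t n\<close>. Comparing each cell
    integral with its limit separates the two indices.\<close>
  define t where "t n = 2 / \<mu> * (2 * ?Q (g n) (g n) + M * (\<Sum>A\<in>\<A>. 2 * (a A (r n) - l A)\<^sup>2 / measure lebesgue A))" for n
  have "t \<longlonglongrightarrow> 2 / \<mu> * (2 * 0 + M * (\<Sum>A\<in>\<A>. 2 * (l A - l A)\<^sup>2 / measure lebesgue A))"
    unfolding t_def by (intro tendsto_intros Qg l) (use \<A>(3) in force)+
  then have t0: "t \<longlonglongrightarrow> 0" by simp
  have gap: "?E (\<lambda>x. g m x - g n x) (\<lambda>x. g m x - g n x) \<le> t m + t n" for m n
  proof -
    let ?d = "\<lambda>x. g m x - g n x"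
    have d: "?d \<in> H0s s \<Omega>" by (rule H0s_diff[OF g(1) g(1)])
    have sqb: "(\<integral>x. indicator A x * ?d x \<partial>lebesgue)\<^sup>2 / measure lebesgue A
        \<le> 2 * (a A (r m) - l A)\<^sup>2 / measure lebesgue A + 2 * (a A (r n) - l A)\<^sup>2 / measure lebesgue A" if "A \<in> \<A>" for A
    proof -
      have "(\<integral>x. indicator A x * ?d x \<partial>lebesgue) = a A (r m) - a A (r n)"
        using integrable_indicator_mult_sq(1)[OF H0s_sq[OF g(1)] \<A>(2)[OF that]]
        by (simp add: a_def g_def[symmetric] right_diff_distrib)
      moreover have "(p - q)\<^sup>2 \<le> 2 * (p - k)\<^sup>2 + 2 * (q - k)\<^sup>2" for p q k :: real
        using zero_le_power2[of "(p - k) + (q - k)"] by (simp add: power2_eq_square algebra_simps)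
      ultimately show ?thesis using \<A>(3)[OF that]
        by (simp add: add_divide_distrib[symmetric] divide_right_mono)
    qed
    have "\<mu> * ?E ?d ?d = ?Q ?d ?d + weight_form w ?d ?d" by (simp add: deficit_def)
    also have "?Q ?d ?d \<le> 2 * ?Q (g m) (g m) + 2 * ?Q (g n) (g n)"
      by (rule deficit_parallelogram_le(1)[OF w nn g(1) g(1)])
    also have "weight_form w ?d ?d \<le> M * (\<integral>x. (?d x)\<^sup>2 \<partial>lebesgue)" by (rule weight_form_le[OF w d])
    also have "\<dots> \<le> M * (\<delta> * ?E ?d ?d + (\<Sum>A\<in>\<A>. (\<integral>x. indicator A x * ?d x \<partial>lebesgue)\<^sup>2 / measure lebesgue A))"
      by (rule mult_left_mono[OF cell[OF d] M])
    also have "\<dots> \<le> M * \<delta> * ?E ?d ?d + M * (\<Sum>A\<in>\<A>. 2 * (a A (r m) - l A)\<^sup>2 / measure lebesgue A + 2 * (a A (r n) - l A)\<^sup>2 / measure lebesgue A)"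
      unfolding distrib_left mult.assoc by (intro add_left_mono mult_left_mono M sum_mono sqb)
    also have "M * \<delta> * ?E ?d ?d \<le> \<mu> / 2 * ?E ?d ?d" by (rule mult_right_mono[OF M\<delta> inner_H0s_nonneg])
    finally have "\<mu> / 2 * ?E ?d ?d \<le> 2 * ?Q (g m) (g m) + 2 * ?Q (g n) (g n)
        + M * (\<Sum>A\<in>\<A>. 2 * (a A (r m) - l A)\<^sup>2 / measure lebesgue A + 2 * (a A (r n) - l A)\<^sup>2 / measure lebesgue A)"
      by simp
    also have "\<dots> = \<mu> / 2 * (t m + t n)"
      using \<mu> by (simp add: t_def sum.distrib distrib_left)
    finally show ?thesis using \<mu> by simp
  qed
  obtain h where h: "h \<in> H0s s \<Omega>" and hl: "(\<lambda>n. ?E (\<lambda>x. g n x - h x) (\<lambda>x. g n x - h x)) \<longlonglongrightarrow> 0"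
  proof (rule H0s_complete[OF s(1) \<Omega>(2) g(1)])
    fix \<epsilon> :: real assume "0 < \<epsilon>"
    then have "\<forall>\<^sub>F n in sequentially. t n < \<epsilon> / 2" using order_tendstoD(2)[OF t0, of "\<epsilon> / 2"] by simp
    then obtain N where N: "\<And>n. n \<ge> N \<Longrightarrow> t n < \<epsilon> / 2" by (auto simp: eventually_sequentially)
    have "?E (\<lambda>x. g m x - g n x) (\<lambda>x. g m x - g n x) \<le> \<epsilon>" if "m \<ge> N" "n \<ge> N" for m n
      using gap[of m n] N[OF that(1)] N[OF that(2)] by linarith
    then show "\<exists>N. \<forall>m\<ge>N. \<forall>n\<ge>N. ?E (\<lambda>x. g m x - g n x) (\<lambda>x. g m x - g n x) \<le> \<epsilon>" by blast
  qed blast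
  let ?e = "\<lambda>n x. g n x - h x"
  have e: "?e n \<in> H0s s \<Omega>" for n by (rule H0s_diff[OF g(1) h])
  have wabs: "- weight_form w u u \<le> M * C * ?E u u" if u: "u \<in> H0s s \<Omega>" for u
  proof -
    have "weight M (\<lambda>x. - w x)" using w by (simp add: weight_def)
    from weight_form_le[OF this u] have "- weight_form w u u \<le> M * (\<integral>x. (u x)\<^sup>2 \<partial>lebesgue)"
      by (simp add: weight_form_def)
    then show ?thesis using mult_left_mono[OF C(2)[OF u] M] by (simp add: mult.assoc)
  qed
  have Qe: "?Q (?e n) (?e n) \<le> (\<mu> + M * C) * ?E (?e n) (?e n)" for n
    using wabs[OF e[of n]] by (simp add: deficit_def distrib_right)
  have "?Q h h \<le> 2 * ?Q (g n) (g n) + 2 * ((\<mu> + M * C) * ?E (?e n) (?e n))" for n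
    using deficit_parallelogram_le(1)[OF w nn g(1)[of n] e[of n]] Qe[of n] by simp
  moreover have "(\<lambda>n. 2 * ?Q (g n) (g n) + 2 * ((\<mu> + M * C) * ?E (?e n) (?e n))) \<longlonglongrightarrow> 2 * 0 + 2 * ((\<mu> + M * C) * 0)"
    by (intro tendsto_intros Qg hl)
  ultimately have "?Q h h \<le> 2 * 0 + 2 * ((\<mu> + M * C) * 0)"
    by (intro LIMSEQ_le_const) auto
  then have Qh: "?Q h h = 0" using nn[OF h] by simp
  \<comment> \<open>With weight 0 and \<open>\<mu> = 1\<close> the deficit is the energy itself, so the parallelogram
    inequality also serves for the energy.\<close>
  have w0': "weight 0 (\<lambda>x::'a. 0::real)" by (simp add: weight_def)
  have "1 \<le> 2 * ?E h h + 2 * ?E (?e n) (?e n)" for n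
  proof -
    have z: "deficit s 1 (\<lambda>x. 0) u u = ?E u u" for u :: "'a \<Rightarrow> real" by (simp add: deficit_def weight_form_def)
    have "0 \<le> deficit s 1 (\<lambda>x. 0) u u" for u :: "'a \<Rightarrow> real" unfolding z by (rule inner_H0s_nonneg)
    from deficit_parallelogram_le(2)[OF w0' this h e[of n]] show ?thesis
      using g(2)[of n] by (simp add: z)
  qed
  moreover have "(\<lambda>n. 2 * ?E h h + 2 * ?E (?e n) (?e n)) \<longlonglongrightarrow> 2 * ?E h h + 2 * 0"
    by (intro tendsto_intros hl)
  ultimately have "1 \<le> 2 * ?E h h + 2 * 0" by (intro LIMSEQ_le_const) auto
  then have "\<not> (AE x in lebesgue. h x = 0)" using inner_H0s_pos_iff[OF s(1) \<Omega>(2) h] by simp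
  moreover have "weight_form w h h = \<mu> * ?E h h" using Qh by (simp add: deficit_def)
  ultimately show thesis using that[OF \<mu> h _ upper] by blast
qed

section \<open>Positivity of nonnegative solutions\<close>

lemma H0s_integrable:
  assumes "open \<Omega>" "bounded \<Omega>" "u \<in> H0s s \<Omega>"
  shows "integrable lebesgue u"
proof -
  have O: "\<Omega> \<in> lmeasurable" using assms(1,2) by (simp add: lmeasurable_open)
  have "integrable lebesgue (\<lambda>x. indicator \<Omega> x * u x)"
    by (rule integrable_indicator_mult_sq(1)[OF H0s_sq[OF assms(3)] O])
  moreover have "AE x in lebesgue. indicator \<Omega> x * u x = u x"
    using assms(3) by (auto simp: H0s_def indicator_def elim!: eventually_mono)
  ultimately show ?thesis
    using integrable_cong_AE[OF _ H0s_measurable[OF assms(3)]] borel_measurable_integrable by blast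
qed

text \<open>A strong maximum principle of nonlocal type. With \<open>z = \<psi> - f/\<epsilon>\<close>, its
positive part \<open>\<theta>\<close> and negative part \<open>\<nu>\<close>, the equation tested
with \<open>\<theta>\<close> shows that minus the energy pairing of \<open>\<nu>\<close> and
\<open>\<theta>\<close> is bounded independently of \<open>\<epsilon>\<close>. As
\<open>\<nu>\<close> and \<open>\<theta>\<close> have disjoint supports, this quantity is the
integral of the nonnegative interaction \<open>\<nu> x \<theta> y + \<nu> y \<theta> x\<close>
against the kernel. On \<open>K\<close>, where \<open>f = 0\<close> and \<open>\<psi> = 1\<close>,
one has \<open>\<theta> = 1\<close>, while \<open>\<epsilon> \<nu> x \<ge> f x -
\<epsilon>\<close>; so \<open>|K| \<integral>f\<close> is of order \<open>\<epsilon>\<close>.\<close>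

lemma nonneg_solution_positive:
  fixes \<Omega> :: "'a::euclidean_space set"
  assumes s: "0 < s" "s < 1" and N: "2 \<le> DIM('a)" and \<Omega>: "open \<Omega>" "bounded \<Omega>"
    and w: "weight M w" and f: "f \<in> H0s s \<Omega>" "\<And>x. 0 \<le> f x" "\<not> (AE x in lebesgue. f x = 0)"
    and eq: "\<And>\<phi>. \<phi> \<in> H0s s \<Omega> \<Longrightarrow> inner_H0s s f \<phi> = weight_form w f \<phi>"
  shows "AE x in lebesgue. x \<in> \<Omega> \<longrightarrow> 0 < f x"
proof (rule ccontr)
  assume contra: "\<not> (AE x in lebesgue. x \<in> \<Omega> \<longrightarrow> 0 < f x)"
  have M: "0 \<le> M" using w abs_ge_zero order_trans unfolding weight_def by blast
  have O: "\<Omega> \<in> lmeasurable" using \<Omega> by (simp add: lmeasurable_open)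
  then have Om: "\<Omega> \<in> sets lebesgue" by (simp add: fmeasurable_def)
  have f0: "AE x in lebesgue. x \<notin> \<Omega> \<longrightarrow> f x = 0" using f(1) by (simp add: H0s_def)
  define Z where "Z = {x \<in> \<Omega>. f x = 0}"
  have "f -` {0} \<inter> space lebesgue \<in> sets lebesgue" by (rule measurable_sets[OF H0s_measurable[OF f(1)]]) simp
  then have "\<Omega> \<inter> (f -` {0} \<inter> space lebesgue) \<in> sets lebesgue" using Om by (rule sets.Int[rotated])
  moreover have "\<Omega> \<inter> (f -` {0} \<inter> space lebesgue) = Z" by (auto simp: Z_def)
  ultimately have Zm: "Z \<in> sets lebesgue" by simp
  have Zb: "bounded Z" using \<Omega>(2) by (rule bounded_subset) (auto simp: Z_def)
  have Zpos: "emeasure lebesgue Z > 0"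
  proof (rule ccontr)
    assume "\<not> emeasure lebesgue Z > 0"
    then have "Z \<in> null_sets lebesgue" using Zm by (simp add: null_sets_def not_gr_zero)
    then have "AE x in lebesgue. x \<notin> Z" by (rule AE_not_in)
    then have "AE x in lebesgue. x \<in> \<Omega> \<longrightarrow> 0 < f x"
      by eventually_elim (use f(2) in \<open>auto simp: Z_def less_le\<close>)
    with contra show False by simp
  qed
  obtain K where K: "compact K" "K \<subseteq> Z" "emeasure lebesgue K > 0"
    using compact_subset_positive_measure[OF Zm Zb Zpos] by blast
  have Kn: "K \<noteq> {}" "K \<subseteq> \<Omega>" using K by (auto simp: Z_def)
  have Kl: "K \<in> lmeasurable" using K(1) by (rule lmeasurable_compact)
  have mK: "0 < measure lebesgue K" using K(3) Kl by (simp add: emeasure_eq_measure2)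
  obtain \<psi> where \<psi>: "\<psi> \<in> H0s s \<Omega>" "\<And>x. 0 \<le> \<psi> x" "\<And>x. \<psi> x \<le> 1" "\<And>x. x \<in> K \<Longrightarrow> \<psi> x = (1::real)"
    using H0s_bump_sequence[OF s N \<Omega> K(1) Kn] by metis
  obtain R where R: "0 < R" "\<Omega> \<subseteq> ball 0 R" using \<Omega>(2) by (metis bounded_subset_ballD)
  have dist: "norm (x - y) \<le> 2 * R" if "x \<in> \<Omega>" "y \<in> \<Omega>" for x y
  proof -
    have "norm x < R" "norm y < R" using that R(2) by auto
    then show ?thesis using norm_triangle_ineq4[of x y] by linarith
  qed
  define a where "a = real DIM('a) + 2 * s"
  define D where "D = (2 * R) powr a"
  have D: "0 < D" using R by (simp add: D_def)
  define B where "B = inner_H0s s \<psi> \<psi> + M * measure lebesgue \<Omega>"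
  have iK: "integrable lebesgue (indicator K :: 'a \<Rightarrow> real)" using Kl by (auto simp: fmeasurable_def)
  have iO: "integrable lebesgue (indicator \<Omega> :: 'a \<Rightarrow> real)" using O by (auto simp: fmeasurable_def)
  have iOf: "integrable lebesgue (\<lambda>x. indicator \<Omega> x * f x)"
    by (rule integrable_indicator_mult_sq(1)[OF H0s_sq[OF f(1)] O])
  have main: "measure lebesgue K * (\<integral>x. indicator \<Omega> x * f x \<partial>lebesgue)
      \<le> \<epsilon> * (D * B + measure lebesgue \<Omega> * measure lebesgue K)" if \<epsilon>: "0 < \<epsilon>" for \<epsilon>
  proof -
    define z where "z x = \<psi> x - (1 / \<epsilon>) * f x" for x
    define \<theta> where "\<theta> x = max 0 (z x)" for x
    define \<nu> where "\<nu> x = max 0 (- 1 * z x)" for x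
    have z: "z \<in> H0s s \<Omega>" unfolding z_def[abs_def] by (intro H0s_diff H0s_scale \<psi>(1) f(1))
    have \<theta>: "\<theta> \<in> H0s s \<Omega>" unfolding \<theta>_def[abs_def] by (rule H0s_pos_part[OF z])
    have \<nu>: "\<nu> \<in> H0s s \<Omega>" unfolding \<nu>_def[abs_def] by (rule H0s_pos_part[OF H0s_scale[OF z]])
    have nn: "0 \<le> \<theta> x" "0 \<le> \<nu> x" "\<theta> x * \<nu> x = 0" for x by (auto simp: \<theta>_def \<nu>_def max_def)
    have fz: "f x = \<epsilon> * (\<psi> x - \<theta> x + \<nu> x)" for x
    proof -
      have "\<theta> x - \<nu> x = z x" by (simp add: \<theta>_def \<nu>_def max_def)
      then have "\<psi> x - \<theta> x + \<nu> x = (1 / \<epsilon>) * f x" unfolding z_def by linarith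
      then show ?thesis using \<epsilon> by simp
    qed
    have E0: "inner_H0s s f \<theta> = \<epsilon> * (inner_H0s s \<psi> \<theta> - inner_H0s s \<theta> \<theta> + inner_H0s s \<nu> \<theta>)"
    proof -
      have "f = (\<lambda>x. \<epsilon> * ((\<psi> x - \<theta> x) + \<nu> x))" using fz by auto
      then have "inner_H0s s f \<theta> = inner_H0s s (\<lambda>x. \<epsilon> * ((\<psi> x - \<theta> x) + \<nu> x)) \<theta>" by simp
      also have "\<dots> = \<epsilon> * inner_H0s s (\<lambda>x. (\<psi> x - \<theta> x) + \<nu> x) \<theta>" by (rule inner_H0s_scale_left)
      also have "\<dots> = \<epsilon> * (inner_H0s s (\<lambda>x. \<psi> x - \<theta> x) \<theta> + inner_H0s s \<nu> \<theta>)"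
        using inner_H0s_add_left[OF H0s_diff[OF \<psi>(1) \<theta>] \<nu> \<theta>] by simp
      also have "inner_H0s s (\<lambda>x. \<psi> x - \<theta> x) \<theta> = inner_H0s s \<psi> \<theta> - inner_H0s s \<theta> \<theta>"
        by (rule inner_H0s_diff_left[OF \<psi>(1) \<theta> \<theta>])
      finally show ?thesis .
    qed
    \<comment> \<open>Pointwise \<open>a b - b\<^sup>2 \<le> a\<^sup>2\<close>: the energy of \<open>\<theta>\<close>
      itself, which may blow up, is absorbed.\<close>
    have young: "inner_H0s s \<psi> \<theta> - inner_H0s s \<theta> \<theta> \<le> inner_H0s s \<psi> \<psi>"
    proof -
      have "(\<integral>p. diff_quot s \<psi> p * diff_quot s \<theta> p - diff_quot s \<theta> p * diff_quot s \<theta> p \<partial>lebesgue) \<le> (\<integral>p. diff_quot s \<psi> p * diff_quot s \<psi> p \<partial>lebesgue)"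
      proof (rule integral_mono)
        show "integrable lebesgue (\<lambda>p. diff_quot s \<psi> p * diff_quot s \<theta> p - diff_quot s \<theta> p * diff_quot s \<theta> p)"
          using Hs_diff_quot_mult[OF H0s_Hs[OF \<psi>(1)] H0s_Hs[OF \<theta>]] Hs_diff_quot_mult[OF H0s_Hs[OF \<theta>] H0s_Hs[OF \<theta>]] by simp
        show "integrable lebesgue (\<lambda>p. diff_quot s \<psi> p * diff_quot s \<psi> p)"
          by (rule Hs_diff_quot_mult[OF H0s_Hs[OF \<psi>(1)] H0s_Hs[OF \<psi>(1)]])
        fix p
        have "a * b - b * b \<le> a * a" for a b :: real
        proof -
          have "(a - b) * (a - b) = a * a - 2 * (a * b) + b * b" by (simp add: algebra_simps)
          then show ?thesis using zero_le_square[of "a - b"] zero_le_square[of a] zero_le_square[of b] by linarith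
        qed
        then show "diff_quot s \<psi> p * diff_quot s \<theta> p - diff_quot s \<theta> p * diff_quot s \<theta> p \<le> diff_quot s \<psi> p * diff_quot s \<psi> p" .
      qed
      then show ?thesis
        using Hs_diff_quot_mult[OF H0s_Hs[OF \<psi>(1)] H0s_Hs[OF \<theta>]] Hs_diff_quot_mult[OF H0s_Hs[OF \<theta>] H0s_Hs[OF \<theta>]]
        by (simp add: inner_H0s_diff_quot)
    qed
    \<comment> \<open>On the support of \<open>\<theta>\<close> one has \<open>f \<le> \<epsilon>\<close> and
      \<open>\<theta> \<le> 1\<close>, so the right-hand side of the equation is of order
      \<open>\<epsilon>\<close>.\<close>
    have lower: "- (M * \<epsilon> * measure lebesgue \<Omega>) \<le> inner_H0s s f \<theta>"
    proof -
      have "(\<integral>x. - (M * \<epsilon>) * indicator \<Omega> x \<partial>lebesgue) \<le> (\<integral>x. w x * f x * \<theta> x \<partial>lebesgue)"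
      proof (rule integral_mono_AE)
        show "integrable lebesgue (\<lambda>x. - (M * \<epsilon>) * indicator \<Omega> x)" by (rule integrable_mult_right[OF iO])
        show "integrable lebesgue (\<lambda>x. w x * f x * \<theta> x)" by (rule weight_form_integrable[OF w f(1) \<theta>])
        show "AE x in lebesgue. - (M * \<epsilon>) * indicator \<Omega> x \<le> w x * f x * \<theta> x"
          using f0
        proof eventually_elim
          case (elim x)
          show ?case
          proof (cases "x \<in> \<Omega>")
            case True
            have "f x * \<theta> x \<le> \<epsilon> * 1"
            proof (cases "z x \<le> 0")
              case False
              then have "f x < \<epsilon> * \<psi> x" using \<epsilon> by (simp add: z_def field_simps)
              also have "\<epsilon> * \<psi> x \<le> \<epsilon> * 1" using \<psi>(3) \<epsilon> by (intro mult_left_mono) auto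
              finally have "f x \<le> \<epsilon>" by simp
              moreover have "0 \<le> f x / \<epsilon>" using f(2)[of x] \<epsilon> by simp
              then have "\<theta> x \<le> 1" using \<psi>(3)[of x] by (simp add: \<theta>_def z_def)
              ultimately show ?thesis using nn(1)[of x] \<epsilon> by (intro mult_mono) auto
            qed (use \<epsilon> in \<open>simp add: \<theta>_def\<close>)
            then have "M * (f x * \<theta> x) \<le> M * (\<epsilon> * 1)" using M by (rule mult_left_mono)
            moreover have "- M \<le> w x" using w by (simp add: weight_def abs_le_iff) (metis minus_le_iff)
            then have "- M * (f x * \<theta> x) \<le> w x * (f x * \<theta> x)"
              by (rule mult_right_mono) (simp add: f(2) nn(1))
            ultimately show ?thesis using True by (simp add: mult.assoc)
          qed (use elim in simp)
        qed
      qed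
      then show ?thesis using eq[OF \<theta>] Om by (simp add: weight_form_def)
    qed
    have up: "- (\<epsilon> * inner_H0s s \<nu> \<theta>) \<le> \<epsilon> * B"
    proof -
      have "- (\<epsilon> * inner_H0s s \<nu> \<theta>) = \<epsilon> * (inner_H0s s \<psi> \<theta> - inner_H0s s \<theta> \<theta>) - inner_H0s s f \<theta>"
        unfolding E0 by (simp add: algebra_simps)
      also have "\<dots> \<le> \<epsilon> * inner_H0s s \<psi> \<psi> + M * \<epsilon> * measure lebesgue \<Omega>"
        using mult_left_mono[OF young, of \<epsilon>] \<epsilon> lower by linarith
      finally show ?thesis by (simp add: B_def algebra_simps)
    qed
    have pw: "(indicator \<Omega> (fst p) * f (fst p) - \<epsilon> * indicator \<Omega> (fst p)) * indicator K (snd p)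
        \<le> D * \<epsilon> * - (diff_quot s \<nu> p * diff_quot s \<theta> p)" for p
    proof -
      obtain x y where p: "p = (x, y)" by (cases p)
      have dd: "- (diff_quot s \<nu> p * diff_quot s \<theta> p) = (\<nu> x * \<theta> y + \<nu> y * \<theta> x) / norm (x - y) powr a"
      proof -
        have "(\<nu> x - \<nu> y) * (\<theta> x - \<theta> y) = \<theta> x * \<nu> x - \<nu> x * \<theta> y - \<nu> y * \<theta> x + \<theta> y * \<nu> y"
          by (simp add: algebra_simps)
        also have "\<dots> = - (\<nu> x * \<theta> y + \<nu> y * \<theta> x)" using nn(3)[of x] nn(3)[of y] by linarith
        finally have "(\<nu> x - \<nu> y) * (\<theta> x - \<theta> y) = - (\<nu> x * \<theta> y + \<nu> y * \<theta> x)" .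
        then show ?thesis unfolding p diff_quot_mult a_def by (simp only: minus_divide_left[symmetric] minus_minus)
      qed
      have ge0: "0 \<le> - (diff_quot s \<nu> p * diff_quot s \<theta> p)" unfolding dd using nn by (intro divide_nonneg_nonneg) auto
      show ?thesis
      proof (cases "x \<in> \<Omega> \<and> y \<in> K")
        case True
        have fy: "f y = 0" using True K(2) by (auto simp: Z_def)
        show ?thesis
        proof (cases "x = y")
          \<comment> \<open>On the diagonal \<open>f x = 0\<close>, so the left-hand side is \<open>-\<epsilon>\<close>, and
            the value 0 of the kernel does no harm.\<close>
          case True
          then have "(indicator \<Omega> (fst p) * f (fst p) - \<epsilon> * indicator \<Omega> (fst p)) * indicator K (snd p) \<le> 0"
            using fy \<epsilon> by (simp add: p)
          also have "0 \<le> D * \<epsilon> * - (diff_quot s \<nu> p * diff_quot s \<theta> p)" using D \<epsilon> ge0 by (intro mult_nonneg_nonneg) auto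
          finally show ?thesis .
        next
          case False
          have "\<theta> y = 1" "\<nu> y = 0" using fy True \<psi>(4) by (simp_all add: \<theta>_def \<nu>_def z_def)
          then have dd': "- (diff_quot s \<nu> p * diff_quot s \<theta> p) = \<nu> x / norm (x - y) powr a" unfolding dd by simp
          have np: "0 < norm (x - y) powr a" using False by simp
          have "norm (x - y) powr a \<le> D"
            unfolding D_def using dist[of x y] True Kn(2) s by (intro powr_mono2) (auto simp: a_def)
          then have "norm (x - y) powr a * \<nu> x \<le> D * \<nu> x" by (rule mult_right_mono[OF _ nn(2)])
          then have "\<nu> x \<le> D * (\<nu> x / norm (x - y) powr a)" using np by (simp add: pos_le_divide_eq mult.commute)
          then have "\<epsilon> * \<nu> x \<le> D * \<epsilon> * (\<nu> x / norm (x - y) powr a)"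
            using mult_left_mono[of "\<nu> x" "D * (\<nu> x / norm (x - y) powr a)" \<epsilon>] \<epsilon> by (simp add: mult.left_commute mult.assoc)
          moreover have "f x - \<epsilon> \<le> \<epsilon> * \<nu> x"
          proof -
            have "f x / \<epsilon> - 1 \<le> \<nu> x" using \<psi>(3)[of x] by (simp add: \<nu>_def z_def)
            then have "\<epsilon> * (f x / \<epsilon> - 1) \<le> \<epsilon> * \<nu> x" using \<epsilon> by (intro mult_left_mono) auto
            then show ?thesis using \<epsilon> by (simp add: right_diff_distrib)
          qed
          ultimately show ?thesis unfolding dd' using True by (simp add: p)
        qed
      next
        case False
        then have "(indicator \<Omega> (fst p) * f (fst p) - \<epsilon> * indicator \<Omega> (fst p)) * indicator K (snd p) = 0"
          by (auto simp: p)
        also have "0 \<le> D * \<epsilon> * - (diff_quot s \<nu> p * diff_quot s \<theta> p)" using D \<epsilon> ge0 by (intro mult_nonneg_nonneg) auto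
        finally show ?thesis .
      qed
    qed
    have il: "integrable lebesgue (\<lambda>x. indicator \<Omega> x * f x - \<epsilon> * indicator \<Omega> x)"
      using iOf iO by simp
    have "(\<integral>x. indicator \<Omega> x * f x \<partial>lebesgue) - \<epsilon> * measure lebesgue \<Omega>
        = (\<integral>x. indicator \<Omega> x * f x - \<epsilon> * indicator \<Omega> x \<partial>lebesgue)"
      using iOf iO Om by simp
    then have "((\<integral>x. indicator \<Omega> x * f x \<partial>lebesgue) - \<epsilon> * measure lebesgue \<Omega>) * measure lebesgue K
        = (\<integral>p. (indicator \<Omega> (fst p) * f (fst p) - \<epsilon> * indicator \<Omega> (fst p)) * indicator K (snd p) \<partial>lebesgue)"
      using integral_tensor(2)[OF il iK] by simp
    also have "\<dots> \<le> (\<integral>p. D * \<epsilon> * - (diff_quot s \<nu> p * diff_quot s \<theta> p) \<partial>lebesgue)"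
    proof (rule integral_mono[OF integrable_tensor[OF il iK] _ pw])
      show "integrable lebesgue (\<lambda>p. D * \<epsilon> * - (diff_quot s \<nu> p * diff_quot s \<theta> p))"
        by (intro integrable_mult_right Bochner_Integration.integrable_minus Hs_diff_quot_mult H0s_Hs[OF \<nu>] H0s_Hs[OF \<theta>])
    qed
    also have "\<dots> = D * (- (\<epsilon> * inner_H0s s \<nu> \<theta>))" by (simp add: inner_H0s_diff_quot)
    also have "\<dots> \<le> D * (\<epsilon> * B)" using up D by (intro mult_left_mono) auto
    finally show ?thesis by (simp add: algebra_simps)
  qed
  let ?c = "D * B + measure lebesgue \<Omega> * measure lebesgue K"
  have "measure lebesgue K * (\<integral>x. indicator \<Omega> x * f x \<partial>lebesgue) \<le> 0"
  proof (rule field_le_epsilon)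
    fix e :: real assume e: "0 < e"
    have "0 < e / (\<bar>?c\<bar> + 1)" using e by (simp add: add_nonneg_pos)
    from main[OF this] have "measure lebesgue K * (\<integral>x. indicator \<Omega> x * f x \<partial>lebesgue) \<le> e / (\<bar>?c\<bar> + 1) * ?c" .
    also have "\<dots> \<le> e / (\<bar>?c\<bar> + 1) * (\<bar>?c\<bar> + 1)"
      using e by (intro mult_left_mono) auto
    also have "\<dots> = e" using abs_ge_zero[of ?c] by (simp del: abs_ge_zero)
    finally show "measure lebesgue K * (\<integral>x. indicator \<Omega> x * f x \<partial>lebesgue) \<le> 0 + e" by simp
  qed
  then have "(\<integral>x. indicator \<Omega> x * f x \<partial>lebesgue) \<le> 0" using mK by (simp add: mult_le_0_iff)
  moreover have "0 \<le> (\<integral>x. indicator \<Omega> x * f x \<partial>lebesgue)"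
    by (rule Bochner_Integration.integral_nonneg) (simp add: f(2))
  ultimately have "(\<integral>x. indicator \<Omega> x * f x \<partial>lebesgue) = 0" by linarith
  then have "AE x in lebesgue. indicator \<Omega> x * f x = 0"
    using integral_nonneg_eq_0_iff_AE[OF iOf] f(2) by simp
  then have "AE x in lebesgue. f x = 0"
    using f0 by eventually_elim (auto simp: indicator_def split: if_splits)
  with f(3) show False by simp
qed

section \<open>The functional as a Rayleigh maximum\<close>

text \<open>Replaces a weight given only on the domain, up to null sets, by one that is bounded and measurable
on the whole space and zero outside the domain.\<close>

definition represents :: "'a::euclidean_space set \<Rightarrow> ('a \<Rightarrow> real) \<Rightarrow> real \<Rightarrow> ('a \<Rightarrow> real) \<Rightarrow> bool" where
  "represents \<Omega> \<rho> M w \<longleftrightarrow> \<rho> \<in> borel_measurable (lebesgue_on \<Omega>) \<and> weight M w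
     \<and> (\<forall>x. x \<notin> \<Omega> \<longrightarrow> w x = 0) \<and> (AE x in lebesgue. x \<in> \<Omega> \<longrightarrow> \<rho> x = w x)"

lemma Linf_represents:
  assumes "open \<Omega>" "\<rho> \<in> Linf \<Omega>"
  obtains M w where "represents \<Omega> \<rho> M w"
proof -
  have O: "\<Omega> \<inter> space lebesgue \<in> sets lebesgue" using assms(1) by simp
  obtain C where C: "AE x in lebesgue_on \<Omega>. \<bar>\<rho> x\<bar> \<le> C" and m: "\<rho> \<in> borel_measurable (lebesgue_on \<Omega>)"
    using assms(2) by (auto simp: Linf_def)
  have AE: "AE x in lebesgue. x \<in> \<Omega> \<longrightarrow> \<bar>\<rho> x\<bar> \<le> C"
    using C by (simp add: AE_restrict_space_iff[OF O])
  have q: "(\<lambda>x. indicator \<Omega> x *\<^sub>R \<rho> x) \<in> borel_measurable lebesgue"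
    using m by (simp add: borel_measurable_restrict_space_iff[OF O])
  define w where "w x = max (- \<bar>C\<bar>) (min \<bar>C\<bar> (indicator \<Omega> x *\<^sub>R \<rho> x))" for x
  have "w \<in> borel_measurable lebesgue"
    unfolding w_def[abs_def] by (intro borel_measurable_max borel_measurable_min borel_measurable_const q)
  moreover have "\<bar>w x\<bar> \<le> \<bar>C\<bar>" for x by (auto simp: w_def)
  moreover have "w x = 0" if "x \<notin> \<Omega>" for x using that by (simp add: w_def)
  moreover have "AE x in lebesgue. x \<in> \<Omega> \<longrightarrow> \<rho> x = w x"
    using AE by eventually_elim (auto simp: w_def)
  ultimately have "represents \<Omega> \<rho> \<bar>C\<bar> w" using m by (auto simp: represents_def weight_def)
  then show thesis by (rule that)
qed

lemma represents_integral:
  assumes "open \<Omega>" "represents \<Omega> \<rho> M w" "v \<in> borel_measurable lebesgue"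
  shows "(LINT x|lebesgue_on \<Omega>. \<rho> x * v x) = (\<integral>x. w x * v x \<partial>lebesgue)"
proof -
  have O: "\<Omega> \<inter> space lebesgue \<in> sets lebesgue" using assms(1) by simp
  have q: "(\<lambda>x. indicator \<Omega> x *\<^sub>R \<rho> x) \<in> borel_measurable lebesgue"
    using assms(2) by (simp add: represents_def borel_measurable_restrict_space_iff[OF O])
  have "(LINT x|lebesgue_on \<Omega>. \<rho> x * v x) = (\<integral>x. indicator \<Omega> x *\<^sub>R (\<rho> x * v x) \<partial>lebesgue)"
    by (rule integral_restrict_space[OF O])
  also have "\<dots> = (\<integral>x. w x * v x \<partial>lebesgue)"
  proof (rule integral_cong_AE)
    have "(\<lambda>x. (indicator \<Omega> x *\<^sub>R \<rho> x) * v x) \<in> borel_measurable lebesgue"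
      by (rule borel_measurable_times[OF q assms(3)])
    then show "(\<lambda>x. indicator \<Omega> x *\<^sub>R (\<rho> x * v x)) \<in> borel_measurable lebesgue" by (simp add: mult.assoc)
    show "(\<lambda>x. w x * v x) \<in> borel_measurable lebesgue"
      using assms(2,3) by (intro borel_measurable_times) (auto simp: represents_def weight_def)
    have "AE x in lebesgue. x \<in> \<Omega> \<longrightarrow> \<rho> x = w x" using assms(2) by (simp add: represents_def)
    then show "AE x in lebesgue. indicator \<Omega> x *\<^sub>R (\<rho> x * v x) = w x * v x"
    proof eventually_elim
      case (elim x)
      have "x \<notin> \<Omega> \<Longrightarrow> w x = 0" using assms(2) by (simp add: represents_def)
      then show ?case using elim by (cases "x \<in> \<Omega>") simp_all
    qed
  qed
  finally show ?thesis .
qed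

lemma represents_positive_set:
  assumes "open \<Omega>" "represents \<Omega> \<rho> M w"
  shows "{x \<in> \<Omega>. 0 < \<rho> x} \<in> sets lebesgue"
    and "emeasure lebesgue {x \<in> \<Omega>. 0 < w x} = emeasure lebesgue {x \<in> \<Omega>. 0 < \<rho> x}"
proof -
  have O: "\<Omega> \<inter> space lebesgue \<in> sets lebesgue" using assms(1) by simp
  have q: "(\<lambda>x. indicator \<Omega> x *\<^sub>R \<rho> x) \<in> borel_measurable lebesgue"
    using assms(2) by (simp add: represents_def borel_measurable_restrict_space_iff[OF O])
  have "(\<lambda>x. indicator \<Omega> x *\<^sub>R \<rho> x) -` {0<..} \<inter> space lebesgue \<in> sets lebesgue"
    by (rule measurable_sets[OF q]) simp
  moreover have "(\<lambda>x. indicator \<Omega> x *\<^sub>R \<rho> x) -` {0<..} \<inter> space lebesgue = {x \<in> \<Omega>. 0 < \<rho> x}"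
    by (auto simp: indicator_def of_bool_def split: if_splits)
  ultimately show 1: "{x \<in> \<Omega>. 0 < \<rho> x} \<in> sets lebesgue" by simp
  have wm: "w \<in> borel_measurable lebesgue" and w0: "\<And>x. x \<notin> \<Omega> \<Longrightarrow> w x = 0"
    using assms(2) by (auto simp: represents_def weight_def)
  have "w -` {0<..} \<inter> space lebesgue \<in> sets lebesgue" by (rule measurable_sets[OF wm]) simp
  moreover have "w -` {0<..} \<inter> space lebesgue = {x \<in> \<Omega>. 0 < w x}" using w0 by force
  ultimately have 2: "{x \<in> \<Omega>. 0 < w x} \<in> sets lebesgue" by simp
  have "AE x in lebesgue. x \<in> \<Omega> \<longrightarrow> \<rho> x = w x" using assms(2) by (simp add: represents_def)
  then show "emeasure lebesgue {x \<in> \<Omega>. 0 < w x} = emeasure lebesgue {x \<in> \<Omega>. 0 < \<rho> x}"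
    by (intro emeasure_eq_AE 1 2) (auto elim!: eventually_mono)
qed

lemma represents_combination:
  assumes "represents \<Omega> \<rho> M w" "represents \<Omega> \<eta> L v"
  shows "represents \<Omega> (\<lambda>x. a * \<rho> x + b * \<eta> x) (\<bar>a\<bar> * M + \<bar>b\<bar> * L) (\<lambda>x. a * w x + b * v x)"
proof -
  have "\<bar>a * w x + b * v x\<bar> \<le> \<bar>a\<bar> * M + \<bar>b\<bar> * L" for x
  proof -
    have "\<bar>a * w x + b * v x\<bar> \<le> \<bar>a\<bar> * \<bar>w x\<bar> + \<bar>b\<bar> * \<bar>v x\<bar>"
      using abs_triangle_ineq[of "a * w x" "b * v x"] by (simp add: abs_mult)
    also have "\<dots> \<le> \<bar>a\<bar> * M + \<bar>b\<bar> * L"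
      using assms by (intro add_mono mult_left_mono) (auto simp: represents_def weight_def)
    finally show ?thesis .
  qed
  moreover have "AE x in lebesgue. x \<in> \<Omega> \<longrightarrow> \<rho> x = w x" "AE x in lebesgue. x \<in> \<Omega> \<longrightarrow> \<eta> x = v x"
    using assms by (auto simp: represents_def)
  then have "AE x in lebesgue. x \<in> \<Omega> \<longrightarrow> a * \<rho> x + b * \<eta> x = a * w x + b * v x"
    by eventually_elim simp
  moreover have "(\<lambda>x. a * \<rho> x + b * \<eta> x) \<in> borel_measurable (lebesgue_on \<Omega>)"
    "(\<lambda>x. a * w x + b * v x) \<in> borel_measurable lebesgue"
    using assms unfolding represents_def weight_def
    by (intro borel_measurable_add borel_measurable_times borel_measurable_const; blast)+
  moreover have "a * w x + b * v x = 0" if "x \<notin> \<Omega>" for x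
    using assms that by (simp add: represents_def)
  ultimately show ?thesis unfolding represents_def weight_def by blast
qed

lemma weight_form_combination:
  assumes "weight M w" "weight L v" "u \<in> H0s s \<Omega>" "z \<in> H0s s \<Omega>"
  shows "weight_form (\<lambda>x. a * w x + b * v x) u z = a * weight_form w u z + b * weight_form v u z"
proof -
  note i = weight_form_integrable[OF assms(1,3,4)] weight_form_integrable[OF assms(2,3,4)]
  have "weight_form (\<lambda>x. a * w x + b * v x) u z = (\<integral>x. a * (w x * u x * z x) + b * (v x * u x * z x) \<partial>lebesgue)"
    unfolding weight_form_def by (intro Bochner_Integration.integral_cong) (simp_all add: algebra_simps)
  also have "\<dots> = a * weight_form w u z + b * weight_form v u z" using i by (simp add: weight_form_def)
  finally show ?thesis .
qed

text \<open>A maximiser of the Rayleigh quotient is a zero of the deficit.\<close>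

lemma rayleigh_euler_lagrange:
  assumes w: "weight M w" and upper: "\<And>u. u \<in> H0s s \<Omega> \<Longrightarrow> weight_form w u u \<le> \<mu> * inner_H0s s u u"
    and f: "f \<in> H0s s \<Omega>" "weight_form w f f = \<mu> * inner_H0s s f f" and \<phi>: "\<phi> \<in> H0s s \<Omega>"
  shows "\<mu> * inner_H0s s f \<phi> = weight_form w f \<phi>"
proof -
  have "deficit s \<mu> w f \<phi> = 0"
    by (rule deficit_null_vector[OF w _ f(1) \<phi>]) (use upper f(2) in \<open>auto simp: deficit_def\<close>)
  then show ?thesis by (simp add: deficit_def)
qed

text \<open>A maximiser is an eigenfunction by the Euler-Lagrange equation, and every eigenvalue is the
Rayleigh quotient of its eigenfunction, so the greatest positive eigenvalue exists and is the
maximum. If \<open>\<rho> \<le> 0\<close> almost everywhere, the upper bound holds with the value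
0.\<close>

lemma mu1_tilde_rayleigh:
  fixes \<Omega> :: "'a::euclidean_space set"
  assumes s: "0 < s" "s < 1" and N: "2 \<le> DIM('a)" and \<Omega>: "open \<Omega>" "bounded \<Omega>"
    and rep: "represents \<Omega> \<rho> M w"
  shows mu1_tilde_upper: "u \<in> H0s s \<Omega> \<Longrightarrow> weight_form w u u \<le> mu1_tilde s \<Omega> \<rho> * inner_H0s s u u"
    and mu1_tilde_attained: "emeasure lebesgue {x \<in> \<Omega>. 0 < \<rho> x} > 0 \<Longrightarrow> 0 < mu1_tilde s \<Omega> \<rho> \<and>
      (\<exists>f\<in>H0s s \<Omega>. 0 < inner_H0s s f f \<and> weight_form w f f = mu1_tilde s \<Omega> \<rho> * inner_H0s s f f)"
proof -
  have w: "weight M w" and w0: "\<And>x. x \<notin> \<Omega> \<Longrightarrow> w x = 0" using rep by (auto simp: represents_def)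
  have *: "(\<forall>u\<in>H0s s \<Omega>. weight_form w u u \<le> mu1_tilde s \<Omega> \<rho> * inner_H0s s u u) \<and> 0 < mu1_tilde s \<Omega> \<rho> \<and>
      (\<exists>f\<in>H0s s \<Omega>. 0 < inner_H0s s f f \<and> weight_form w f f = mu1_tilde s \<Omega> \<rho> * inner_H0s s f f)"
    if pos: "emeasure lebesgue {x \<in> \<Omega>. 0 < \<rho> x} > 0"
  proof -
    have "emeasure lebesgue {x \<in> \<Omega>. 0 < w x} > 0" using pos represents_positive_set(2)[OF \<Omega>(1) rep] by simp
    then obtain \<mu> f where mu: "0 < \<mu>" and f: "f \<in> H0s s \<Omega>" "\<not> (AE x in lebesgue. f x = 0)"
      and upper: "\<And>u. u \<in> H0s s \<Omega> \<Longrightarrow> weight_form w u u \<le> \<mu> * inner_H0s s u u"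
      and att: "weight_form w f f = \<mu> * inner_H0s s f f"
      using rayleigh_maximizer_exists[OF s N \<Omega> w w0] by blast
    have eig: "eigenvalue_G s \<Omega> \<rho> \<nu> \<longleftrightarrow>
        (\<exists>g\<in>H0s s \<Omega>. \<not> (AE x in lebesgue. g x = 0) \<and> (\<forall>\<phi>\<in>H0s s \<Omega>. \<nu> * inner_H0s s g \<phi> = weight_form w g \<phi>))" for \<nu>
    proof -
      have "(LINT x|lebesgue_on \<Omega>. \<rho> x * g x * \<phi> x) = weight_form w g \<phi>"
        if "g \<in> H0s s \<Omega>" "\<phi> \<in> H0s s \<Omega>" for g \<phi>
        using represents_integral[OF \<Omega>(1) rep borel_measurable_times[OF H0s_measurable[OF that(1)] H0s_measurable[OF that(2)]]]
        by (simp add: weight_form_def mult.assoc)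
      then show ?thesis
        unfolding eigenvalue_G_def is_G_def by (auto simp: inner_H0s_scale_left H0s_scale)
    qed
    have "mu1 s \<Omega> \<rho> = \<mu>" unfolding mu1_def
    proof (rule Greatest_equality)
      show "0 < \<mu> \<and> eigenvalue_G s \<Omega> \<rho> \<mu>"
        unfolding eig using mu f rayleigh_euler_lagrange[OF w upper f(1) att] by blast
      fix \<nu> assume "0 < \<nu> \<and> eigenvalue_G s \<Omega> \<rho> \<nu>"
      then obtain g where g: "g \<in> H0s s \<Omega>" "\<not> (AE x in lebesgue. g x = 0)"
        "\<nu> * inner_H0s s g g = weight_form w g g" unfolding eig by blast
      have "0 < inner_H0s s g g" using g inner_H0s_pos_iff[OF s(1) \<Omega>(2) g(1)] by simp
      moreover have "\<nu> * inner_H0s s g g \<le> \<mu> * inner_H0s s g g" using upper[OF g(1)] g(3) by linarith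
      ultimately show "\<nu> \<le> \<mu>" by (rule mult_right_le_imp_le[rotated])
    qed
    then have "mu1_tilde s \<Omega> \<rho> = \<mu>" using pos by (simp add: mu1_tilde_def)
    moreover have "0 < inner_H0s s f f" using f inner_H0s_pos_iff[OF s(1) \<Omega>(2) f(1)] by simp
    ultimately show ?thesis using mu upper f(1) att by blast
  qed
  show "weight_form w u u \<le> mu1_tilde s \<Omega> \<rho> * inner_H0s s u u" if u: "u \<in> H0s s \<Omega>"
  proof (cases "emeasure lebesgue {x \<in> \<Omega>. 0 < \<rho> x} > 0")
    case True
    then show ?thesis using * u by blast
  next
    case False
    then have "emeasure lebesgue {x \<in> \<Omega>. 0 < \<rho> x} = 0" by (simp add: not_gr_zero)
    then have "{x \<in> \<Omega>. 0 < \<rho> x} \<in> null_sets lebesgue"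
      using represents_positive_set(1)[OF \<Omega>(1) rep] by (simp add: null_sets_def)
    then have "AE x in lebesgue. x \<notin> {x \<in> \<Omega>. 0 < \<rho> x}" by (rule AE_not_in)
    moreover have "AE x in lebesgue. x \<in> \<Omega> \<longrightarrow> \<rho> x = w x" using rep by (simp add: represents_def)
    ultimately have "AE x in lebesgue. w x \<le> 0"
    proof eventually_elim
      case (elim x)
      then show ?case using w0[of x] by (cases "x \<in> \<Omega>") auto
    qed
    then have "AE x in lebesgue. 0 \<le> - (w x * u x * u x)"
      by eventually_elim (simp add: mult.assoc mult_nonpos_nonneg)
    then have "0 \<le> (\<integral>x. - (w x * u x * u x) \<partial>lebesgue)" by (rule integral_nonneg_AE)
    then have "weight_form w u u \<le> 0" by (simp add: weight_form_def)
    moreover have "mu1_tilde s \<Omega> \<rho> = 0" using False by (simp add: mu1_tilde_def)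
    ultimately show ?thesis by simp
  qed
  show "0 < mu1_tilde s \<Omega> \<rho> \<and>
      (\<exists>f\<in>H0s s \<Omega>. 0 < inner_H0s s f f \<and> weight_form w f f = mu1_tilde s \<Omega> \<rho> * inner_H0s s f f)"
    if "emeasure lebesgue {x \<in> \<Omega>. 0 < \<rho> x} > 0"
    using *[OF that] by blast
qed

lemma mu1_tilde_nonneg:
  fixes \<Omega> :: "'a::euclidean_space set"
  assumes "0 < s" "s < 1" "2 \<le> DIM('a)" "open \<Omega>" "bounded \<Omega>" "represents \<Omega> \<rho> M w"
  shows "0 \<le> mu1_tilde s \<Omega> \<rho>"
proof (cases "emeasure lebesgue {x \<in> \<Omega>. 0 < \<rho> x} > 0")
  case True
  then show ?thesis using mu1_tilde_attained[OF assms True] by simp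
next
  case False
  then show ?thesis unfolding mu1_tilde_def by (simp only: if_False order_refl)
qed

text \<open>Evaluate the three Rayleigh quotients at a maximiser of the middle one.\<close>

lemma mu1_tilde_convex:
  fixes \<Omega> :: "'a::euclidean_space set"
  assumes s: "0 < s" "s < 1" and N: "2 \<le> DIM('a)" and \<Omega>: "open \<Omega>" "bounded \<Omega>"
    and \<rho>: "\<rho> \<in> Linf \<Omega>" and \<eta>: "\<eta> \<in> Linf \<Omega>" and t: "0 \<le> t" "t \<le> 1"
  shows "mu1_tilde s \<Omega> (\<lambda>x. t * \<rho> x + (1 - t) * \<eta> x) \<le> t * mu1_tilde s \<Omega> \<rho> + (1 - t) * mu1_tilde s \<Omega> \<eta>"
proof -
  obtain M w where w: "represents \<Omega> \<rho> M w" using Linf_represents[OF \<Omega>(1) \<rho>] .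
  obtain L v where v: "represents \<Omega> \<eta> L v" using Linf_represents[OF \<Omega>(1) \<eta>] .
  note \<zeta> = represents_combination[OF w v, of t "1 - t"]
  let ?\<xi> = "\<lambda>x. t * \<rho> x + (1 - t) * \<eta> x"
  have ww: "weight M w" "weight L v" using w v by (auto simp: represents_def)
  note nn = mu1_tilde_nonneg[OF s N \<Omega> w] mu1_tilde_nonneg[OF s N \<Omega> v]
  show ?thesis
  proof (cases "emeasure lebesgue {x \<in> \<Omega>. 0 < ?\<xi> x} > 0")
    case True
    from mu1_tilde_attained[OF s N \<Omega> \<zeta> this] obtain f where f: "f \<in> H0s s \<Omega>" "0 < inner_H0s s f f"
      "weight_form (\<lambda>x. t * w x + (1 - t) * v x) f f = mu1_tilde s \<Omega> ?\<xi> * inner_H0s s f f" by blast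
    have "mu1_tilde s \<Omega> ?\<xi> * inner_H0s s f f = t * weight_form w f f + (1 - t) * weight_form v f f"
      using weight_form_combination[OF ww f(1) f(1)] f(3) by simp
    also have "\<dots> \<le> t * (mu1_tilde s \<Omega> \<rho> * inner_H0s s f f) + (1 - t) * (mu1_tilde s \<Omega> \<eta> * inner_H0s s f f)"
      using t by (intro add_mono mult_left_mono mu1_tilde_upper[OF s N \<Omega> w f(1)] mu1_tilde_upper[OF s N \<Omega> v f(1)]) auto
    also have "\<dots> = (t * mu1_tilde s \<Omega> \<rho> + (1 - t) * mu1_tilde s \<Omega> \<eta>) * inner_H0s s f f"
      by (simp add: algebra_simps)
    finally show ?thesis using f(2) by simp
  next
    case False
    then have "mu1_tilde s \<Omega> ?\<xi> = 0" by (simp add: mu1_tilde_def)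
    also have "0 \<le> t * mu1_tilde s \<Omega> \<rho> + (1 - t) * mu1_tilde s \<Omega> \<eta>" using nn t by simp
    finally show ?thesis .
  qed
qed

section \<open>Strict convexity\<close>

text \<open>Otherwise \<open>h\<close> or \<open>-h\<close> is positive on a set of positive measure, and the
square of a bump detects it.\<close>

lemma H0s_separates:
  fixes h :: "'a::euclidean_space \<Rightarrow> real"
  assumes s: "0 < s" "s < 1" and N: "2 \<le> DIM('a)" and \<Omega>: "open \<Omega>" "bounded \<Omega>"
    and h: "integrable lebesgue h" and 0: "\<And>\<phi>. \<phi> \<in> H0s s \<Omega> \<Longrightarrow> (\<integral>x. h x * \<phi> x \<partial>lebesgue) = 0"
  shows "AE x in lebesgue. x \<in> \<Omega> \<longrightarrow> h x = 0"
proof -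
  have le: "AE x in lebesgue. x \<in> \<Omega> \<longrightarrow> k x \<le> 0"
    if k: "integrable lebesgue k" and k0: "\<And>\<phi>. \<phi> \<in> H0s s \<Omega> \<Longrightarrow> (\<integral>x. k x * \<phi> x \<partial>lebesgue) = 0"
    for k :: "'a \<Rightarrow> real"
  proof -
    have "\<not> emeasure lebesgue {x \<in> \<Omega>. 0 < k x} > 0"
    proof
      assume "emeasure lebesgue {x \<in> \<Omega>. 0 < k x} > 0"
      then obtain \<psi> where "(\<lambda>x. (\<psi> x)\<^sup>2) \<in> H0s s \<Omega>" "0 < (\<integral>x. k x * (\<psi> x)\<^sup>2 \<partial>lebesgue)"
        using test_function_positive[OF s N \<Omega> k] by blast
      then show False using k0[of "\<lambda>x. (\<psi> x)\<^sup>2"] by simp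
    qed
    moreover have "k -` {0<..} \<inter> space lebesgue \<in> sets lebesgue"
      by (rule measurable_sets[OF borel_measurable_integrable[OF k]]) simp
    then have "\<Omega> \<inter> (k -` {0<..} \<inter> space lebesgue) \<in> sets lebesgue" using \<Omega>(1) by (intro sets.Int) simp_all
    moreover have "\<Omega> \<inter> (k -` {0<..} \<inter> space lebesgue) = {x \<in> \<Omega>. 0 < k x}" by auto
    ultimately have "{x \<in> \<Omega>. 0 < k x} \<in> null_sets lebesgue" by (simp add: null_sets_def not_gr_zero)
    then have "AE x in lebesgue. x \<notin> {x \<in> \<Omega>. 0 < k x}" by (rule AE_not_in)
    then show ?thesis by eventually_elim auto
  qed
  have "integrable lebesgue (\<lambda>x. - h x)" using h by simp
  moreover have "(\<integral>x. - h x * \<phi> x \<partial>lebesgue) = 0" if "\<phi> \<in> H0s s \<Omega>" for \<phi> using 0[OF that] by simp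
  ultimately have "AE x in lebesgue. x \<in> \<Omega> \<longrightarrow> - h x \<le> 0" by (rule le)
  moreover have "AE x in lebesgue. x \<in> \<Omega> \<longrightarrow> h x \<le> 0" using h 0 by (rule le)
  ultimately show ?thesis by eventually_elim auto
qed

text \<open>Passing to the absolute value does not increase the energy and leaves the weighted integral
unchanged.\<close>

lemma mu1_tilde_nonneg_maximizer:
  fixes \<Omega> :: "'a::euclidean_space set"
  assumes s: "0 < s" "s < 1" and N: "2 \<le> DIM('a)" and \<Omega>: "open \<Omega>" "bounded \<Omega>"
    and rep: "represents \<Omega> \<rho> M w" and pos: "emeasure lebesgue {x \<in> \<Omega>. 0 < \<rho> x} > 0"
  obtains f where "f \<in> H0s s \<Omega>" "\<And>x. 0 \<le> f x" "0 < inner_H0s s f f"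
    "weight_form w f f = mu1_tilde s \<Omega> \<rho> * inner_H0s s f f"
proof -
  let ?m = "mu1_tilde s \<Omega> \<rho>"
  from mu1_tilde_attained[OF s N \<Omega> rep pos] obtain f where m: "0 < ?m" and f: "f \<in> H0s s \<Omega>" "0 < inner_H0s s f f"
    "weight_form w f f = ?m * inner_H0s s f f" by blast
  let ?g = "\<lambda>x. \<bar>f x\<bar>"
  have g: "?g \<in> H0s s \<Omega>" by (rule H0s_abs[OF f(1)])
  have W: "weight_form w ?g ?g = weight_form w f f" by (simp add: weight_form_def mult.assoc)
  have "?m * inner_H0s s ?g ?g \<le> ?m * inner_H0s s f f"
    using inner_H0s_abs_le[OF f(1)] m by (intro mult_left_mono) auto
  then have eq: "weight_form w ?g ?g = ?m * inner_H0s s ?g ?g"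
    using mu1_tilde_upper[OF s N \<Omega> rep g] W f(3) by linarith
  have "0 < ?m * inner_H0s s ?g ?g" using W eq f(2,3) m by simp
  then have "0 < inner_H0s s ?g ?g" using m by (simp add: zero_less_mult_iff)
  then show thesis using that[OF g _ _ eq] by simp
qed

lemma maximizer_positive:
  fixes \<Omega> :: "'a::euclidean_space set"
  assumes s: "0 < s" "s < 1" and N: "2 \<le> DIM('a)" and \<Omega>: "open \<Omega>" "bounded \<Omega>"
    and w: "weight M w" and \<mu>: "0 < \<mu>" and f: "f \<in> H0s s \<Omega>" "\<And>x. 0 \<le> f x" "0 < inner_H0s s f f"
    and eq: "\<And>\<phi>. \<phi> \<in> H0s s \<Omega> \<Longrightarrow> \<mu> * inner_H0s s f \<phi> = weight_form w f \<phi>"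
  shows "AE x in lebesgue. x \<in> \<Omega> \<longrightarrow> 0 < f x"
proof (rule nonneg_solution_positive[OF s N \<Omega> _ f(1,2)])
  show "weight (M / \<mu>) (\<lambda>x. (1 / \<mu>) * w x)"
    using w \<mu> by (auto simp: weight_def abs_mult divide_right_mono)
  show "\<not> (AE x in lebesgue. f x = 0)" using f(3) inner_H0s_pos_iff[OF s(1) \<Omega>(2) f(1)] by simp
  fix \<phi> assume \<phi>: "\<phi> \<in> H0s s \<Omega>"
  have "weight_form (\<lambda>x. (1 / \<mu>) * w x) f \<phi> = (1 / \<mu>) * weight_form w f \<phi>"
    unfolding weight_form_def integral_mult_right_zero[symmetric]
    by (intro Bochner_Integration.integral_cong) simp_all
  also have "\<dots> = inner_H0s s f \<phi>" unfolding eq[OF \<phi>, symmetric] using \<mu> by simp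
  finally show "inner_H0s s f \<phi> = weight_form (\<lambda>x. (1 / \<mu>) * w x) f \<phi>" by (rule sym)
qed

text \<open>If equality held, a nonnegative maximiser \<open>f\<close> of the intermediate weight would be a
maximiser for both weights. Cross-multiplying the two Euler-Lagrange equations eliminates the
energy: \<open>(e w - r v) f\<close> is orthogonal to the whole space, hence zero, and \<open>f >
0\<close> makes \<open>e \<rho> - r \<eta>\<close> vanish, where \<open>r\<close> and
\<open>e\<close> are the two positive maxima.\<close>

lemma mu1_tilde_strictly_convex:
  fixes \<Omega> :: "'a::euclidean_space set"
  assumes s: "0 < s" "s < 1" and N: "2 \<le> DIM('a)" and \<Omega>: "open \<Omega>" "bounded \<Omega>"
    and \<rho>: "\<rho> \<in> Linf \<Omega>" and \<eta>: "\<eta> \<in> Linf \<Omega>" and t: "0 < t" "t < 1"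
    and ind: "lin_indep \<Omega> \<rho> \<eta>" and pos: "0 < mu1_tilde s \<Omega> \<rho>" "0 < mu1_tilde s \<Omega> \<eta>"
  shows "mu1_tilde s \<Omega> (\<lambda>x. t * \<rho> x + (1 - t) * \<eta> x) < t * mu1_tilde s \<Omega> \<rho> + (1 - t) * mu1_tilde s \<Omega> \<eta>"
proof (rule ccontr)
  let ?\<xi> = "\<lambda>x. t * \<rho> x + (1 - t) * \<eta> x"
  let ?r = "mu1_tilde s \<Omega> \<rho>" and ?e = "mu1_tilde s \<Omega> \<eta>" and ?m = "mu1_tilde s \<Omega> ?\<xi>"
  assume "\<not> ?m < t * ?r + (1 - t) * ?e"
  then have ge: "t * ?r + (1 - t) * ?e \<le> ?m" by simp
  have "0 < t * ?r + (1 - t) * ?e" using pos t by (intro add_pos_pos mult_pos_pos) auto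
  then have "?m \<noteq> 0" using ge by linarith
  then have \<xi>pos: "emeasure lebesgue {x \<in> \<Omega>. 0 < ?\<xi> x} > 0" unfolding mu1_tilde_def by presburger
  obtain M w where w: "represents \<Omega> \<rho> M w" using Linf_represents[OF \<Omega>(1) \<rho>] .
  obtain L v where v: "represents \<Omega> \<eta> L v" using Linf_represents[OF \<Omega>(1) \<eta>] .
  note \<zeta> = represents_combination[OF w v, of t "1 - t"]
  have ww: "weight M w" and wv: "weight L v" using w v by (auto simp: represents_def)
  obtain f where f: "f \<in> H0s s \<Omega>" "\<And>x. 0 \<le> f x" "0 < inner_H0s s f f"
    and att: "weight_form (\<lambda>x. t * w x + (1 - t) * v x) f f = ?m * inner_H0s s f f"
    using mu1_tilde_nonneg_maximizer[OF s N \<Omega> \<zeta> \<xi>pos] by blast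
  let ?E = "inner_H0s s f f"
  have rw: "weight_form w f f \<le> ?r * ?E" by (rule mu1_tilde_upper[OF s N \<Omega> w f(1)])
  have ev: "weight_form v f f \<le> ?e * ?E" by (rule mu1_tilde_upper[OF s N \<Omega> v f(1)])
  have "(t * ?r + (1 - t) * ?e) * ?E \<le> ?m * ?E" using ge f(3) by (intro mult_right_mono) auto
  also have "\<dots> = t * weight_form w f f + (1 - t) * weight_form v f f"
    using weight_form_combination[OF ww wv f(1) f(1)] att by simp
  finally have sum: "t * (?r * ?E) + (1 - t) * (?e * ?E) \<le> t * weight_form w f f + (1 - t) * weight_form v f f"
    by (simp add: algebra_simps)
  have tw: "t * weight_form w f f \<le> t * (?r * ?E)" using rw t by (intro mult_left_mono) auto
  have tv: "(1 - t) * weight_form v f f \<le> (1 - t) * (?e * ?E)" using ev t by (intro mult_left_mono) auto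
  have "t * weight_form w f f = t * (?r * ?E)" "(1 - t) * weight_form v f f = (1 - t) * (?e * ?E)"
    using sum tw tv by linarith+
  then have eqw: "weight_form w f f = ?r * ?E" and eqv: "weight_form v f f = ?e * ?E" using t by simp_all
  have ELw: "?r * inner_H0s s f \<phi> = weight_form w f \<phi>" if "\<phi> \<in> H0s s \<Omega>" for \<phi>
    by (rule rayleigh_euler_lagrange[OF ww mu1_tilde_upper[OF s N \<Omega> w] f(1) eqw that])
  have ELv: "?e * inner_H0s s f \<phi> = weight_form v f \<phi>" if "\<phi> \<in> H0s s \<Omega>" for \<phi>
    by (rule rayleigh_euler_lagrange[OF wv mu1_tilde_upper[OF s N \<Omega> v] f(1) eqv that])
  have fpos: "AE x in lebesgue. x \<in> \<Omega> \<longrightarrow> 0 < f x"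
    by (rule maximizer_positive[OF s N \<Omega> ww pos(1) f ELw])
  note \<sigma> = represents_combination[OF w v, of "?e" "- ?r"]
  have "integrable lebesgue (\<lambda>x. (?e * w x + - ?r * v x) * f x)"
    using weight_integrable_mult[OF _ H0s_integrable[OF \<Omega> f(1)]] \<sigma> unfolding represents_def by blast
  moreover have "(\<integral>x. (?e * w x + - ?r * v x) * f x * \<phi> x \<partial>lebesgue) = 0" if \<phi>: "\<phi> \<in> H0s s \<Omega>" for \<phi>
  proof -
    have "weight_form (\<lambda>x. ?e * w x + - ?r * v x) f \<phi> = ?e * (?r * inner_H0s s f \<phi>) + - ?r * (?e * inner_H0s s f \<phi>)"
      unfolding ELw[OF \<phi>] ELv[OF \<phi>] by (rule weight_form_combination[OF ww wv f(1) \<phi>])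
    also have "\<dots> = 0" by simp
    finally show ?thesis unfolding weight_form_def .
  qed
  ultimately have "AE x in lebesgue. x \<in> \<Omega> \<longrightarrow> (?e * w x + - ?r * v x) * f x = 0"
    by (rule H0s_separates[OF s N \<Omega>])
  moreover have "AE x in lebesgue. x \<in> \<Omega> \<longrightarrow> ?e * \<rho> x + - ?r * \<eta> x = ?e * w x + - ?r * v x"
    using \<sigma> unfolding represents_def by blast
  ultimately have "AE x in lebesgue. x \<in> \<Omega> \<longrightarrow> ?e * \<rho> x + - ?r * \<eta> x = 0"
    using fpos by eventually_elim auto
  then have "AE x in lebesgue_on \<Omega>. ?e * \<rho> x + - ?r * \<eta> x = 0"
    using \<Omega>(1) by (subst AE_restrict_space_iff) auto
  then have "?e = 0" using ind unfolding lin_indep_def by blast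
  then show False using pos(2) by simp
qed

section \<open>The closure of a rearrangement class\<close>

lemma Linf_integrable:
  assumes "open \<Omega>" "bounded \<Omega>" "\<rho> \<in> Linf \<Omega>"
  shows "integrable (lebesgue_on \<Omega>) \<rho>"
proof -
  have O: "\<Omega> \<in> lmeasurable" using assms by (simp add: lmeasurable_open)
  then have "emeasure (lebesgue_on \<Omega>) (space (lebesgue_on \<Omega>)) = emeasure lebesgue \<Omega>"
    by (subst emeasure_restrict_space) (auto simp: fmeasurable_def)
  moreover have "emeasure lebesgue \<Omega> \<noteq> \<infinity>"
    using O by (simp add: fmeasurable_def less_top del: emeasure_completion)
  ultimately interpret finite_measure "lebesgue_on \<Omega>" by (intro finite_measureI) simp
  obtain C where "AE x in lebesgue_on \<Omega>. \<bar>\<rho> x\<bar> \<le> C" "\<rho> \<in> borel_measurable (lebesgue_on \<Omega>)"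
    using assms(3) by (auto simp: Linf_def)
  then show ?thesis by (intro integrable_const_bound[of _ C]) auto
qed

text \<open>Rearrangements have the same distribution on the reals, since half-lines generate the Borel sets.\<close>

lemma rearrangement_integral_eq:
  fixes \<Omega> :: "'a::euclidean_space set"
  assumes \<Omega>: "open \<Omega>" "bounded \<Omega>" and \<rho>: "\<rho> \<in> borel_measurable (lebesgue_on \<Omega>)" and g: "g \<in> rearrangements \<Omega> \<rho>"
  shows "(LINT x|lebesgue_on \<Omega>. g x) = (LINT x|lebesgue_on \<Omega>. \<rho> x)"
proof -
  have O: "\<Omega> \<in> lmeasurable" using \<Omega> by (simp add: lmeasurable_open)
  have gm: "g \<in> borel_measurable (lebesgue_on \<Omega>)" using g by (simp add: rearrangements_def)
  have em: "emeasure (distr (lebesgue_on \<Omega>) borel h) {t<..} = emeasure lebesgue {x \<in> \<Omega>. t < h x}"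
    if "h \<in> borel_measurable (lebesgue_on \<Omega>)" for h :: "'a \<Rightarrow> real" and t
  proof -
    have "emeasure (distr (lebesgue_on \<Omega>) borel h) {t<..} = emeasure (lebesgue_on \<Omega>) (h -` {t<..} \<inter> \<Omega>)"
      using that by (subst emeasure_distr) simp_all
    also have "\<dots> = emeasure lebesgue (h -` {t<..} \<inter> \<Omega>)"
      using O by (intro emeasure_restrict_space) (auto simp: fmeasurable_def)
    also have "h -` {t<..} \<inter> \<Omega> = {x \<in> \<Omega>. t < h x}" by auto
    finally show ?thesis .
  qed
  have "distr (lebesgue_on \<Omega>) borel g = distr (lebesgue_on \<Omega>) borel \<rho>"
  proof (rule measure_eqI_lessThan)
    show "emeasure (distr (lebesgue_on \<Omega>) borel g) {t<..} = emeasure (distr (lebesgue_on \<Omega>) borel \<rho>) {t<..}" for t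
      unfolding em[OF gm] em[OF \<rho>] using g by (simp add: rearrangements_def)
    show "emeasure (distr (lebesgue_on \<Omega>) borel g) {t<..} < \<infinity>" for t
    proof -
      have "emeasure lebesgue {x \<in> \<Omega>. t < g x} \<le> emeasure lebesgue \<Omega>"
        using O by (intro emeasure_mono) (auto simp: fmeasurable_def)
      also have "\<dots> < \<infinity>" using O by (simp add: fmeasurable_def del: emeasure_completion)
      finally show ?thesis unfolding em[OF gm] .
    qed
  qed simp_all
  then have "(\<integral>y. y \<partial>distr (lebesgue_on \<Omega>) borel g) = (\<integral>y. y \<partial>distr (lebesgue_on \<Omega>) borel \<rho>)" by simp
  then show ?thesis using gm \<rho> by (simp add: integral_distr)
qed

lemma topspace_weak_star: "topspace (weak_star \<Omega>) \<subseteq> Linf \<Omega>"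
  unfolding weak_star_def topology_generated_by_topspace
  by (rule Union_least) (elim CollectE exE conjE, simp)

lemma openin_weak_star:
  assumes "\<phi> \<in> L1 \<Omega>" "open U"
  shows "openin (weak_star \<Omega>) {\<rho> \<in> Linf \<Omega>. (LINT x|lebesgue_on \<Omega>. \<rho> x * \<phi> x) \<in> U}"
  unfolding weak_star_def
  by (rule topology_generated_by_Basis, rule CollectI, rule exI[of _ \<phi>], rule exI[of _ U])
    (simp add: assms)

text \<open>The constant 1 is integrable on a bounded domain, so the integral is weak* continuous; it is
constant on the rearrangement class.\<close>

lemma weak_star_closure_rearrangements:
  assumes \<Omega>: "open \<Omega>" "bounded \<Omega>" and \<rho>0: "\<rho>0 \<in> Linf \<Omega>"
    and \<rho>: "\<rho> \<in> weak_star \<Omega> closure_of rearrangements \<Omega> \<rho>0"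
  shows "\<rho> \<in> Linf \<Omega>" and "(LINT x|lebesgue_on \<Omega>. \<rho> x) = (LINT x|lebesgue_on \<Omega>. \<rho>0 x)"
proof -
  show L: "\<rho> \<in> Linf \<Omega>"
    using conjunct1[OF iffD1[OF in_closure_of \<rho>]] topspace_weak_star by (rule rev_subsetD)
  show "(LINT x|lebesgue_on \<Omega>. \<rho> x) = (LINT x|lebesgue_on \<Omega>. \<rho>0 x)"
  proof (rule ccontr)
    assume ne: "(LINT x|lebesgue_on \<Omega>. \<rho> x) \<noteq> (LINT x|lebesgue_on \<Omega>. \<rho>0 x)"
    define U where "U = - {LINT x|lebesgue_on \<Omega>. \<rho>0 x}"
    define T where "T = {\<rho> \<in> Linf \<Omega>. (LINT x|lebesgue_on \<Omega>. \<rho> x * 1) \<in> U}"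
    have U: "open U" by (simp add: U_def open_Compl)
    have "(\<lambda>x. 1) \<in> Linf \<Omega>" by (auto simp: Linf_def)
    then have one: "(\<lambda>x. 1) \<in> L1 \<Omega>" using Linf_integrable[OF \<Omega>] by (simp add: L1_def)
    have "openin (weak_star \<Omega>) T" unfolding T_def by (rule openin_weak_star[OF one U])
    moreover have "\<rho> \<in> T" using L ne by (simp add: T_def U_def)
    ultimately obtain g where g: "g \<in> rearrangements \<Omega> \<rho>0" "g \<in> T"
      using conjunct2[OF iffD1[OF in_closure_of \<rho>]] by meson
    have "\<rho>0 \<in> borel_measurable (lebesgue_on \<Omega>)" using \<rho>0 by (simp add: Linf_def)
    from rearrangement_integral_eq[OF \<Omega> this g(1)] show False using g(2) by (simp add: T_def U_def)
  qed
qed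

lemma mu1_tilde_pos_if_integral_pos:
  fixes \<Omega> :: "'a::euclidean_space set"
  assumes s: "0 < s" "s < 1" and N: "2 \<le> DIM('a)" and \<Omega>: "open \<Omega>" "bounded \<Omega>"
    and \<rho>: "\<rho> \<in> Linf \<Omega>" and int: "0 < (LINT x|lebesgue_on \<Omega>. \<rho> x)"
  shows "0 < mu1_tilde s \<Omega> \<rho>"
proof -
  obtain M w where w: "represents \<Omega> \<rho> M w" using Linf_represents[OF \<Omega>(1) \<rho>] .
  have "emeasure lebesgue {x \<in> \<Omega>. 0 < \<rho> x} > 0"
  proof (rule ccontr)
    assume "\<not> emeasure lebesgue {x \<in> \<Omega>. 0 < \<rho> x} > 0"
    then have "{x \<in> \<Omega>. 0 < \<rho> x} \<in> null_sets lebesgue"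
      using represents_positive_set(1)[OF \<Omega>(1) w] by (simp add: null_sets_def not_gr_zero)
    then have "AE x in lebesgue. x \<notin> {x \<in> \<Omega>. 0 < \<rho> x}" by (rule AE_not_in)
    then have "AE x in lebesgue. x \<in> \<Omega> \<longrightarrow> 0 \<le> - \<rho> x" by eventually_elim auto
    then have "AE x in lebesgue_on \<Omega>. 0 \<le> - \<rho> x"
      using \<Omega>(1) by (subst AE_restrict_space_iff) auto
    then have "0 \<le> (LINT x|lebesgue_on \<Omega>. - \<rho> x)" by (rule integral_nonneg_AE)
    then show False using int by simp
  qed
  then show ?thesis using mu1_tilde_attained[OF s N \<Omega> w] by blast
qed

text \<open>Integrating a relation \<open>a \<rho> + b \<eta> = 0\<close> gives \<open>(a + b) c = 0\<close>,
so \<open>b = -a\<close>.\<close>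

lemma lin_indep_if_same_integral:
  assumes \<Omega>: "open \<Omega>" "bounded \<Omega>" and \<rho>: "\<rho> \<in> Linf \<Omega>" and \<eta>: "\<eta> \<in> Linf \<Omega>"
    and int: "(LINT x|lebesgue_on \<Omega>. \<rho> x) = c" "(LINT x|lebesgue_on \<Omega>. \<eta> x) = c" and c: "c \<noteq> 0"
    and ne: "\<not> (AE x in lebesgue_on \<Omega>. \<rho> x = \<eta> x)"
  shows "lin_indep \<Omega> \<rho> \<eta>"
  unfolding lin_indep_def
proof (intro allI impI)
  fix a b assume ab: "AE x in lebesgue_on \<Omega>. a * \<rho> x + b * \<eta> x = 0"
  then have "(LINT x|lebesgue_on \<Omega>. a * \<rho> x + b * \<eta> x) = 0" by (rule integral_eq_zero_AE)
  then have "a * c + b * c = 0"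
    using Linf_integrable[OF \<Omega> \<rho>] Linf_integrable[OF \<Omega> \<eta>] int by simp
  then have b: "b = - a" using c by (simp add: distrib_right[symmetric])
  have "a = 0"
  proof (rule ccontr)
    assume "a \<noteq> 0"
    have "AE x in lebesgue_on \<Omega>. \<rho> x = \<eta> x"
      using ab[unfolded b] by eventually_elim (use \<open>a \<noteq> 0\<close> in simp)
    with ne show False by simp
  qed
  then show "a = 0 \<and> b = 0" using b by simp
qed

theorem theorem4p2:
  fixes \<Omega> :: "'a::euclidean_space set" and s :: real
  assumes "DIM('a) \<ge> 2" and "0 < s" and "s < 1" and "bounded_C2_domain \<Omega>"
  shows
    "(\<forall>\<rho> \<in> Linf \<Omega>. \<forall>\<eta> \<in> Linf \<Omega>. \<forall>t. 0 \<le> t \<and> t \<le> 1 \<longrightarrow>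
        mu1_tilde s \<Omega> (\<lambda>x. t * \<rho> x + (1 - t) * \<eta> x)
          \<le> t * mu1_tilde s \<Omega> \<rho> + (1 - t) * mu1_tilde s \<Omega> \<eta>)
     \<and>
     (\<forall>\<rho> \<in> Linf \<Omega>. \<forall>\<eta> \<in> Linf \<Omega>.
        lin_indep \<Omega> \<rho> \<eta> \<and> mu1_tilde s \<Omega> \<rho> > 0 \<and> mu1_tilde s \<Omega> \<eta> > 0 \<longrightarrow>
        (\<forall>t. 0 < t \<and> t < 1 \<longrightarrow>
           mu1_tilde s \<Omega> (\<lambda>x. t * \<rho> x + (1 - t) * \<eta> x)
             < t * mu1_tilde s \<Omega> \<rho> + (1 - t) * mu1_tilde s \<Omega> \<eta>))
     \<and>
     (\<forall>\<rho>0 \<in> Linf \<Omega>. (LINT x|lebesgue_on \<Omega>. \<rho>0 x) > 0 \<longrightarrow>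
        (\<forall>\<rho> \<in> weak_star \<Omega> closure_of rearrangements \<Omega> \<rho>0.
         \<forall>\<eta> \<in> weak_star \<Omega> closure_of rearrangements \<Omega> \<rho>0.
           \<not> (AE x in lebesgue_on \<Omega>. \<rho> x = \<eta> x) \<longrightarrow>
           (\<forall>t. 0 < t \<and> t < 1 \<longrightarrow>
              mu1_tilde s \<Omega> (\<lambda>x. t * \<rho> x + (1 - t) * \<eta> x)
                < t * mu1_tilde s \<Omega> \<rho> + (1 - t) * mu1_tilde s \<Omega> \<eta>)))"
proof -
  note s = assms(2,3) and N = assms(1)
  have \<Omega>: "open \<Omega>" "bounded \<Omega>" using assms(4) by (simp_all add: bounded_C2_domain_def)
  have strict: "mu1_tilde s \<Omega> (\<lambda>x. t * \<rho> x + (1 - t) * \<eta> x) < t * mu1_tilde s \<Omega> \<rho> + (1 - t) * mu1_tilde s \<Omega> \<eta>"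
    if \<rho>0: "\<rho>0 \<in> Linf \<Omega>" and pos: "0 < (LINT x|lebesgue_on \<Omega>. \<rho>0 x)"
      and \<rho>: "\<rho> \<in> weak_star \<Omega> closure_of rearrangements \<Omega> \<rho>0"
      and \<eta>: "\<eta> \<in> weak_star \<Omega> closure_of rearrangements \<Omega> \<rho>0"
      and ne: "\<not> (AE x in lebesgue_on \<Omega>. \<rho> x = \<eta> x)" and t: "0 < t" "t < 1"
    for \<rho>0 \<rho> \<eta> :: "'a \<Rightarrow> real" and t :: real
  proof -
    note \<rho>' = weak_star_closure_rearrangements[OF \<Omega> \<rho>0 \<rho>]
    note \<eta>' = weak_star_closure_rearrangements[OF \<Omega> \<rho>0 \<eta>]
    have "(LINT x|lebesgue_on \<Omega>. \<rho>0 x) \<noteq> 0" using pos by (rule less_imp_neq[symmetric])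
    then have "lin_indep \<Omega> \<rho> \<eta>"
      by (rule lin_indep_if_same_integral[OF \<Omega> \<rho>'(1) \<eta>'(1) \<rho>'(2) \<eta>'(2) _ ne])
    moreover have "0 < mu1_tilde s \<Omega> \<rho>"
      by (rule mu1_tilde_pos_if_integral_pos[OF s N \<Omega> \<rho>'(1)]) (use pos \<rho>'(2) in linarith)
    moreover have "0 < mu1_tilde s \<Omega> \<eta>"
      by (rule mu1_tilde_pos_if_integral_pos[OF s N \<Omega> \<eta>'(1)]) (use pos \<eta>'(2) in linarith)
    ultimately show ?thesis
      by (rule mu1_tilde_strictly_convex[OF s N \<Omega> \<rho>'(1) \<eta>'(1) t])
  qed
  show ?thesis
    by (intro conjI ballI allI impI; (elim conjE)?)
      (rule mu1_tilde_convex[OF s N \<Omega>] mu1_tilde_strictly_convex[OF s N \<Omega>] strict; assumption)+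
qed

end
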